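(* Let $a<b$ be real numbers and let $r\in[a,b]$ be real with $r\neq a$ and $r\neq b$. For all Dirac-like (at $r$) measurable functions $\delta_r\in\mathcal{L}^1([a,b]_{\mathcal{R}})$ and for all $f\in C^0([a,b])$, if $\{\overline{p}_n\}_{n\in\mathbb{N}}$ is the sequence of canonical extensions to $[a,b]_{\mathcal{R}}$ of the best uniform polynomial approximations of $f$, then $$\lim_{n\to\infty}{}^\circ\!\left(\int_{[a,b]_{\mathcal{R}}}\delta_r\cdot\overline{p}_n\right)=\lim_{n\to\infty}\left(\int_{[a,b]_{\mathcal{R}}}\delta_r\cdot\overline{p}_n\right)[0]=f(r).$$
   Context: A set $F\subset\mathbb{Q}$ is left-finite if $\{x\in F: x\le q\}$ is finite for every $q\in\mathbb{Q}$. The Levi-Civita field $\mathcal{R}$ is the set of functions $x:\mathbb{Q}\to\mathbb{R}$ (values written $x[q]$) whose support $\{q: x[q]\neq 0\}$ is left-finite, with pointwise sum and product $(x\cdot y)[q]=\sum_{q_1+q_2=q}x[q_1]y[q_2]$. For $x\ne 0$, $\lambda(x)=\min\operatorname{supp}(x)$, and $\lambda(0)=\infty$. For $x\neq y$, $x<y$ iff $(x-y)[\lambda(x-y)]<0$. This makes $\mathcal{R}$ an ordered field containing $\mathbb{R}$. $M_o=\{\varepsilon\in\mathcal{R}:0<\lambda(\varepsilon)<\infty\}$ is the set of nonzero infinitesimals. The standard part ${}^\circ x$ is $x[0]$ if $\lambda(x)\ge 0$, and $+\infty$ (resp. $-\infty$) if $\lambda(x)<0$ and $x>0$ (resp. $x<0$).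 $[a,b]_{\mathcal{R}}=\{x\in\mathcal{R}:a\le x\le b\}$. A sequence strongly converges to $l$ if for every $\varepsilon\in\mathcal{R}$, $\varepsilon>0$, eventually $|a_n-l|<\varepsilon$. It weakly converges to $l\in\mathcal{R}$ if for every real $\varepsilon>0$, eventually $\max_{q\in\mathbb{Q},q\le\varepsilon^{-1}}|(a_n-l)[q]|<\varepsilon$. For $a\le b$ in $\mathcal{R}$, $I(a,b)$ denotes any of the four intervals of $\mathcal{R}$ with endpoints $a,b$ (degenerate intervals allowed), with length $l(I(a,b))=b-a$. A set $A\subseteq\mathcal{R}$ is measurable iff for every $\varepsilon\in\mathcal{R}$, $\varepsilon>0$, there are two sequences of mutually disjoint intervals $\{I_n\}$, $\{J_n\}$ such that $\bigcup_n I_n\subseteq A\subseteq\bigcup_n J_n$, $\sum_n l(I_n)$ and $\sum_n l(J_n)$ strongly converge, and $\sum_n l(J_n)-\sum_n l(I_n)\le\varepsilon$. The measure $m(A)\in\mathcal{R}$ is the (existing) supremum of such inner sums, equal to the infimum of such outer sums. A function $f$ is simple on an interval $I$ if there are $x_0,a_k\in\mathcal{R}$ such that for every $x\in I$ the partial sums $\sum_{k\le K}a_k(x-x_0)^k$ weakly converge to $f(x)$. For $A$ measurable, $f:A\to\mathcal{R}$ is measurable ($f\in\mathcal{M}(A)$) iff for every $\varepsilon\in\mathcal{R}$, $\varepsilon>0$, there is a sequence of mutually disjoint intervals $\{I_n\}$ with $\bigcup_n I_n\subseteq A$, $\sum_n l(I_n)$ strongly convergent, $m(A)-\sum_n l(I_n)<\varepsilon$,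 and $f$ simple on each $I_n$. If $f$ is simple on $I(a,b)$ with (termwise) antiderivative $F$, $\int_{I(a,b)}f=\lim_{x\to b}F(x)-\lim_{x\to a}F(x)$. For $f\in\mathcal{M}(A)$, $\int_A f$ is the limit of $\sum_n\int_{I_n}f$ (strong sum) over sequences of mutually disjoint intervals $\{I_n\}$ with $\bigcup_n I_n\subseteq A$ and $f$ simple on each $I_n$, as $\sum_n l(I_n)\to m(A)$; it is $\pm\infty$ if the partial sums diverge (eventually exceed every element of $\mathcal R$, resp. for the negatives), and undefined if the limit does not exist. $\mathcal{L}^1(A)$ is the set of $f\in\mathcal{M}(A)$ such that $\int_A|f|$ is defined and finite, with $\|f\|_1=\int_A|f|$. Dirac-like: $\delta_r\in\mathcal{L}^1(A)$ is Dirac-like at $r\in A$ iff $\delta_r(x)\ge 0$ for all $x\in A$; there is $h\in M_o$, $h>0$, with $\{x:\delta_r(x)\neq0\}\subseteq[r-h,r+h]_{\mathcal{R}}\subseteq A$; and $\|\delta_r\|_1=1$. Approximations: for $f\in C^0([a,b])$ and $n\in\mathbb{N}$, $p_n^f$ is the unique real polynomial of degree at most $n$ minimizing $\|f-p\|_\infty$ on $[a,b]$ among real polynomials $p$ of degree at most $n$; $\overline{p}_n:[a,b]_{\mathcal{R}}\to\mathcal{R}$ is the same polynomial evaluated on $[a,b]_{\mathcal{R}}$. *)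

theory Defs
  imports "HOL-Analysis.Analysis"
begin

section \<open>The Levi-Civita field\<close>

definition left_finite :: "rat set \<Rightarrow> bool" where
  "left_finite F \<longleftrightarrow> (\<forall>q. finite {x \<in> F. x \<le> q})"

typedef lc = "{x :: rat \<Rightarrow> real. left_finite {q. x q \<noteq> 0}}"
  morphisms lc_coeff Abs_lc
  by (rule exI[of _ "\<lambda>_. 0"]) (simp add: left_finite_def)

setup_lifting type_definition_lc

lemma lc_eqI: "(\<And>q. lc_coeff x q = lc_coeff y q) \<Longrightarrow> x = y"
  by (simp add: lc_coeff_inject[symmetric] fun_eq_iff)

lemma left_finite_subset: "left_finite G \<Longrightarrow> F \<subseteq> G \<Longrightarrow> left_finite F"
  unfolding left_finite_def
proof
  fix q
  assume G: "\<forall>q. finite {x \<in> G. x \<le> q}" and sub: "F \<subseteq> G"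
  show "finite {x \<in> F. x \<le> q}"
    by (rule finite_subset[OF _ G[rule_format, of q]]) (use sub in blast)
qed

lemma left_finite_Un: "left_finite F \<Longrightarrow> left_finite G \<Longrightarrow> left_finite (F \<union> G)"
  unfolding left_finite_def by (simp add: conj_disj_distribR Collect_disj_eq)

lemma left_finite_bound:
  assumes "left_finite F"
  shows "\<exists>m. \<forall>q\<in>F. m \<le> q"
proof (intro exI ballI)
  fix q assume q: "q \<in> F"
  have fin: "finite (insert 0 {x \<in> F. x \<le> 0})" using assms by (simp add: left_finite_def)
  show "Min (insert 0 {x \<in> F. x \<le> 0}) \<le> q"
  proof (cases "q \<le> 0")
    case True
    then show ?thesis using q fin by (intro Min_le) auto
  next
    case False
    have "Min (insert 0 {x \<in> F. x \<le> 0}) \<le> 0" using fin by (intro Min_le) auto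
    then show ?thesis using False by linarith
  qed
qed

lemma left_finite_coeff: "left_finite {q. lc_coeff x q \<noteq> 0}"
  using lc_coeff by auto

lemma lc_bound: "\<exists>m. \<forall>q. lc_coeff x q \<noteq> 0 \<longrightarrow> m \<le> q"
  using left_finite_bound[OF left_finite_coeff[of x]] by simp

lemma finite_lc_trunc: "finite {q. lc_coeff x q \<noteq> 0 \<and> q \<le> c}"
  using left_finite_coeff[of x] by (auto simp: left_finite_def)

lemma finite_conv:
  assumes "left_finite {q. x q \<noteq> (0::real)}" "left_finite {q. y q \<noteq> (0::real)}"
  shows "finite {p. x p \<noteq> 0 \<and> y (q - p) \<noteq> 0}"
proof -
  obtain m where m: "\<And>r. r \<in> {q. y q \<noteq> 0} \<Longrightarrow> m \<le> r" using left_finite_bound[OF assms(2)] by blast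
  have "{p. x p \<noteq> 0 \<and> y (q - p) \<noteq> 0} \<subseteq> {p \<in> {q. x q \<noteq> 0}. p \<le> q - m}"
    using m by (force simp: algebra_simps)
  moreover have "finite {p \<in> {q. x q \<noteq> 0}. p \<le> q - m}"
    using assms(1) unfolding left_finite_def by blast
  ultimately show ?thesis by (rule finite_subset)
qed

instantiation lc :: "{zero, one, plus, minus, uminus, times, scaleR}"
begin

lift_definition zero_lc :: lc is "\<lambda>_. 0" by (simp add: left_finite_def)

lift_definition one_lc :: lc is "\<lambda>q. if q = 0 then 1 else 0"
  by (simp add: left_finite_def)

lift_definition plus_lc :: "lc \<Rightarrow> lc \<Rightarrow> lc" is "\<lambda>x y q. x q + y q"
  by (erule left_finite_subset[OF left_finite_Un]) auto

lift_definition minus_lc :: "lc \<Rightarrow> lc \<Rightarrow> lc" is "\<lambda>x y q. x q - y q"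
  by (erule left_finite_subset[OF left_finite_Un]) auto

lift_definition uminus_lc :: "lc \<Rightarrow> lc" is "\<lambda>x q. - x q"
  by simp

lift_definition scaleR_lc :: "real \<Rightarrow> lc \<Rightarrow> lc" is "\<lambda>c x q. c * x q"
  by (erule left_finite_subset) auto

lift_definition times_lc :: "lc \<Rightarrow> lc \<Rightarrow> lc"
  is "\<lambda>x y q. \<Sum>p | x p \<noteq> 0 \<and> y (q - p) \<noteq> 0. x p * y (q - p)"
proof -
  fix x y :: "rat \<Rightarrow> real"
  let ?X = "{q. x q \<noteq> 0}" and ?Y = "{q. y q \<noteq> 0}"
  assume x: "left_finite ?X" and y: "left_finite ?Y"
  obtain mx where mx: "\<And>r. r \<in> ?X \<Longrightarrow> mx \<le> r" using left_finite_bound[OF x] by blast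
  obtain my where my: "\<And>r. r \<in> ?Y \<Longrightarrow> my \<le> r" using left_finite_bound[OF y] by blast
  show "left_finite {q. (\<Sum>p | x p \<noteq> 0 \<and> y (q - p) \<noteq> 0. x p * y (q - p)) \<noteq> 0}"
    unfolding left_finite_def
  proof
    fix c
    let ?S = "(\<lambda>(p, r). p + r) ` ({p \<in> ?X. p \<le> c - my} \<times> {p \<in> ?Y. p \<le> c - mx})"
    have "q \<in> ?S" if q: "(\<Sum>p | x p \<noteq> 0 \<and> y (q - p) \<noteq> 0. x p * y (q - p)) \<noteq> 0" and c: "q \<le> c" for q
    proof -
      obtain p where "p \<in> {p. x p \<noteq> 0 \<and> y (q - p) \<noteq> 0}"
        using sum.not_neutral_contains_not_neutral[OF q] by blast
      then have p: "x p \<noteq> 0" "y (q - p) \<noteq> 0" by simp_all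
      have "mx \<le> p" "my \<le> q - p" using p mx[of p] my[of "q - p"] by simp_all
      then have "(p, q - p) \<in> {p \<in> ?X. p \<le> c - my} \<times> {p \<in> ?Y. p \<le> c - mx}"
        using p c by auto
      then show ?thesis by (rule rev_image_eqI) simp
    qed
    then have sub: "{q \<in> {q. (\<Sum>p | x p \<noteq> 0 \<and> y (q - p) \<noteq> 0. x p * y (q - p)) \<noteq> 0}. q \<le> c} \<subseteq> ?S"
      by blast
    have fin: "finite ?S"
      using x y unfolding left_finite_def by (intro finite_imageI finite_cartesian_product) blast+
    show "finite {q \<in> {q. (\<Sum>p | x p \<noteq> 0 \<and> y (q - p) \<noteq> 0. x p * y (q - p)) \<noteq> 0}. q \<le> c}"
      by (rule finite_subset[OF sub fin])
  qed
qed

instance ..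
end

lemma lc_coeff_simps [simp]:
  "lc_coeff 0 q = 0"
  "lc_coeff 1 q = (if q = 0 then 1 else 0)"
  "lc_coeff (x + y) q = lc_coeff x q + lc_coeff y q"
  "lc_coeff (x - y) q = lc_coeff x q - lc_coeff y q"
  "lc_coeff (- x) q = - lc_coeff x q"
  "lc_coeff (c *\<^sub>R x) q = c * lc_coeff x q"
  by (transfer; simp)+

lemma lc_coeff_mult:
  "lc_coeff (x * y) q =
    (\<Sum>p | lc_coeff x p \<noteq> 0 \<and> lc_coeff y (q - p) \<noteq> 0. lc_coeff x p * lc_coeff y (q - p))"
  by transfer simp

lemma lc_coeff_mult_left:
  assumes "finite S" "\<And>p. lc_coeff x p \<noteq> 0 \<Longrightarrow> lc_coeff y (q - p) \<noteq> 0 \<Longrightarrow> p \<in> S"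
  shows "lc_coeff (x * y) q = (\<Sum>p\<in>S. lc_coeff x p * lc_coeff y (q - p))"
  unfolding lc_coeff_mult by (rule sum.mono_neutral_left) (use assms in auto)

lemma lc_mult_commute: "x * y = y * (x :: lc)"
proof (rule lc_eqI)
  fix q
  show "lc_coeff (x * y) q = lc_coeff (y * x) q"
    unfolding lc_coeff_mult
    by (rule sum.reindex_bij_witness[of _ "\<lambda>p. q - p" "\<lambda>p. q - p"]) auto
qed

lemma lc_mult_assoc: "x * y * z = x * (y * (z :: lc))"
proof (rule lc_eqI)
  fix q
  obtain mx where mx: "\<And>r. lc_coeff x r \<noteq> 0 \<Longrightarrow> mx \<le> r" using lc_bound[of x] by blast
  obtain my where my: "\<And>r. lc_coeff y r \<noteq> 0 \<Longrightarrow> my \<le> r" using lc_bound[of y] by blast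
  obtain mz where mz: "\<And>r. lc_coeff z r \<noteq> 0 \<Longrightarrow> mz \<le> r" using lc_bound[of z] by blast
  have lower: "mu + mv \<le> s" if nz: "lc_coeff (u * v) s \<noteq> 0"
    and lb: "\<And>r. lc_coeff u r \<noteq> 0 \<Longrightarrow> mu \<le> r" "\<And>r. lc_coeff v r \<noteq> 0 \<Longrightarrow> mv \<le> r" for u v s mu mv
  proof -
    obtain p where "p \<in> {p. lc_coeff u p \<noteq> 0 \<and> lc_coeff v (s - p) \<noteq> 0}"
      using sum.not_neutral_contains_not_neutral[OF nz[unfolded lc_coeff_mult]] by blast
    then have "mu \<le> p" "mv \<le> s - p" using lb(1)[of p] lb(2)[of "s - p"] by simp_all
    then show ?thesis by linarith
  qed
  define P where "P = {p. lc_coeff x p \<noteq> 0 \<and> p \<le> q - (my + mz)}"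
  define T where "T = {p. lc_coeff z p \<noteq> 0 \<and> p \<le> q - (mx + my)}"
  have fin: "finite P" "finite T" unfolding P_def T_def by (rule finite_lc_trunc)+
  have inner1: "lc_coeff (x * y) (q - t) = (\<Sum>p\<in>P. lc_coeff x p * lc_coeff y (q - t - p))"
    if "t \<in> T" for t
    by (rule lc_coeff_mult_left[OF fin(1)])
      (use that my mz in \<open>force simp: P_def T_def algebra_simps\<close>)
  have inner2: "lc_coeff (z * y) (q - p) = (\<Sum>t\<in>T. lc_coeff z t * lc_coeff y (q - p - t))"
    if "p \<in> P" for p
    by (rule lc_coeff_mult_left[OF fin(2)])
      (use that mx my in \<open>force simp: P_def T_def algebra_simps\<close>)
  have "lc_coeff (z * (x * y)) q = (\<Sum>t\<in>T. lc_coeff z t * lc_coeff (x * y) (q - t))"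
    by (rule lc_coeff_mult_left[OF fin(2)])
      (use lower[OF _ mx my] in \<open>force simp: T_def algebra_simps\<close>)
  also have "\<dots> = (\<Sum>t\<in>T. \<Sum>p\<in>P. lc_coeff z t * lc_coeff x p * lc_coeff y (q - t - p))"
    by (simp add: inner1 sum_distrib_left mult_ac)
  also have "\<dots> = (\<Sum>p\<in>P. \<Sum>t\<in>T. lc_coeff x p * (lc_coeff z t * lc_coeff y (q - p - t)))"
    by (subst sum.swap) (simp add: mult_ac diff_diff_add add.commute)
  also have "\<dots> = (\<Sum>p\<in>P. lc_coeff x p * lc_coeff (z * y) (q - p))"
    by (simp add: inner2 sum_distrib_left)
  also have "\<dots> = lc_coeff (x * (z * y)) q"
    by (rule lc_coeff_mult_left[OF fin(1), symmetric])
      (use lower[OF _ mz my] in \<open>force simp: P_def algebra_simps\<close>)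
  finally show "lc_coeff (x * y * z) q = lc_coeff (x * (y * z)) q"
    by (simp add: lc_mult_commute)
qed

instance lc :: "{comm_ring_1, real_algebra_1}"
proof
  fix x y z :: lc and c d :: real
  show "x * y * z = x * (y * z)" by (rule lc_mult_assoc)
  show "x * y = y * x" by (rule lc_mult_commute)
  show one: "1 * x = x"
  proof (rule lc_eqI)
    fix q
    have "lc_coeff (1 * x) q = (\<Sum>p\<in>{0}. lc_coeff 1 p * lc_coeff x (q - p))"
      by (rule lc_coeff_mult_left) (auto split: if_splits)
    then show "lc_coeff (1 * x) q = lc_coeff x q" by simp
  qed
  then show "x * 1 = x" by (simp add: lc_mult_commute)
  show distrib: "(x + y) * z = x * z + y * z" for x y z :: lc
  proof (rule lc_eqI)
    fix q
    let ?S = "{p. lc_coeff x p \<noteq> 0 \<and> lc_coeff z (q - p) \<noteq> 0}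
      \<union> {p. lc_coeff y p \<noteq> 0 \<and> lc_coeff z (q - p) \<noteq> 0}"
    have fin: "finite ?S" by (intro finite_UnI finite_conv left_finite_coeff)
    have "lc_coeff (x * z) q = (\<Sum>p\<in>?S. lc_coeff x p * lc_coeff z (q - p))"
      by (rule lc_coeff_mult_left[OF fin]) auto
    moreover have "lc_coeff (y * z) q = (\<Sum>p\<in>?S. lc_coeff y p * lc_coeff z (q - p))"
      by (rule lc_coeff_mult_left[OF fin]) auto
    moreover have "lc_coeff ((x + y) * z) q = (\<Sum>p\<in>?S. lc_coeff (x + y) p * lc_coeff z (q - p))"
      by (rule lc_coeff_mult_left[OF fin]) auto
    ultimately show "lc_coeff ((x + y) * z) q = lc_coeff (x * z + y * z) q"
      by (simp add: distrib_right sum.distrib)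
  qed
  show "x * (y + z) = x * y + x * z"
    using distrib[of y z x] by (simp add: lc_mult_commute)
  show scale: "(c *\<^sub>R x) * y = c *\<^sub>R (x * y)" for x y :: lc
  proof (rule lc_eqI)
    fix q
    let ?S = "{p. lc_coeff x p \<noteq> 0 \<and> lc_coeff y (q - p) \<noteq> 0}"
    have fin: "finite ?S" by (intro finite_conv left_finite_coeff)
    have "lc_coeff ((c *\<^sub>R x) * y) q = (\<Sum>p\<in>?S. lc_coeff (c *\<^sub>R x) p * lc_coeff y (q - p))"
      by (rule lc_coeff_mult_left[OF fin]) auto
    then show "lc_coeff ((c *\<^sub>R x) * y) q = lc_coeff (c *\<^sub>R (x * y)) q"
      by (simp add: lc_coeff_mult[of x y] sum_distrib_left mult_ac)
  qed
  show "x * (c *\<^sub>R y) = c *\<^sub>R (x * y)"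
    using scale[of y x] by (simp add: lc_mult_commute)
  show "(0::lc) \<noteq> 1" by (metis lc_coeff_simps(1,2) zero_neq_one)
qed (rule lc_eqI; simp add: algebra_simps)+

text \<open>
  The exponent of the leading term; only meaningful for \<open>x \<noteq> 0\<close>, where the support has a
  minimum by left-finiteness.
\<close>

definition lc_lead :: "lc \<Rightarrow> rat" where
  "lc_lead x = (LEAST q. lc_coeff x q \<noteq> 0)"

lemma lc_lead_props:
  assumes "x \<noteq> 0"
  shows "lc_coeff x (lc_lead x) \<noteq> 0" "lc_coeff x q \<noteq> 0 \<Longrightarrow> lc_lead x \<le> q"
proof -
  obtain q0 where q0: "lc_coeff x q0 \<noteq> 0" using assms by (metis lc_eqI lc_coeff_simps(1))
  define F where "F = {q. lc_coeff x q \<noteq> 0 \<and> q \<le> q0}"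
  have F: "finite F" "F \<noteq> {}" using q0 finite_lc_trunc by (auto simp: F_def)
  have min: "lc_coeff x (Min F) \<noteq> 0" using Min_in[OF F] by (simp add: F_def)
  have le: "Min F \<le> q" if "lc_coeff x q \<noteq> 0" for q
  proof (cases "q \<le> q0")
    case True
    then show ?thesis using that F by (auto simp: F_def)
  next
    case False
    then show ?thesis using Min_in[OF F] by (auto simp: F_def)
  qed
  have "lc_lead x = Min F" unfolding lc_lead_def by (rule Least_equality) (use min le in auto)
  then show "lc_coeff x (lc_lead x) \<noteq> 0" "lc_coeff x q \<noteq> 0 \<Longrightarrow> lc_lead x \<le> q"
    using min le by auto
qed

lemma lc_coeff_below_lead: "q < lc_lead x \<Longrightarrow> lc_coeff x q = 0"
  by (metis lc_coeff_simps(1) lc_lead_props(2) not_le)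

lemma lc_leadI:
  assumes "lc_coeff x q \<noteq> 0" "\<And>p. p < q \<Longrightarrow> lc_coeff x p = 0"
  shows "lc_lead x = q"
  unfolding lc_lead_def by (rule Least_equality) (use assms not_le in auto)

lemma lc_lead_uminus [simp]: "lc_lead (- x) = lc_lead x"
  by (simp add: lc_lead_def)

lemma lc_lead_mult:
  assumes "x \<noteq> 0" "y \<noteq> 0"
  shows "lc_lead (x * y) = lc_lead x + lc_lead y"
    "lc_coeff (x * y) (lc_lead x + lc_lead y) = lc_coeff x (lc_lead x) * lc_coeff y (lc_lead y)"
proof -
  have "lc_coeff (x * y) (lc_lead x + lc_lead y) =
      (\<Sum>p\<in>{lc_lead x}. lc_coeff x p * lc_coeff y (lc_lead x + lc_lead y - p))"
  proof (rule lc_coeff_mult_left)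
    fix p assume "lc_coeff x p \<noteq> 0" "lc_coeff y (lc_lead x + lc_lead y - p) \<noteq> 0"
    then show "p \<in> {lc_lead x}"
      using lc_lead_props(2)[OF assms(1), of p]
        lc_lead_props(2)[OF assms(2), of "lc_lead x + lc_lead y - p"] by simp
  qed simp
  then show eq: "lc_coeff (x * y) (lc_lead x + lc_lead y) =
      lc_coeff x (lc_lead x) * lc_coeff y (lc_lead y)" by simp
  show "lc_lead (x * y) = lc_lead x + lc_lead y"
  proof (rule lc_leadI)
    show "lc_coeff (x * y) (lc_lead x + lc_lead y) \<noteq> 0"
      using eq lc_lead_props(1) assms by simp
    fix q assume "q < lc_lead x + lc_lead y"
    then have "lc_coeff (x * y) q = (\<Sum>p\<in>{}. lc_coeff x p * lc_coeff y (q - p))"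
      by (intro lc_coeff_mult_left)
        (use lc_lead_props(2)[OF assms(1)] lc_lead_props(2)[OF assms(2)] in \<open>force\<close>)+
    then show "lc_coeff (x * y) q = 0" by simp
  qed
qed

instantiation lc :: "{ord, abs, sgn}"
begin

definition less_lc :: "lc \<Rightarrow> lc \<Rightarrow> bool" where
  "x < y \<longleftrightarrow> x \<noteq> y \<and> lc_coeff (x - y) (lc_lead (x - y)) < 0"

definition less_eq_lc :: "lc \<Rightarrow> lc \<Rightarrow> bool" where
  "x \<le> y \<longleftrightarrow> x = y \<or> x < (y :: lc)"

definition abs_lc :: "lc \<Rightarrow> lc" where
  "\<bar>x\<bar> = (if x < 0 then - x else (x :: lc))"

definition sgn_lc :: "lc \<Rightarrow> lc" where
  "sgn (x :: lc) = (if x = 0 then 0 else if 0 < x then 1 else - 1)"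

instance ..
end

lemma lc_less_iff: "x < y \<longleftrightarrow> 0 < y - (x :: lc)"
  by (auto simp: less_lc_def)

lemma lc_pos_iff: "0 < x \<longleftrightarrow> 0 < lc_coeff x (lc_lead x)"
proof (cases "x = 0")
  case True
  then show ?thesis by (simp add: less_lc_def)
next
  case False
  have "lc_lead (0 - x) = lc_lead x" by (metis diff_0 lc_lead_uminus)
  then show ?thesis using False by (auto simp: less_lc_def)
qed

lemma lc_pos_cases: "x = 0 \<or> 0 < x \<or> 0 < - (x :: lc)"
  unfolding lc_pos_iff using lc_lead_props(1)[of x] by auto

lemma lc_pos_asym: "0 < x \<Longrightarrow> \<not> 0 < - (x :: lc)"
  unfolding lc_pos_iff by simp

lemma lc_pos_add:
  assumes "0 < x" "0 < (y :: lc)"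
  shows "0 < x + y"
proof -
  have main: "0 < x + y" if le: "lc_lead x \<le> lc_lead y" and p: "0 < x" "0 < y" for x y :: lc
  proof -
    have "lc_coeff y (lc_lead x) \<ge> 0"
      using le p(2) lc_coeff_below_lead[of "lc_lead x" y]
      unfolding lc_pos_iff by (cases "lc_lead x = lc_lead y") auto
    then have c: "lc_coeff (x + y) (lc_lead x) > 0" using p(1) unfolding lc_pos_iff by simp
    have "lc_lead (x + y) = lc_lead x"
      by (rule lc_leadI) (use c le lc_coeff_below_lead in auto)
    then show ?thesis using c unfolding lc_pos_iff by simp
  qed
  show ?thesis
    using main[of x y] main[of y x] assms by (metis add.commute linear)
qed

lemma lc_pos_mult:
  assumes "0 < x" "0 < (y :: lc)"
  shows "0 < x * y"
proof -
  have "x \<noteq> 0" "y \<noteq> 0" using assms by (auto simp: less_lc_def)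
  then show ?thesis using assms lc_lead_mult[of x y] unfolding lc_pos_iff by simp
qed

instance lc :: linordered_idom
proof
  fix x y z :: lc
  have irr: "\<not> x < x" for x :: lc by (simp add: less_lc_def)
  have tr: "x < y \<Longrightarrow> y < z \<Longrightarrow> x < z" for x y z :: lc
    using lc_pos_add[of "y - x" "z - y"] by (simp add: lc_less_iff[of x] lc_less_iff[of y])
  have asym: "x < y \<Longrightarrow> \<not> y < x" for x y :: lc using irr tr by blast
  show "(x < y) = (x \<le> y \<and> \<not> y \<le> x)" using irr asym by (auto simp: less_eq_lc_def)
  show "x \<le> x" by (simp add: less_eq_lc_def)
  show "x \<le> y \<Longrightarrow> y \<le> z \<Longrightarrow> x \<le> z" using tr by (auto simp: less_eq_lc_def)
  show "x \<le> y \<Longrightarrow> y \<le> x \<Longrightarrow> x = y" using asym by (auto simp: less_eq_lc_def)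
  show "x \<le> y \<or> y \<le> x"
    using lc_pos_cases[of "y - x"] by (auto simp: less_eq_lc_def lc_less_iff[of x] lc_less_iff[of y])
  show "x \<le> y \<Longrightarrow> z + x \<le> z + y"
    by (auto simp: less_eq_lc_def lc_less_iff[of x] lc_less_iff[of "z + x"])
  show "x < y \<Longrightarrow> 0 < z \<Longrightarrow> z * x < z * y"
    using lc_pos_mult[of z "y - x"]
    by (simp add: lc_less_iff[of x] lc_less_iff[of "z * x"] right_diff_distrib)
  show "\<bar>x\<bar> = (if x < 0 then - x else x)" by (rule abs_lc_def)
  show "sgn x = (if x = 0 then 0 else if 0 < x then 1 else - 1)" by (rule sgn_lc_def)
qed

definition lc_val :: "lc \<Rightarrow> ereal" where
  "lc_val x = (if x = 0 then \<infinity> else ereal (of_rat (lc_lead x)))"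

definition nonzero_infinitesimals :: "lc set" where
  "nonzero_infinitesimals = {x. 0 < lc_val x \<and> lc_val x < \<infinity>}"

definition standard_part :: "lc \<Rightarrow> ereal" where
  "standard_part x =
    (if 0 \<le> lc_val x then ereal (lc_coeff x 0) else if 0 < x then \<infinity> else - \<infinity>)"

section \<open>Strong and weak convergence\<close>

definition strong_lim :: "(nat \<Rightarrow> lc) \<Rightarrow> lc \<Rightarrow> bool" where
  "strong_lim X l \<longleftrightarrow> (\<forall>e>0. \<forall>\<^sub>F n in sequentially. \<bar>X n - l\<bar> < e)"

definition strong_sums :: "(nat \<Rightarrow> lc) \<Rightarrow> lc \<Rightarrow> bool" where
  "strong_sums X s \<longleftrightarrow> strong_lim (\<lambda>n. \<Sum>k\<le>n. X k) s"

text \<open>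
  By left-finiteness only finitely many \<open>q \<le> 1 / e\<close> have a nonzero coefficient, so the bound on
  the maximum amounts to a bound on every coefficient.
\<close>

definition weak_lim :: "(nat \<Rightarrow> lc) \<Rightarrow> lc \<Rightarrow> bool" where
  "weak_lim X l \<longleftrightarrow> (\<forall>e::real. e > 0 \<longrightarrow>
    (\<forall>\<^sub>F n in sequentially. \<forall>q. of_rat q \<le> 1 / e \<longrightarrow> \<bar>lc_coeff (X n - l) q\<bar> < e))"

definition lc_limit_within :: "(lc \<Rightarrow> lc) \<Rightarrow> lc \<Rightarrow> lc set \<Rightarrow> lc \<Rightarrow> bool" where
  "lc_limit_within F c S l \<longleftrightarrow>
    (\<forall>e>0. \<exists>d>0. \<forall>x\<in>S. x \<noteq> c \<longrightarrow> \<bar>x - c\<bar> < d \<longrightarrow> \<bar>F x - l\<bar> < e)"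

section \<open>Intervals, measurable sets and measure\<close>

text \<open>
  \<open>Ivl a b s t\<close> is the interval with endpoints \<open>a\<close> and \<open>b\<close>; the flags \<open>s\<close> and \<open>t\<close> tell whether
  the left and the right endpoint belong to it.
\<close>

datatype lc_ivl = Ivl (lower: lc) (upper: lc) (left_closed: bool) (right_closed: bool)

definition ivl_set :: "lc_ivl \<Rightarrow> lc set" where
  "ivl_set J = {x. (if left_closed J then lower J \<le> x else lower J < x) \<and>
                   (if right_closed J then x \<le> upper J else x < upper J)}"

definition ivl_length :: "lc_ivl \<Rightarrow> lc" where
  "ivl_length J = upper J - lower J"

definition disjoint_ivls :: "(nat \<Rightarrow> lc_ivl) \<Rightarrow> bool" where
  "disjoint_ivls I \<longleftrightarrow> (\<forall>n. lower (I n) \<le> upper (I n)) \<and> disjoint_family (\<lambda>n. ivl_set (I n))"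

definition lc_measurable_set :: "lc set \<Rightarrow> bool" where
  "lc_measurable_set A \<longleftrightarrow> (\<forall>e>0. \<exists>I J s t.
     disjoint_ivls I \<and> disjoint_ivls J \<and>
     (\<Union>n. ivl_set (I n)) \<subseteq> A \<and> A \<subseteq> (\<Union>n. ivl_set (J n)) \<and>
     strong_sums (\<lambda>n. ivl_length (I n)) s \<and> strong_sums (\<lambda>n. ivl_length (J n)) t \<and>
     t - s \<le> e)"

definition inner_sums :: "lc set \<Rightarrow> lc set" where
  "inner_sums A = {s. \<exists>I. disjoint_ivls I \<and> (\<Union>n. ivl_set (I n)) \<subseteq> A \<and>
     strong_sums (\<lambda>n. ivl_length (I n)) s}"

definition outer_sums :: "lc set \<Rightarrow> lc set" where
  "outer_sums A = {t. \<exists>J. disjoint_ivls J \<and> A \<subseteq> (\<Union>n. ivl_set (J n)) \<and>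
     strong_sums (\<lambda>n. ivl_length (J n)) t}"

text \<open>
  The order of \<open>lc\<close> is not complete, so the supremum and the infimum are described explicitly. For
  measurable sets both exist and agree.
\<close>

definition lc_measure :: "lc set \<Rightarrow> lc" where
  "lc_measure A = (THE m.
     (\<forall>s\<in>inner_sums A. s \<le> m) \<and> (\<forall>u. (\<forall>s\<in>inner_sums A. s \<le> u) \<longrightarrow> m \<le> u) \<and>
     (\<forall>t\<in>outer_sums A. m \<le> t) \<and> (\<forall>u. (\<forall>t\<in>outer_sums A. u \<le> t) \<longrightarrow> u \<le> m))"

section \<open>Simple and measurable functions, the integral\<close>

definition weak_power_series :: "(nat \<Rightarrow> lc) \<Rightarrow> lc \<Rightarrow> (lc \<Rightarrow> lc) \<Rightarrow> lc set \<Rightarrow> bool" where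
  "weak_power_series c x0 f S \<longleftrightarrow>
    (\<forall>x\<in>S. weak_lim (\<lambda>K. \<Sum>k\<le>K. c k * (x - x0) ^ k) (f x))"

definition weak_antiderivative :: "(nat \<Rightarrow> lc) \<Rightarrow> lc \<Rightarrow> (lc \<Rightarrow> lc) \<Rightarrow> lc set \<Rightarrow> bool" where
  "weak_antiderivative c x0 F S \<longleftrightarrow>
    (\<forall>x\<in>S. weak_lim (\<lambda>K. \<Sum>k\<le>K. (1 / real (Suc k)) *\<^sub>R (c k * (x - x0) ^ Suc k)) (F x))"

definition simple_on :: "(lc \<Rightarrow> lc) \<Rightarrow> lc set \<Rightarrow> bool" where
  "simple_on f S \<longleftrightarrow> (\<exists>x0 c. weak_power_series c x0 f S)"

text \<open>
  For degenerate intervals, where the endpoints need not be limit points, the integral is \<open>0\<close>.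
\<close>

definition ivl_integral :: "(lc \<Rightarrow> lc) \<Rightarrow> lc_ivl \<Rightarrow> lc" where
  "ivl_integral f J =
    (if lower J < upper J
     then THE v. \<exists>x0 c F l u. weak_power_series c x0 f (ivl_set J) \<and>
            weak_antiderivative c x0 F (ivl_set J) \<and>
            lc_limit_within F (lower J) (ivl_set J) l \<and>
            lc_limit_within F (upper J) (ivl_set J) u \<and> v = u - l
     else 0)"

text \<open>
  A function on \<open>A\<close> is represented by a total function; only its values on \<open>A\<close> matter.
  \<open>simple_cover f A I s\<close>: the intervals \<open>I\<close> lie in \<open>A\<close>, \<open>f\<close> is simple on each of them and \<open>s\<close> is
  their total length.
\<close>

definition simple_cover :: "(lc \<Rightarrow> lc) \<Rightarrow> lc set \<Rightarrow> (nat \<Rightarrow> lc_ivl) \<Rightarrow> lc \<Rightarrow> bool" where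
  "simple_cover f A I s \<longleftrightarrow> disjoint_ivls I \<and> (\<Union>n. ivl_set (I n)) \<subseteq> A \<and>
     (\<forall>n. simple_on f (ivl_set (I n))) \<and> strong_sums (\<lambda>n. ivl_length (I n)) s"

definition measurable_funs :: "lc set \<Rightarrow> (lc \<Rightarrow> lc) set" where
  "measurable_funs A = {f. lc_measurable_set A \<and>
     (\<forall>e>0. \<exists>I s. simple_cover f A I s \<and> lc_measure A - s < e)}"

text \<open>
  \<open>f\<close> has the finite integral \<open>v\<close> over \<open>A\<close>: every family of simple pieces whose total length is
  close enough to the measure of \<open>A\<close> has a strongly convergent sum of integrals close to \<open>v\<close>. The
  improper values plus and minus infinity are not represented: a divergent integral is simply not
  a finite one.
\<close>

definition lc_has_integral :: "(lc \<Rightarrow> lc) \<Rightarrow> lc \<Rightarrow> lc set \<Rightarrow> bool" where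
  "lc_has_integral f v A \<longleftrightarrow> f \<in> measurable_funs A \<and>
     (\<forall>e>0. \<exists>d>0. \<forall>I s. simple_cover f A I s \<longrightarrow> lc_measure A - s < d \<longrightarrow>
        (\<exists>w. strong_sums (\<lambda>n. ivl_integral f (I n)) w \<and> \<bar>w - v\<bar> < e))"

definition lc_integrable :: "(lc \<Rightarrow> lc) \<Rightarrow> lc set \<Rightarrow> bool" where
  "lc_integrable f A \<longleftrightarrow> (\<exists>v. lc_has_integral f v A)"

definition lc_integral :: "lc set \<Rightarrow> (lc \<Rightarrow> lc) \<Rightarrow> lc" where
  "lc_integral A f = (THE v. lc_has_integral f v A)"

definition L1 :: "lc set \<Rightarrow> (lc \<Rightarrow> lc) set" where
  "L1 A = {f \<in> measurable_funs A. lc_integrable (\<lambda>x. \<bar>f x\<bar>) A}"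

definition norm1 :: "lc set \<Rightarrow> (lc \<Rightarrow> lc) \<Rightarrow> lc" where
  "norm1 A f = lc_integral A (\<lambda>x. \<bar>f x\<bar>)"

section \<open>Dirac-like functions and polynomial approximation\<close>

definition dirac_like :: "lc set \<Rightarrow> lc \<Rightarrow> (lc \<Rightarrow> lc) \<Rightarrow> bool" where
  "dirac_like A r g \<longleftrightarrow> r \<in> A \<and> g \<in> L1 A \<and> (\<forall>x\<in>A. 0 \<le> g x) \<and>
     (\<exists>h\<in>nonzero_infinitesimals. 0 < h \<and> {x \<in> A. g x \<noteq> 0} \<subseteq> {r - h..r + h} \<and> {r - h..r + h} \<subseteq> A) \<and>
     norm1 A g = 1"

definition sup_norm :: "real \<Rightarrow> real \<Rightarrow> (real \<Rightarrow> real) \<Rightarrow> real" where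
  "sup_norm a b f = (SUP x\<in>{a..b}. \<bar>f x\<bar>)"

text \<open>
  For continuous \<open>f\<close> and \<open>a < b\<close> there is exactly one such \<open>p\<close> for every \<open>n\<close>.
\<close>

definition best_approx :: "real \<Rightarrow> real \<Rightarrow> (real \<Rightarrow> real) \<Rightarrow> nat \<Rightarrow> real poly \<Rightarrow> bool" where
  "best_approx a b f n p \<longleftrightarrow> degree p \<le> n \<and>
     (\<forall>q. degree q \<le> n \<longrightarrow> sup_norm a b (\<lambda>x. f x - poly p x) \<le> sup_norm a b (\<lambda>x. f x - poly q x))"

definition canonical_extension :: "real poly \<Rightarrow> lc \<Rightarrow> lc" where
  "canonical_extension p x = poly (map_poly of_real p) x"

end

(* The integral of a simple function over an interval is determined coefficientwise by real integrals
   over the points dividing the interval in a real ratio. This needs a normal form of simple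
   functions: a gliding-hump argument shows that the terms of a power series that converges weakly at
   all points of an interval have orders bounded below, hence (perturbing the argument infinitesimally)
   coefficients decreasing faster than any power, and a countability argument yields a common
   left-finite support after re-expansion. Uniqueness, additivity and positivity of the integral follow.
   A Dirac-like function g has integral 1, and a polynomial p is bounded on the interval, so g * p is
   dominated by a multiple of g; comparing an arbitrary cover with fine families for g through their
   common refinement shows that g * p is integrable. As p differs from p(r) by an infinitesimal where g
   does not vanish, the integral of g * p is infinitely close to p(r). Best approximations converge at r
   by the Weierstrass theorem. *)

theory Submission
  imports Defs "HOL-Complex_Analysis.Complex_Analysis"
begin


section \<open>Order of vanishing and strong convergence\<close>

text \<open>Three features of the field shape the proof. A function with vanishing derivative need
  not be constant, so uniqueness of the integral cannot come from a mean value theorem; along the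
  points A + t (B - A) with t real, every coefficient is an ordinary continuous function on [0,1],
  where real integration applies. Order intervals are not compact and bounded sets need not have
  suprema, so covers have no finite subcovers and convergence at single points gives no uniform
  bound by itself. The substitutes are the construction of bad points digit by digit, possible since
  the field is complete for strong convergence, and counting: an interval contains uncountably many
  points in real ratio, whereas supports are finite below every exponent. Finally, a product with a
  polynomial p can be simple on intervals where the Dirac-like function itself is not, the extreme
  case being p = 0. Sums over a cover for the product therefore cannot be estimated by the integrals
  of the Dirac-like function over the same cover, which is why refinements enter.\<close>

text \<open>\<open>ord_ge m x\<close> means \<open>\<lambda>(x) \<ge> m\<close>, also for \<open>x = 0\<close>.\<close>

definition ord_ge :: "rat \<Rightarrow> lc \<Rightarrow> bool" where
  "ord_ge m x \<longleftrightarrow> (\<forall>q<m. lc_coeff x q = 0)"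

lemma ord_geD: "ord_ge m x \<Longrightarrow> q < m \<Longrightarrow> lc_coeff x q = 0"
  by (simp add: ord_ge_def)

lemma ord_ge_mono: "ord_ge m x \<Longrightarrow> n \<le> m \<Longrightarrow> ord_ge n x"
  by (simp add: ord_ge_def)

lemma ord_ge_zero [simp]: "ord_ge m 0"
  by (simp add: ord_ge_def)

lemma ord_ge_one [simp]: "ord_ge 0 1"
  by (simp add: ord_ge_def)

lemma ord_ge_add: "ord_ge m x \<Longrightarrow> ord_ge m y \<Longrightarrow> ord_ge m (x + y)"
  by (simp add: ord_ge_def)

lemma ord_ge_diff: "ord_ge m x \<Longrightarrow> ord_ge m y \<Longrightarrow> ord_ge m (x - y)"
  by (simp add: ord_ge_def)

lemma ord_ge_uminus_iff [simp]: "ord_ge m (- x) \<longleftrightarrow> ord_ge m x"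
  by (simp add: ord_ge_def)



lemma ord_ge_sum: "(\<And>i. i \<in> S \<Longrightarrow> ord_ge m (f i)) \<Longrightarrow> ord_ge m (sum f S)"
  by (induction S rule: infinite_finite_induct) (auto intro: ord_ge_add)


lemma ord_ge_ex: "\<exists>m. ord_ge m x"
  using lc_bound[of x] unfolding ord_ge_def by (metis not_le)

lemma ord_ge_mult:
  assumes "ord_ge m x" "ord_ge n y"
  shows "ord_ge (m + n) (x * y)"
  unfolding ord_ge_def
proof (intro allI impI)
  fix q assume q: "q < m + n"
  have "lc_coeff (x * y) q = (\<Sum>p\<in>{}. lc_coeff x p * lc_coeff y (q - p))"
  proof (rule lc_coeff_mult_left)
    fix p assume "lc_coeff x p \<noteq> 0" "lc_coeff y (q - p) \<noteq> 0"
    then have "m \<le> p" "n \<le> q - p" using assms by (auto simp: ord_ge_def not_less[symmetric])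
    then show "p \<in> {}" using q by linarith
  qed simp
  then show "lc_coeff (x * y) q = 0" by simp
qed

lemma ord_ge_mult2: "ord_ge m x \<Longrightarrow> ord_ge n y \<Longrightarrow> k \<le> m + n \<Longrightarrow> ord_ge k (x * y)"
  using ord_ge_mono ord_ge_mult by blast

lemma lc_coeff_mult_lowest:
  assumes "ord_ge m x" "ord_ge n y"
  shows "lc_coeff (x * y) (m + n) = lc_coeff x m * lc_coeff y n"
proof -
  have "lc_coeff (x * y) (m + n) = (\<Sum>p\<in>{m}. lc_coeff x p * lc_coeff y (m + n - p))"
  proof (rule lc_coeff_mult_left)
    fix p assume "lc_coeff x p \<noteq> 0" "lc_coeff y (m + n - p) \<noteq> 0"
    then have "m \<le> p" "n \<le> m + n - p" using assms by (auto simp: ord_ge_def not_less[symmetric])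
    then show "p \<in> {m}" by simp
  qed simp
  then show ?thesis by simp
qed

text \<open>The index set depends only on \<open>z\<close>, \<open>m\<close> and \<open>q\<close>,
  not on \<open>x\<close>. Multiplication by a fixed \<open>z\<close> therefore acts on each
  coefficient as one finite linear combination for all \<open>x\<close> of order at least
  \<open>m\<close>, and commutes with coefficientwise limits, series and integrals.\<close>

lemma lc_coeff_mult_ord:
  assumes "ord_ge m x"
  shows "lc_coeff (x * z) q = (\<Sum>p | lc_coeff z p \<noteq> 0 \<and> p \<le> q - m. lc_coeff z p * lc_coeff x (q - p))"
proof -
  have "lc_coeff (z * x) q = (\<Sum>p | lc_coeff z p \<noteq> 0 \<and> p \<le> q - m. lc_coeff z p * lc_coeff x (q - p))"
  proof (rule lc_coeff_mult_left[OF finite_lc_trunc])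
    fix p assume "lc_coeff z p \<noteq> 0" "lc_coeff x (q - p) \<noteq> 0"
    moreover have "m \<le> q - p" using calculation assms by (auto simp: ord_ge_def not_less[symmetric])
    ultimately show "p \<in> {p. lc_coeff z p \<noteq> 0 \<and> p \<le> q - m}" by auto
  qed
  then show ?thesis by (simp add: mult.commute)
qed

lemma ord_ge_power: "ord_ge m x \<Longrightarrow> ord_ge (of_nat n * m) (x ^ n)"
proof (induction n)
  case (Suc n)
  then show ?case using ord_ge_mult[of m x "of_nat n * m" "x ^ n"] by (simp add: algebra_simps)
qed simp

lemma ord_ge_power0: "ord_ge 0 x \<Longrightarrow> ord_ge 0 (x ^ n)"
  using ord_ge_power[of 0 x n] by simp

lemma lc_coeff_sum [simp]: "lc_coeff (sum f S) q = (\<Sum>i\<in>S. lc_coeff (f i) q)"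
  by (induction S rule: infinite_finite_induct) auto

lemma lc_coeff_of_real [simp]: "lc_coeff (of_real r) q = (if q = 0 then r else 0)"
  by (simp add: of_real_def)

lemma lc_coeff_of_real_mult [simp]: "lc_coeff (of_real r * x) q = r * lc_coeff x q"
  by (metis lc_coeff_simps(6) scaleR_conv_of_real)

lemma lc_coeff_of_nat_mult [simp]: "lc_coeff (of_nat n * x) q = real n * lc_coeff x q"
  by (metis lc_coeff_of_real_mult of_real_of_nat_eq)

lemma ord_ge_of_real [simp]: "ord_ge 0 (of_real r)"
  by (simp add: ord_ge_def)

lemma ord_ge_lead: "ord_ge (lc_lead x) x"
  by (simp add: ord_ge_def lc_coeff_below_lead)

lemma ord_ge_iff_lead: "x \<noteq> 0 \<Longrightarrow> ord_ge m x \<longleftrightarrow> m \<le> lc_lead x"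
  by (metis lc_lead_props(1) not_le ord_geD ord_ge_lead ord_ge_mono)

lemma lc_pos_iff2: "0 < x \<longleftrightarrow> (\<exists>q. ord_ge q x \<and> 0 < lc_coeff x q)"
proof
  assume "0 < x"
  then show "\<exists>q. ord_ge q x \<and> 0 < lc_coeff x q" using lc_pos_iff ord_ge_lead by blast
next
  assume "\<exists>q. ord_ge q x \<and> 0 < lc_coeff x q"
  then obtain q where q: "ord_ge q x" "0 < lc_coeff x q" by blast
  then have "lc_lead x = q" by (intro lc_leadI) (auto simp: ord_ge_def)
  then show "0 < x" using q lc_pos_iff by simp
qed

lemma abs_less_of_ord:
  assumes "ord_ge m x" "0 < y" "lc_lead y < m"
  shows "\<bar>x\<bar> < y"
proof -
  have "0 < y - x" "0 < y + x"
    unfolding lc_pos_iff2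
    using assms ord_ge_lead[of y] ord_ge_mono[OF assms(1), of "lc_lead y"]
    by (auto intro!: exI[of _ "lc_lead y"] ord_ge_add ord_ge_diff simp: lc_pos_iff ord_geD)
  then show ?thesis by (simp add: abs_lc_def)
qed

lemma ord_ge_of_abs_le:
  assumes "\<bar>x\<bar> \<le> y" "ord_ge m y"
  shows "ord_ge m x"
proof (rule ccontr)
  assume n: "\<not> ord_ge m x"
  then have x0: "x \<noteq> 0" by auto
  then have l: "lc_lead x < m" using n ord_ge_iff_lead by auto
  have "0 < \<bar>x\<bar>" using x0 by simp
  moreover have "lc_lead \<bar>x\<bar> = lc_lead x" by (simp add: abs_lc_def)
  ultimately have "\<bar>y\<bar> < \<bar>x\<bar>" using abs_less_of_ord[OF assms(2), of "\<bar>x\<bar>"] l by simp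
  then show False using assms(1) by (metis abs_ge_self leD order.trans)
qed

text \<open>The monomial \<open>d\<^sup>p\<close>.\<close>

lift_definition lc_mono :: "rat \<Rightarrow> lc" is "\<lambda>p q. if q = p then 1 else 0"
  by (simp add: left_finite_def)

lemma lc_coeff_mono [simp]: "lc_coeff (lc_mono p) q = (if q = p then 1 else 0)"
  by transfer simp

lemma ord_ge_mono_lc [simp]: "ord_ge p (lc_mono p)"
  by (simp add: ord_ge_def)

lemma lc_mono_pos [simp]: "0 < lc_mono p"
  unfolding lc_pos_iff2 by (rule exI[of _ p]) simp

lemma lc_coeff_mono_mult [simp]: "lc_coeff (lc_mono p * x) q = lc_coeff x (q - p)"
proof -
  have "lc_coeff (lc_mono p * x) q = (\<Sum>r\<in>{p}. lc_coeff (lc_mono p) r * lc_coeff x (q - r))"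
    by (rule lc_coeff_mult_left) (auto split: if_splits)
  then show ?thesis by simp
qed

lemma lc_mono_mult: "lc_mono p * lc_mono q = lc_mono (p + q)"
  by (rule lc_eqI) auto

lemma lc_mono_0: "lc_mono 0 = 1"
  by (rule lc_eqI) auto

lemma lc_lead_mono [simp]: "lc_lead (lc_mono p) = p"
  by (rule lc_leadI) auto

lemma ex_nat_gt_rat: "\<exists>n::nat. (q::rat) < of_nat n"
  by (rule reals_Archimedean2)

text \<open>The monomials \<open>lc_mono m\<close> are coinitial among the positive elements, so
  order convergence is convergence in the valuation; estimates by \<open>ord_ge\<close> can replace
  epsilons.\<close>

lemma strong_lim_iff: "strong_lim X l \<longleftrightarrow> (\<forall>m. \<forall>\<^sub>F n in sequentially. ord_ge m (X n - l))"
proof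
  assume s: "strong_lim X l"
  show "\<forall>m. \<forall>\<^sub>F n in sequentially. ord_ge m (X n - l)"
  proof
    fix m
    have "\<forall>\<^sub>F n in sequentially. \<bar>X n - l\<bar> < lc_mono m" using s unfolding strong_lim_def by simp
    then show "\<forall>\<^sub>F n in sequentially. ord_ge m (X n - l)"
      by eventually_elim (rule ord_ge_of_abs_le[of _ "lc_mono m"], auto)
  qed
next
  assume a: "\<forall>m. \<forall>\<^sub>F n in sequentially. ord_ge m (X n - l)"
  show "strong_lim X l" unfolding strong_lim_def
  proof (intro allI impI)
    fix e :: lc assume e: "0 < e"
    have "\<forall>\<^sub>F n in sequentially. ord_ge (lc_lead e + 1) (X n - l)" using a by blast
    then show "\<forall>\<^sub>F n in sequentially. \<bar>X n - l\<bar> < e"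
      by eventually_elim (rule abs_less_of_ord, use e in auto)
  qed
qed

lemma strong_lim_unique:
  assumes "strong_lim X l" "strong_lim X l'"
  shows "l = l'"
proof (rule lc_eqI)
  fix q
  have "\<forall>\<^sub>F n in sequentially. ord_ge (q+1) (X n - l) \<and> ord_ge (q+1) (X n - l')"
    using assms unfolding strong_lim_iff by (simp add: eventually_conj)
  then obtain n where "ord_ge (q+1) (X n - l)" "ord_ge (q+1) (X n - l')"
    by (metis (mono_tags, lifting) eventually_sequentially order_refl)
  then show "lc_coeff l q = lc_coeff l' q"
    using ord_geD[of "q+1" "X n - l" q] ord_geD[of "q+1" "X n - l'" q] by simp
qed

lemma strong_lim_complete:
  assumes "\<And>m. \<exists>N. \<forall>n\<ge>N. \<forall>n'\<ge>N. ord_ge m (X n - X n')"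
  shows "\<exists>l. strong_lim X l"
proof -
  obtain N where N: "\<And>m n n'. n \<ge> N m \<Longrightarrow> n' \<ge> N m \<Longrightarrow> ord_ge m (X n - X n')"
    using assms by metis
  \<comment> \<open>\<open>ord_ge (q+1)\<close> controls the coefficients strictly below
    \<open>q + 1\<close>, in particular the one at \<open>q\<close>.\<close>
  define L where "L q = lc_coeff (X (N (q+1))) q" for q
  have L: "L q = lc_coeff (X n) q" if "q < m" "n \<ge> N m" for q m n
  proof -
    define k where "k = max (N m) (N (q+1))"
    have "ord_ge (q+1) (X (N (q+1)) - X k)" "ord_ge m (X n - X k)"
      using N that by (auto simp: k_def)
    then show ?thesis using that ord_geD[of "q+1" "X (N (q+1)) - X k" q] ord_geD[of m "X n - X k" q]
      by (simp add: L_def)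
  qed
  have "left_finite {q. L q \<noteq> 0}" unfolding left_finite_def
  proof
    fix c
    have "{x \<in> {q. L q \<noteq> 0}. x \<le> c} \<subseteq> {q. lc_coeff (X (N (c+1))) q \<noteq> 0 \<and> q \<le> c}"
      using L[of _ "c+1" "N (c+1)"] by auto
    then show "finite {x \<in> {q. L q \<noteq> 0}. x \<le> c}"
      using finite_lc_trunc finite_subset by blast
  qed
  then have l: "lc_coeff (Abs_lc L) = L" by (simp add: Abs_lc_inverse)
  have "strong_lim X (Abs_lc L)" unfolding strong_lim_iff eventually_sequentially ord_ge_def
    using L l by (metis diff_self lc_coeff_simps(4))
  then show ?thesis by blast
qed

text \<open>The valuation is ultrametric: a block of terms has at least the smallest order of its
  members, so null terms already make the partial sums Cauchy.\<close>

lemma strong_sums_of_terms: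
  assumes "\<And>m. \<forall>\<^sub>F n in sequentially. ord_ge m (X n)"
  shows "\<exists>s. strong_sums X s"
  unfolding strong_sums_def
proof (rule strong_lim_complete)
  fix m
  obtain N where N: "\<And>n. n \<ge> N \<Longrightarrow> ord_ge m (X n)" using assms[of m] by (auto simp: eventually_sequentially)
  have *: "ord_ge m (sum X {..n} - sum X {..N})" if "n \<ge> N" for n
    using that
  proof (induction n rule: dec_induct)
    case (step n)
    then show ?case using N[of "Suc n"] ord_ge_add[of m "sum X {..n} - sum X {..N}" "X (Suc n)"]
      by (simp add: algebra_simps)
  qed simp
  show "\<exists>N. \<forall>n\<ge>N. \<forall>n'\<ge>N. ord_ge m (sum X {..n} - sum X {..n'})"
  proof (intro exI[of _ N] allI impI)
    fix n n' assume "n \<ge> N" "n' \<ge> N"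
    then show "ord_ge m (sum X {..n} - sum X {..n'})"
      using ord_ge_diff[OF *[of n] *[of n']] by simp
  qed
qed

lemma strong_sums_terms:
  assumes "strong_sums X s"
  shows "\<forall>\<^sub>F n in sequentially. ord_ge m (X n)"
proof -
  obtain N where N: "\<And>n. n \<ge> N \<Longrightarrow> ord_ge m (sum X {..n} - s)"
    using assms unfolding strong_sums_def strong_lim_iff eventually_sequentially by blast
  have "ord_ge m (X n)" if "n \<ge> Suc N" for n
  proof -
    obtain k where k: "n = Suc k" "k \<ge> N" using \<open>n \<ge> Suc N\<close> Suc_le_D by auto
    show ?thesis using ord_ge_diff[OF N[of n] N[of k]] k by simp
  qed
  then show ?thesis unfolding eventually_sequentially by blast
qed

section \<open>The field structure\<close>

lemma lc_geometric:
  assumes "0 < m" "ord_ge m u"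
  shows "\<exists>y. (1 - u) * y = 1"
proof -
  have pw: "\<exists>N. \<forall>n\<ge>N. ord_ge r (u ^ n)" for r
  proof -
    obtain N :: nat where "r / m < of_nat N" using ex_nat_gt_rat by blast
    then have N: "r / m < of_nat N" .
    have "r \<le> of_nat n * m" if "n \<ge> N" for n
    proof -
      have "r < of_nat N * m" using N assms(1) by (simp add: pos_divide_less_eq)
      also have "\<dots> \<le> of_nat n * m" using that assms(1) by (intro mult_right_mono) auto
      finally show ?thesis by simp
    qed
    then show ?thesis using ord_ge_mono[OF ord_ge_power[OF assms(2)]] by blast
  qed
  then have "\<exists>s. strong_sums (\<lambda>n. u ^ n) s"
    by (intro strong_sums_of_terms) (simp add: eventually_sequentially)
  then obtain y where y: "strong_sums (\<lambda>n. u ^ n) y" by blast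
  have "ord_ge r ((1 - u) * y - 1)" for r
  proof -
    obtain N1 where N1: "\<And>n. n \<ge> N1 \<Longrightarrow> ord_ge r (u ^ n)" using pw by blast
    obtain N2 where N2: "\<And>n. n \<ge> N2 \<Longrightarrow> ord_ge r ((\<Sum>k\<le>n. u ^ k) - y)"
      using y unfolding strong_sums_def strong_lim_iff eventually_sequentially by blast
    define n where "n = max N1 N2"
    have "(1 - u) * (\<Sum>k\<le>n. u ^ k) = 1 - u ^ Suc n"
      using one_diff_power_eq[of u "Suc n"] lessThan_Suc_atMost by metis
    then have "(1 - u) * y - 1 = - (u ^ Suc n) - (1 - u) * ((\<Sum>k\<le>n. u ^ k) - y)"
      by (simp add: algebra_simps)
    moreover have "ord_ge 0 (1 - u)" using assms by (intro ord_ge_diff) (auto intro: ord_ge_mono)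
    ultimately show ?thesis
      using ord_ge_mult2[of 0 "1 - u" r "(\<Sum>k\<le>n. u ^ k) - y" r] N2[of n] N1[of "Suc n"]
      by (metis add_0 le_Suc_eq max.cobounded1 max.cobounded2 n_def ord_ge_diff ord_ge_uminus_iff order_refl)
  qed
  then have "(1 - u) * y - 1 = 0"
    by (intro lc_eqI) (metis lc_coeff_simps(1) less_add_one ord_geD)
  then show ?thesis by auto
qed

text \<open>Dividing by the leading term leaves 1 - u with u infinitesimal, which the geometric
  series inverts.\<close>

lemma lc_inverse_ex:
  assumes "x \<noteq> (0::lc)"
  shows "\<exists>y. x * y = 1"
proof -
  define l where "l = lc_lead x"
  define z where "z = of_real (1 / lc_coeff x l) * (lc_mono (- l) * x)"
  have z: "lc_coeff z q = lc_coeff x (q + l) / lc_coeff x l" for q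
    by (simp add: z_def)
  have l: "lc_coeff x l \<noteq> 0" using lc_lead_props(1)[OF assms] by (simp add: l_def)
  define u where "u = 1 - z"
  have u0: "lc_coeff u q = 0" if "q \<le> 0" for q
  proof (cases "q = 0")
    case True
    then show ?thesis using l by (simp add: u_def z)
  next
    case False
    then have "lc_coeff x (q + l) = 0" using that lc_coeff_below_lead[of "q + l" x] by (simp add: l_def)
    then show ?thesis using False by (simp add: u_def z)
  qed
  have "\<exists>m>0. ord_ge m u"
  proof (cases "u = 0")
    case True
    then show ?thesis by (auto intro: exI[of _ 1])
  next
    case False
    then have "0 < lc_lead u" using u0 lc_lead_props(1)[OF False] not_le by blast
    then show ?thesis using ord_ge_lead by blast
  qed
  then obtain y where "(1 - u) * y = 1" using lc_geometric by blast
  then have "z * y = 1" by (simp add: u_def)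
  then have "x * (of_real (1 / lc_coeff x l) * lc_mono (- l) * y) = 1" by (simp add: z_def mult_ac)
  then show ?thesis by blast
qed

instantiation lc :: linordered_field
begin

definition inverse_lc :: "lc \<Rightarrow> lc" where
  "inverse x = (if x = (0::lc) then 0 else SOME y. x * y = 1)"

definition divide_lc :: "lc \<Rightarrow> lc \<Rightarrow> lc" where
  "x div y = x * inverse (y :: lc)"

instance
proof
  fix x y :: lc
  show "x \<noteq> 0 \<Longrightarrow> inverse x * x = 1"
    using someI_ex[OF lc_inverse_ex[of x]] by (simp add: inverse_lc_def mult.commute)
  show "x div y = x * inverse y" by (simp add: divide_lc_def)
  show "inverse (0::lc) = 0" by (simp add: inverse_lc_def)
qed

end


section \<open>Embedded reals and infinitesimals\<close>

lemma of_real_lc_less_iff [simp]: "(of_real x :: lc) < of_real y \<longleftrightarrow> x < y"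
proof -
  have pos: "0 < (of_real z :: lc)" if "0 < z" for z
    unfolding lc_pos_iff2 using that by (intro exI[of _ 0]) simp
  show ?thesis
    using pos[of "y - x"] pos[of "x - y"]
    by (metis diff_gt_0_iff_gt less_asym linorder_cases of_real_diff order_less_irrefl)
qed

lemma of_real_lc_le_iff [simp]: "(of_real x :: lc) \<le> of_real y \<longleftrightarrow> x \<le> y"
  by (metis linorder_not_less of_real_lc_less_iff)

lemma of_real_lc_pos_iff [simp]: "0 < (of_real x :: lc) \<longleftrightarrow> 0 < x"
  using of_real_lc_less_iff[of 0 x] by simp

lemma of_real_lc_nonneg_iff [simp]: "0 \<le> (of_real x :: lc) \<longleftrightarrow> 0 \<le> x"
  using of_real_lc_le_iff[of 0 x] by simp

lemma of_real_lc_neg_iff [simp]: "(of_real x :: lc) < 0 \<longleftrightarrow> x < 0"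
  using of_real_lc_less_iff[of x 0] by simp

lemma abs_of_real_lc [simp]: "\<bar>of_real x :: lc\<bar> = of_real \<bar>x\<bar>"
  by (simp add: abs_lc_def)

text \<open>In contrast to \<^const>\<open>nonzero_infinitesimals\<close>, this includes \<open>0\<close>.\<close>

definition infsml :: "lc \<Rightarrow> bool" where
  "infsml x \<longleftrightarrow> (\<exists>m>0. ord_ge m x)"

lemma infsml_iff: "infsml x \<longleftrightarrow> ord_ge 0 x \<and> lc_coeff x 0 = 0"
proof
  assume "infsml x"
  then show "ord_ge 0 x \<and> lc_coeff x 0 = 0" unfolding infsml_def ord_ge_def by auto
next
  assume a: "ord_ge 0 x \<and> lc_coeff x 0 = 0"
  show "infsml x"
  proof (cases "x = 0")
    case True
    then show ?thesis unfolding infsml_def by (auto intro: exI[of _ 1])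
  next
    case False
    then have "0 \<le> lc_lead x" "lc_lead x \<noteq> 0" using a ord_ge_iff_lead lc_lead_props(1) by metis+
    then show ?thesis unfolding infsml_def using ord_ge_lead by (metis le_less)
  qed
qed

lemma infsml_standard_part: "ord_ge 0 x \<Longrightarrow> infsml (x - of_real (lc_coeff x 0))"
  unfolding infsml_iff by (simp add: ord_ge_diff)

lemma infsml_mult: "infsml x \<Longrightarrow> ord_ge 0 y \<Longrightarrow> infsml (x * y)"
  unfolding infsml_def using ord_ge_mult by fastforce

lemma infsml_abs_less:
  assumes "infsml x" "0 < r"
  shows "\<bar>x\<bar> < of_real r"
proof -
  obtain m where m: "m > 0" "ord_ge m x" using assms unfolding infsml_def by blast
  have "lc_lead (of_real r) = 0" using assms by (intro lc_leadI) auto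
  then show ?thesis using m assms abs_less_of_ord[of m x "of_real r"] by simp
qed

lemma infsml_of_abs_le: "\<bar>x\<bar> \<le> y \<Longrightarrow> infsml y \<Longrightarrow> infsml x"
  unfolding infsml_def using ord_ge_of_abs_le by blast



lemma infsml_mono1 [simp]: "infsml (lc_mono 1)"
  unfolding infsml_def by (rule exI[of _ 1]) simp

lemma lc_coeff0_mult: "ord_ge 0 x \<Longrightarrow> ord_ge 0 y \<Longrightarrow> lc_coeff (x * y) 0 = lc_coeff x 0 * lc_coeff y 0"
  using lc_coeff_mult_lowest[of 0 x 0 y] by simp

lemma lc_coeff0_mono:
  assumes "ord_ge 0 x" "ord_ge 0 y" "x \<le> y"
  shows "lc_coeff x 0 \<le> lc_coeff y 0"
proof (rule ccontr)
  assume "\<not> ?thesis"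
  then have "0 < x - y" unfolding lc_pos_iff2 using assms by (intro exI[of _ 0]) (auto intro: ord_ge_diff)
  then show False using assms(3) by simp
qed

lemma lc_less_of_coeff0:
  assumes "ord_ge 0 x" "ord_ge 0 y" "lc_coeff x 0 < lc_coeff y 0"
  shows "x < y"
  using lc_coeff0_mono[OF assms(2,1)] assms(3) not_less by auto

text \<open>The null sequence \<open>lc_mono k\<close> lets the fineness of interval families be
  indexed by natural numbers.\<close>

lemma lc_dense_small:
  assumes "0 < (e::lc)"
  shows "\<exists>n::nat. \<forall>k\<ge>n. lc_mono (of_nat k) < e"
proof -
  obtain n :: nat where n: "lc_lead e < of_nat n" using ex_nat_gt_rat by blast
  show ?thesis
  proof (intro exI[of _ n] allI impI)
    fix k assume "k \<ge> n"
    then have "lc_lead e < of_nat k" using n by (meson less_le_trans of_nat_le_iff)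
    then show "lc_mono (of_nat k) < e" using abs_less_of_ord[of "of_nat k" "lc_mono (of_nat k)" e] assms by simp
  qed
qed

section \<open>Weak convergence\<close>

lemma weak_lim_coeff:
  assumes "weak_lim X l"
  shows "(\<lambda>n. lc_coeff (X n) q) \<longlonglongrightarrow> lc_coeff l q"
proof (rule LIMSEQ_I)
  fix r :: real assume r: "0 < r"
  \<comment> \<open>The condition at \<open>e\<close> reaches only exponents up to
    \<open>1 / e\<close>; \<open>e \<le> 1 / B\<close> brings \<open>q\<close> into range.\<close>
  define B :: real where "B = max 1 (of_rat q)"
  have B: "0 < B" "of_rat q \<le> B" by (auto simp: B_def)
  define e where "e = min r (1 / B)"
  have e: "0 < e" "e \<le> r" "e \<le> 1 / B" using r B by (auto simp: e_def)
  have "B \<le> 1 / e" using e B by (simp add: field_simps)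
  then have q: "of_rat q \<le> 1 / e" using B by linarith
  have "\<forall>\<^sub>F n in sequentially. \<bar>lc_coeff (X n - l) q\<bar> < e"
    using assms e(1) q unfolding weak_lim_def by (auto elim!: eventually_mono)
  then show "\<exists>no. \<forall>n\<ge>no. norm (lc_coeff (X n) q - lc_coeff l q) < r"
    using e(2) unfolding eventually_sequentially by (metis lc_coeff_simps(4) less_le_trans real_norm_def)
qed

lemma weak_lim_unique:
  assumes "weak_lim X l" "weak_lim X l'"
  shows "l = l'"
  by (rule lc_eqI) (rule LIMSEQ_unique[OF weak_lim_coeff[OF assms(1)] weak_lim_coeff[OF assms(2)]])

text \<open>The bound in \<open>weak_lim\<close> is uniform over all exponents up to
  \<open>1 / e\<close>. Finite joint support of the sequence below each \<open>Q\<close> is what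
  upgrades coefficientwise convergence to it.\<close>

lemma weak_limI:
  assumes fin: "\<And>Q. finite {q. q \<le> Q \<and> (\<exists>n. lc_coeff (X n) q \<noteq> 0)}"
    and lim: "\<And>q. (\<lambda>n. lc_coeff (X n) q) \<longlonglongrightarrow> lc_coeff l q"
  shows "weak_lim X l"
  unfolding weak_lim_def
proof (intro allI impI)
  fix e :: real assume e: "0 < e"
  obtain Q :: rat where Q: "1 / e < of_rat Q" using of_rat_dense[of "1/e" "1/e+1"] by auto
  define S where "S = {q. q \<le> Q \<and> (\<exists>n. lc_coeff (X n) q \<noteq> 0)}"
  have "\<forall>\<^sub>F n in sequentially. \<forall>q\<in>S. \<bar>lc_coeff (X n) q - lc_coeff l q\<bar> < e"
  proof (rule eventually_ball_finite)
    show "finite S" unfolding S_def by (rule fin)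
    show "\<forall>q\<in>S. \<forall>\<^sub>F n in sequentially. \<bar>lc_coeff (X n) q - lc_coeff l q\<bar> < e"
      using lim e by (auto simp: tendsto_iff dist_real_def)
  qed
  then show "\<forall>\<^sub>F n in sequentially. \<forall>q. of_rat q \<le> 1 / e \<longrightarrow> \<bar>lc_coeff (X n - l) q\<bar> < e"
  proof eventually_elim
    case (elim n)
    show ?case
    proof (intro allI impI)
      fix q :: rat assume "of_rat q \<le> 1 / e"
      then have "(of_rat q :: real) \<le> of_rat Q" using Q by linarith
      then have q: "q \<le> Q" by (simp add: of_rat_less_eq)
      show "\<bar>lc_coeff (X n - l) q\<bar> < e"
      proof (cases "q \<in> S")
        case True
        then show ?thesis using elim by simp
      next
        case False
        have z: "lc_coeff (X n) q = 0" for n using False q by (auto simp: S_def)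
        have "(\<lambda>n. 0) \<longlonglongrightarrow> lc_coeff l q" using lim[of q] unfolding z .
        then have "lc_coeff l q = 0" using LIMSEQ_unique[OF tendsto_const] by metis
        then show ?thesis using z e by simp
      qed
    qed
  qed
qed

lemma weak_lim_terms:
  assumes "weak_lim (\<lambda>K. \<Sum>k\<le>K. T k) l"
  shows "\<forall>\<^sub>F k in sequentially. \<forall>q\<le>1. \<bar>lc_coeff (T k) q\<bar> < 1"
proof -
  \<comment> \<open>With error 1/2 two consecutive partial sums differ by less than 1, for exponents
    up to 2.\<close>
  have "\<forall>\<^sub>F n in sequentially. \<forall>q. of_rat q \<le> 1 / (1/2::real) \<longrightarrow> \<bar>lc_coeff ((\<Sum>k\<le>n. T k) - l) q\<bar> < 1/2"
    using assms[unfolded weak_lim_def, rule_format, of "1/2"] by simp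
  then obtain N where N: "\<And>n q. n \<ge> N \<Longrightarrow> of_rat q \<le> (2::real) \<Longrightarrow> \<bar>lc_coeff ((\<Sum>k\<le>n. T k) - l) q\<bar> < 1/2"
    unfolding eventually_sequentially by auto
  have "\<bar>lc_coeff (T n) q\<bar> < 1" if "n \<ge> Suc N" "q \<le> 1" for n q
  proof -
    obtain k where k: "n = Suc k" "k \<ge> N" using \<open>n \<ge> Suc N\<close> Suc_le_D by auto
    have "(of_rat q :: real) \<le> of_rat 1" using that(2) by (subst of_rat_less_eq)
    then have q: "of_rat q \<le> (2::real)" unfolding of_rat_1 by linarith
    have "lc_coeff (T n) q = lc_coeff ((\<Sum>k\<le>n. T k) - l) q - lc_coeff ((\<Sum>k\<le>k. T k) - l) q"
      by (simp add: k)
    then show ?thesis using N[of n q] N[of k q] q k by linarith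
  qed
  then show ?thesis unfolding eventually_sequentially by blast
qed

section \<open>Uniform lower bounds for the terms of a weakly convergent power series\<close>

lemma ord_ge_power_diff:
  assumes "ord_ge 0 x" "ord_ge 0 y" "ord_ge n (y - x)"
  shows "ord_ge n (y ^ k - x ^ k)"
proof (induction k)
  case (Suc k)
  have "y ^ Suc k - x ^ Suc k = y * (y ^ k - x ^ k) + (y - x) * x ^ k"
    by (simp add: algebra_simps)
  then show ?case using ord_ge_mult[OF assms(2) Suc] ord_ge_mult[OF assms(3) ord_ge_power0[OF assms(1)]]
    by (simp add: ord_ge_add)
qed simp

text \<open>The derivative of the k-th power at a point with standard part 1 is k up to an
  infinitesimal: this is how a single digit of the argument steers a coefficient of its
  power.\<close>

lemma lc_coeff_power_perturb:
  fixes x :: lc and \<beta> :: real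
  assumes "ord_ge 0 x" "lc_coeff x 0 = 1" "0 < n"
  defines "y \<equiv> x + of_real \<beta> * lc_mono n"
  shows "lc_coeff (y ^ k - x ^ k) n = real k * \<beta>"
proof -
  have y: "ord_ge 0 y" "lc_coeff y 0 = 1" "ord_ge n (y - x)"
    using assms(3) ord_geD[OF assms(1)] by (auto simp: y_def ord_ge_def assms(2))
  have pw: "lc_coeff (x ^ k) 0 = 1" for k
    by (induction k) (use lc_coeff0_mult[OF assms(1) ord_ge_power0[OF assms(1)]] assms(2) in auto)
  show ?thesis
  proof (induction k)
    case (Suc k)
    have "y ^ Suc k - x ^ Suc k = y * (y ^ k - x ^ k) + (y - x) * x ^ k"
      by (simp add: algebra_simps)
    moreover have "lc_coeff (y * (y ^ k - x ^ k)) n = real k * \<beta>"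
      using lc_coeff_mult_lowest[OF y(1) ord_ge_power_diff[OF assms(1) y(1,3)], of k] Suc y(2) by simp
    moreover have "lc_coeff ((y - x) * x ^ k) n = \<beta>"
      using lc_coeff_mult_lowest[OF y(3) ord_ge_power0[OF assms(1)], of k] pw[of k]
      by (simp add: y_def)
    ultimately show ?case by (simp only: lc_coeff_simps) (simp add: algebra_simps)
  qed simp
qed

text \<open>
  A gliding-hump argument: if the orders of the \<open>T k\<close> were unbounded below, the digits of
  \<open>u\<close> could be chosen one after the other so that infinitely many \<open>T k * (1 + u) ^ k\<close> have
  a coefficient \<open>1\<close> at a negative exponent.
\<close>

lemma uniform_ord_ge_of_weakly_convergent:
  fixes T :: "nat \<Rightarrow> lc"
  assumes "0 < N"
    and conv: "\<And>u. ord_ge (of_nat N) u \<Longrightarrow> lc_coeff u (of_nat N) = \<sigma> \<Longrightarrow>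
      \<exists>l. weak_lim (\<lambda>K. \<Sum>k\<le>K. T k * (1 + u) ^ k) l"
  shows "\<exists>m. \<forall>k. ord_ge m (T k)"
proof (rule ccontr)
  assume neg: "\<not> ?thesis"
  have "\<exists>k>i. T k \<noteq> 0 \<and> lc_lead (T k) < - of_nat (N + 1 + i)" for i
  proof -
    obtain M where M: "\<And>k. ord_ge (M k) (T k)"
      using choice[of "\<lambda>k m. ord_ge m (T k)"] ord_ge_ex by blast
    \<comment> \<open>Lying below the orders of the first \<open>i + 1\<close> terms forces the
      violating index beyond \<open>i\<close>, so the hump moves on.\<close>
    define m where "m = Min (insert (- of_nat (N + 1 + i)) (M ` {..i}))"
    have m: "m \<le> - of_nat (N + 1 + i)" "\<And>k. k \<le> i \<Longrightarrow> m \<le> M k"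
      by (simp add: m_def) (simp add: m_def, rule min.coboundedI2, rule Min_le, auto)
    obtain k where k: "\<not> ord_ge m (T k)" using neg by blast
    have "k > i" using k m(2)[of k] ord_ge_mono[OF M] by (meson not_less)
    moreover have "T k \<noteq> 0" using k by auto
    moreover have "lc_lead (T k) < m" using k ord_ge_iff_lead[OF \<open>T k \<noteq> 0\<close>] by auto
    ultimately show ?thesis using m(1) by (intro exI[of _ k]) auto
  qed
  then obtain \<kappa> where \<kappa>: "\<And>i. \<kappa> i > i" "\<And>i. T (\<kappa> i) \<noteq> 0"
    "\<And>i. lc_lead (T (\<kappa> i)) < - of_nat (N + 1 + i)" by metis
  \<comment> \<open>The exponent at which digit \<open>N + 1 + i\<close> of \<open>u\<close> first
    acts on \<open>T (\<kappa> i) * (1 + u) ^ \<kappa> i\<close>; it is negative by the choice of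
    \<open>\<kappa>\<close>.\<close>
  define e :: "nat \<Rightarrow> rat" where "e i = lc_lead (T (\<kappa> i)) + of_nat (N + 1 + i)" for i
  \<comment> \<open>That digit enters the coefficient at \<open>e i\<close> linearly, with factor
    \<open>\<kappa> i\<close> times the leading coefficient of \<open>T (\<kappa> i)\<close>;
    \<open>\<beta>\<close> solves for the value 1.\<close>
  define \<beta> where "\<beta> i U = (1 - lc_coeff (T (\<kappa> i) * (1 + U) ^ \<kappa> i) (e i)) /
    (real (\<kappa> i) * lc_coeff (T (\<kappa> i)) (lc_lead (T (\<kappa> i))))" for i U
  \<comment> \<open>Digit \<open>N\<close> is reserved for \<open>\<sigma>\<close>, as the
    hypothesis on convergence demands; the free digits start at \<open>N + 1\<close>.\<close>
  define U where "U = rec_nat (of_real \<sigma> * lc_mono (of_nat N))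
    (\<lambda>i U. U + of_real (\<beta> i U) * lc_mono (of_nat (N + 1 + i)))"
  have U0: "U 0 = of_real \<sigma> * lc_mono (of_nat N)"
    and US: "U (Suc i) = U i + of_real (\<beta> i (U i)) * lc_mono (of_nat (N + 1 + i))" for i
    by (simp_all add: U_def)
  have step: "ord_ge (of_nat (N + 1 + i)) (U (Suc i) - U i)" for i
    by (simp add: US ord_ge_def)
  have later: "ord_ge (of_nat (N + 1 + i)) (U n - U i)" if "n \<ge> i" for i n
    using that
  proof (induction n rule: dec_induct)
    case (step n)
    have "ord_ge (of_nat (N + 1 + i)) (U (Suc n) - U n)"
      by (rule ord_ge_mono[OF \<open>\<And>i. ord_ge (of_nat (N + 1 + i)) (U (Suc i) - U i)\<close>]) (use step in simp)
    then show ?case using ord_ge_add[OF step(3)] by fastforce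
  qed simp
  have "\<exists>l. strong_lim U l"
  proof (rule strong_lim_complete)
    fix m :: rat
    obtain i :: nat where i: "m < of_nat i" using ex_nat_gt_rat by blast
    have "ord_ge m (U n - U n')" if "n \<ge> i" "n' \<ge> i" for n n'
      using ord_ge_diff[OF later[OF that(1)] later[OF that(2)]] i by (auto elim: ord_ge_mono)
    then show "\<exists>N. \<forall>n\<ge>N. \<forall>n'\<ge>N. ord_ge m (U n - U n')" by blast
  qed
  then obtain u where u: "strong_lim U u" by blast
  have uU: "ord_ge (of_nat (N + 1 + i)) (u - U i)" for i
  proof -
    have "\<forall>\<^sub>F n in sequentially. ord_ge (of_nat (N + 1 + i)) (U n - u) \<and> n \<ge> i"
      using u unfolding strong_lim_iff by (intro eventually_conj eventually_ge_at_top) blast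
    then obtain n where "ord_ge (of_nat (N + 1 + i)) (U n - u)" "n \<ge> i"
      by (metis (mono_tags, lifting) eventually_sequentially order_refl)
    then show ?thesis using ord_ge_diff[OF later[of i n]] by fastforce
  qed
  have ordU: "ord_ge (of_nat N) (U i)" for i
  proof -
    have "ord_ge (of_nat N) (U i - U 0)" by (rule ord_ge_mono[OF later]) auto
    moreover have "ord_ge (of_nat N) (U 0)" by (simp add: U0 ord_ge_def)
    ultimately show ?thesis using ord_ge_add by fastforce
  qed
  have ordu: "ord_ge (of_nat N) u" using ord_ge_add[OF ord_ge_mono[OF uU[of 0]] ordU[of 0]] by simp
  have "lc_coeff (u - U 0) (of_nat N) = 0" by (rule ord_geD[OF uU]) simp
  then have "lc_coeff u (of_nat N) = \<sigma>" by (simp add: U0)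
  from conv[OF ordu this] obtain l where "weak_lim (\<lambda>K. \<Sum>k\<le>K. T k * (1 + u) ^ k) l" by blast
  from weak_lim_terms[OF this] obtain n0 where
    n0: "\<And>k q. k \<ge> n0 \<Longrightarrow> q \<le> 1 \<Longrightarrow> \<bar>lc_coeff (T k * (1 + u) ^ k) q\<bar> < 1"
    unfolding eventually_sequentially by blast
  define i where "i = n0"
  define k where "k = \<kappa> i"
  define n :: rat where "n = of_nat (N + 1 + i)"
  have unit: "ord_ge 0 (1 + U i)" for i
    using ordU[of i] by (intro ord_ge_add) (auto intro: ord_ge_mono)
  have unitu: "ord_ge 0 (1 + u)" using ordu by (intro ord_ge_add) (auto intro: ord_ge_mono)
  have "lc_coeff (U i) 0 = 0" using ord_geD[OF ordU[of i], of 0] \<open>0 < N\<close> by simp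
  then have c1: "lc_coeff (1 + U i) 0 = 1" by simp
  have "lc_coeff ((1 + U (Suc i)) ^ k - (1 + U i) ^ k) n = real k * \<beta> i (U i)"
    using lc_coeff_power_perturb[OF unit[of i] c1, of n "\<beta> i (U i)" k] by (simp add: US n_def algebra_simps)
  moreover have "ord_ge n ((1 + U (Suc i)) ^ k - (1 + U i) ^ k)"
    by (rule ord_ge_power_diff[OF unit unit]) (use step[of i] in \<open>simp add: n_def\<close>)
  ultimately have "lc_coeff (T k * ((1 + U (Suc i)) ^ k - (1 + U i) ^ k)) (e i)
      = lc_coeff (T k) (lc_lead (T k)) * (real k * \<beta> i (U i))"
    using lc_coeff_mult_lowest[OF ord_ge_lead[of "T k"]] by (simp add: e_def n_def k_def)
  moreover have "lc_coeff (T k) (lc_lead (T k)) \<noteq> 0" "real k \<noteq> 0"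
    using \<kappa>(2)[of i] \<kappa>(1)[of i] lc_lead_props(1) by (auto simp: k_def)
  ultimately have "lc_coeff (T k * ((1 + U (Suc i)) ^ k - (1 + U i) ^ k)) (e i)
      = 1 - lc_coeff (T k * (1 + U i) ^ k) (e i)"
    by (simp add: \<beta>_def k_def field_simps)
  then have one: "lc_coeff (T k * (1 + U (Suc i)) ^ k) (e i) = 1"
    by (simp add: right_diff_distrib)
  \<comment> \<open>Digits chosen later have exponent at least \<open>N + 2 + i\<close> and act only
    above \<open>e i\<close>.\<close>
  have "ord_ge (of_nat (N + 1 + Suc i)) ((1 + u) ^ k - (1 + U (Suc i)) ^ k)"
    by (rule ord_ge_power_diff[OF unit unitu]) (use uU[of "Suc i"] in simp)
  then have "ord_ge (lc_lead (T k) + of_nat (N + 1 + Suc i)) (T k * ((1 + u) ^ k - (1 + U (Suc i)) ^ k))"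
    by (intro ord_ge_mult ord_ge_lead)
  then have "lc_coeff (T k * ((1 + u) ^ k - (1 + U (Suc i)) ^ k)) (e i) = 0"
    by (rule ord_geD) (simp add: e_def k_def)
  then have "lc_coeff (T k * (1 + u) ^ k) (e i) = 1" using one by (simp add: right_diff_distrib)
  moreover have "e i \<le> 1" using \<kappa>(3)[of i] by (simp add: e_def)
  moreover have "k \<ge> n0" using \<kappa>(1)[of i] by (simp add: k_def i_def)
  ultimately show False using n0[of k "e i"] by simp
qed

section \<open>Rapidly decreasing sequences\<close>

text \<open>Evaluation at \<open>2 * s\<close> minus \<open>2 ^ Suc J\<close> times evaluation at
  \<open>s\<close> cancels the top coefficient and multiplies the others by nonzero
  constants.\<close>

lemma poly_coeffs_convergent:
  fixes a :: "nat \<Rightarrow> nat \<Rightarrow> real"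
  assumes "\<And>s. 0 < s \<Longrightarrow> convergent (\<lambda>K. \<Sum>j\<le>J. a j K * s ^ j)"
  shows "\<forall>j\<le>J. convergent (a j)"
  using assms
proof (induction J arbitrary: a)
  case 0
  then show ?case using 0[of 1] by simp
next
  case (Suc J)
  define a' where "a' j K = (2 ^ j - 2 ^ Suc J) * a j K" for j K
  have "\<forall>j\<le>J. convergent (a' j)"
  proof (rule Suc.IH)
    fix s :: real assume s: "0 < s"
    have eq: "(\<Sum>j\<le>J. a' j K * s ^ j) =
      (\<Sum>j\<le>Suc J. a j K * (2 * s) ^ j) - 2 ^ Suc J * (\<Sum>j\<le>Suc J. a j K * s ^ j)" for K
    proof -
      have "(\<Sum>j\<le>Suc J. a j K * (2 * s) ^ j) - 2 ^ Suc J * (\<Sum>j\<le>Suc J. a j K * s ^ j)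
        = (\<Sum>j\<le>Suc J. a' j K * s ^ j)"
        unfolding sum_distrib_left sum_subtractf[symmetric]
        by (rule sum.cong) (auto simp: a'_def power_mult_distrib algebra_simps)
      also have "\<dots> = (\<Sum>j\<le>J. a' j K * s ^ j)" by (simp add: a'_def)
      finally show ?thesis by simp
    qed
    show "convergent (\<lambda>K. \<Sum>j\<le>J. a' j K * s ^ j)"
      unfolding eq using s
      by (intro convergent_diff convergent_mult convergent_const Suc.prems) auto
  qed
  have low: "convergent (a j)" if "j \<le> J" for j
  proof -
    have nz: "(2::real) ^ j - 2 ^ Suc J \<noteq> 0" using that
      by (metis eq_iff_diff_eq_0 not_less_eq_eq order_refl power_inject_exp one_less_numeral_iff semiring_norm(76))
    have "convergent (\<lambda>K. inverse (2 ^ j - 2 ^ Suc J) * a' j K)"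
      using \<open>\<forall>j\<le>J. convergent (a' j)\<close> that by (intro convergent_mult convergent_const) auto
    moreover have "inverse (2 ^ j - 2 ^ Suc J) * a' j K = a j K" for K
      using nz by (simp add: a'_def del: power_Suc)
    ultimately show ?thesis by simp
  qed
  have "convergent (\<lambda>K. (\<Sum>j\<le>Suc J. a j K * 1 ^ j) - (\<Sum>j\<le>J. a j K))"
    using low by (intro convergent_diff Suc.prems convergent_sum) auto
  then have "convergent (a (Suc J))" by simp
  then show ?case using low le_Suc_eq by auto
qed

text \<open>This class is stable under the factors \<open>k choose j\<close> that an infinitesimal
  perturbation of the argument of a power series produces.\<close>

definition rapid :: "(nat \<Rightarrow> real) \<Rightarrow> bool" where
  "rapid a \<longleftrightarrow> (\<forall>j. \<exists>C. \<forall>k. real k ^ j * \<bar>a k\<bar> \<le> C)"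

text \<open>Terms of a convergent series are bounded, and \<open>k choose j\<close> dominates
  \<open>(k / j) ^ j\<close> for \<open>k \<ge> j\<close>, so bounds on all binomial multiples are
  bounds on all power multiples.\<close>

lemma rapidI_binomial:
  fixes a :: "nat \<Rightarrow> real"
  assumes "\<And>j. convergent (\<lambda>K. \<Sum>k\<le>K. real (k choose j) * a k)"
  shows "rapid a"
  unfolding rapid_def
proof
  fix j
  have "summable (\<lambda>k. real (k choose j) * a k)"
    using assms[of j] by (simp add: summable_iff_convergent')
  then have "Bseq (\<lambda>k. real (k choose j) * a k)"
    using summable_LIMSEQ_zero convergentI convergent_imp_Bseq by blast
  then obtain B where B: "\<And>k. \<bar>real (k choose j) * a k\<bar> \<le> B" unfolding Bseq_def by auto
  \<comment> \<open>\<open>j ^ j\<close> comes from that lower bound for the binomial coefficient;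
    the finite sum takes care of the indices below \<open>j\<close>.\<close>
  define C where "C = real j ^ j * (B + (\<Sum>i<j. \<bar>a i\<bar>))"
  have B0: "0 \<le> B" using B[of 0] abs_ge_zero order.trans by blast
  have "real k ^ j * \<bar>a k\<bar> \<le> C" for k
  proof (cases "j \<le> k")
    case True
    have "real k ^ j \<le> real j ^ j * real (k choose j)"
    proof (cases "j = 0")
      case False
      have "(real k / real j) ^ j \<le> real (k choose j)"
        using binomial_ge_n_over_k_pow_k[OF True, where ?'a = real] by simp
      then show ?thesis using False by (simp add: power_divide field_simps)
    qed auto
    then have "real k ^ j * \<bar>a k\<bar> \<le> real j ^ j * real (k choose j) * \<bar>a k\<bar>"
      by (intro mult_right_mono) auto
    also have "\<dots> = real j ^ j * \<bar>real (k choose j) * a k\<bar>" by (simp add: abs_mult)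
    also have "\<dots> \<le> real j ^ j * (B + (\<Sum>i<j. \<bar>a i\<bar>))"
      using B[of k] by (intro mult_left_mono) (auto intro: order.trans add_increasing2 sum_nonneg)
    finally show ?thesis by (simp add: C_def)
  next
    case False
    have "\<bar>a k\<bar> \<le> (\<Sum>i<j. \<bar>a i\<bar>)" using False by (intro member_le_sum) auto
    then have "\<bar>a k\<bar> \<le> B + (\<Sum>i<j. \<bar>a i\<bar>)" using B0 by simp
    then show ?thesis unfolding C_def using False by (intro mult_mono power_mono) auto
  qed
  then show "\<exists>C. \<forall>k. real k ^ j * \<bar>a k\<bar> \<le> C" by blast
qed

lemma rapid_le:
  assumes "rapid a" "\<And>k. \<bar>b k\<bar> \<le> c * real (Suc k) ^ i * \<bar>a k\<bar>"
  shows "rapid b"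
  unfolding rapid_def
proof
  fix j
  obtain C where C: "\<And>k. real k ^ (i + j) * \<bar>a k\<bar> \<le> C" using assms(1) unfolding rapid_def by blast
  \<comment> \<open>The term at 0 is kept apart because \<open>Suc k \<le> 2 * k\<close>, the source
    of \<open>2 ^ i\<close>, needs \<open>k > 0\<close>.\<close>
  have "real k ^ j * \<bar>b k\<bar> \<le> \<bar>b 0\<bar> + \<bar>c\<bar> * 2 ^ i * C" for k
  proof (cases "k = 0")
    case True
    have "0 \<le> C" using C[of 0] by (rule order.trans[rotated]) simp
    moreover have "real k ^ j * \<bar>b k\<bar> \<le> \<bar>b 0\<bar>" using True by (simp add: mult_left_le_one_le power_le_one)
    ultimately show ?thesis by (simp add: add_increasing2)
  next
    case False
    have "real (Suc k) ^ i \<le> (2 * real k) ^ i" using False by (intro power_mono) auto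
    then have *: "c * real (Suc k) ^ i * \<bar>a k\<bar> \<le> \<bar>c\<bar> * (2 * real k) ^ i * \<bar>a k\<bar>"
      by (intro mult_right_mono mult_mono) auto
    have "real k ^ j * \<bar>b k\<bar> \<le> real k ^ j * (\<bar>c\<bar> * (2 * real k) ^ i * \<bar>a k\<bar>)"
      using assms(2)[of k] * by (intro mult_left_mono) auto
    also have "\<dots> = \<bar>c\<bar> * 2 ^ i * (real k ^ (i + j) * \<bar>a k\<bar>)"
      by (simp add: power_mult_distrib power_add)
    also have "\<dots> \<le> \<bar>c\<bar> * 2 ^ i * C" using C by (intro mult_left_mono) auto
    finally show ?thesis by (simp add: add_increasing)
  qed
  then show "\<exists>C. \<forall>k. real k ^ j * \<bar>b k\<bar> \<le> C" by blast
qed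

lemma rapid_add:
  assumes "rapid a" "rapid b"
  shows "rapid (\<lambda>k. a k + b k)"
  unfolding rapid_def
proof
  fix j
  obtain C where C: "\<And>k. real k ^ j * \<bar>a k\<bar> \<le> C" using assms(1) unfolding rapid_def by blast
  obtain D where D: "\<And>k. real k ^ j * \<bar>b k\<bar> \<le> D" using assms(2) unfolding rapid_def by blast
  have "real k ^ j * \<bar>a k + b k\<bar> \<le> C + D" for k
  proof -
    have "real k ^ j * \<bar>a k + b k\<bar> \<le> real k ^ j * (\<bar>a k\<bar> + \<bar>b k\<bar>)" by (intro mult_left_mono) auto
    also have "\<dots> \<le> C + D" unfolding distrib_left by (intro add_mono C D)
    finally show ?thesis .
  qed
  then show "\<exists>C. \<forall>k. real k ^ j * \<bar>a k + b k\<bar> \<le> C" by blast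
qed

lemma rapid_zero: "rapid (\<lambda>k. 0)"
  by (auto simp: rapid_def)

lemma rapid_sum:
  "(\<And>i. i \<in> S \<Longrightarrow> rapid (a i)) \<Longrightarrow> rapid (\<lambda>k. \<Sum>i\<in>S. a i k)"
  by (induction S rule: infinite_finite_induct) (auto simp: rapid_zero intro!: rapid_add)

lemma rapid_cmult: "rapid a \<Longrightarrow> rapid (\<lambda>k. c * a k)"
  by (rule rapid_le[of a _ "\<bar>c\<bar>" 0]) (auto simp: abs_mult)

lemma rapid_Suc: 
  assumes "rapid (\<lambda>k. a (Suc k))"
  shows "rapid a"
  unfolding rapid_def
proof
  fix j
  have "rapid (\<lambda>k. real (Suc k) ^ j * a (Suc k))"
    by (rule rapid_le[OF assms, of _ 1 j]) (auto simp: abs_mult)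
  then obtain C where C: "\<And>k. real k ^ 0 * \<bar>real (Suc k) ^ j * a (Suc k)\<bar> \<le> C"
    unfolding rapid_def by blast
  have "real k ^ j * \<bar>a k\<bar> \<le> max (0 ^ j * \<bar>a 0\<bar>) C" for k
    using C[of "k - 1"] by (cases k) (auto simp: abs_mult)
  then show "\<exists>C. \<forall>k. real k ^ j * \<bar>a k\<bar> \<le> C" by blast
qed

lemma rapid_bound:
  assumes "rapid a"
  shows "\<exists>C. \<forall>k. \<bar>a k\<bar> \<le> C * (1 / real (Suc k) ^ 2)"
proof -
  have "rapid (\<lambda>k. real (Suc k) ^ 2 * a k)"
    by (rule rapid_le[OF assms, of _ 1 2]) (auto simp: abs_mult)
  then obtain C where C: "\<And>k. real k ^ 0 * \<bar>real (Suc k) ^ 2 * a k\<bar> \<le> C"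
    unfolding rapid_def by blast
  have "\<bar>a k\<bar> \<le> C * (1 / real (Suc k) ^ 2)" for k
    using C[of k] by (simp add: abs_mult field_simps)
  then show ?thesis by blast
qed

lemma summable_inverse_Suc_square: "summable (\<lambda>k. C * (1 / real (Suc k) ^ 2))"
  using inverse_squares_sums sums_summable by (intro summable_mult) fastforce

lemma rapid_summable:
  assumes "rapid a"
  shows "summable (\<lambda>k. \<bar>a k\<bar>)"
proof -
  obtain C where "\<And>k. \<bar>a k\<bar> \<le> C * (1 / real (Suc k) ^ 2)" using rapid_bound[OF assms] by blast
  then show ?thesis
    by (intro summable_comparison_test[OF _ summable_inverse_Suc_square[of C]]) auto
qed

text \<open>The j-th power of \<open>w\<close> has order at least \<open>j * \<mu>\<close>, so it
  cannot reach \<open>q\<close> once \<open>j > J\<close>. The bound \<open>J\<close> is the same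
  for every \<open>k\<close>, which makes each coefficient of a perturbed series a finite
  combination of binomially weighted series.\<close>

lemma lc_coeff_mult_binomial:
  assumes X: "ord_ge m X" and w: "ord_ge \<mu> w" "0 < \<mu>" and q: "q < m + of_nat (Suc J) * \<mu>"
  shows "lc_coeff (X * (of_real s + w) ^ k) q =
    (\<Sum>j\<le>J. real (k choose j) * s ^ (k - j) * lc_coeff (X * w ^ j) q)"
proof -
  define g where "g j = real (k choose j) * s ^ (k - j) * lc_coeff (X * w ^ j) q" for j
  have "X * (w + of_real s) ^ k = (\<Sum>j\<le>k. of_real (real (k choose j) * s ^ (k - j)) * (X * w ^ j))"
    unfolding binomial_ring sum_distrib_left by (rule sum.cong) (auto simp: algebra_simps)
  then have "lc_coeff (X * (of_real s + w) ^ k) q = (\<Sum>j\<le>k. g j)"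
    by (simp only: lc_coeff_sum lc_coeff_of_real_mult g_def add.commute)
  also have "\<dots> = (\<Sum>j\<le>max k J. g j)"
    by (rule sum.mono_neutral_left) (auto simp: g_def binomial_eq_0)
  also have "\<dots> = (\<Sum>j\<le>J. g j)"
  proof (rule sum.mono_neutral_right)
    show "\<forall>i\<in>{..max k J} - {..J}. g i = 0"
    proof
      fix i assume "i \<in> {..max k J} - {..J}"
      then have "of_nat (Suc J) * \<mu> \<le> of_nat i * \<mu>" using w(2) by (intro mult_right_mono) auto
      then have "q < m + of_nat i * \<mu>" using q by linarith
      then show "g i = 0" using ord_geD[OF ord_ge_mult[OF X ord_ge_power[OF w(1), of i]], of q]
        by (simp add: g_def)
    qed
  qed auto
  finally show ?thesis by (simp add: g_def)
qed

lemma ex_nat_mult_gt: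
  assumes "0 < (\<mu>::rat)"
  shows "\<exists>J::nat. q < m + of_nat (Suc J) * \<mu>"
proof -
  obtain J :: nat where J: "(q - m) / \<mu> < of_nat J" using ex_nat_gt_rat by blast
  then have "q - m < of_nat J * \<mu>" using assms by (simp add: pos_divide_less_eq)
  then show ?thesis using assms by (intro exI[of _ J]) (simp add: algebra_simps)
qed

text \<open>
  For fixed \<open>q\<close> the \<open>q\<close>-th coefficient of the perturbed series is a polynomial in \<open>s\<close> of
  bounded degree, so convergence for all \<open>s\<close> gives convergence of each coefficient.
\<close>

lemma binomial_sums_convergent:
  fixes T :: "nat \<Rightarrow> lc"
  assumes m: "\<And>k. ord_ge m (T k)" and N: "0 < N" and \<sigma>: "\<sigma> \<noteq> 0"
    and conv: "\<And>s. 0 < s \<Longrightarrow>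
      \<exists>l. weak_lim (\<lambda>K. \<Sum>k\<le>K. T k * (1 + of_real (s * \<sigma>) * lc_mono (of_nat N)) ^ k) l"
  shows "convergent (\<lambda>K. \<Sum>k\<le>K. real (k choose j) * lc_coeff (T k) q)"
proof -
  define \<nu> :: rat where "\<nu> = of_nat N"
  have \<nu>: "0 < \<nu>" using N by (simp add: \<nu>_def)
  \<comment> \<open>The j-th power of the perturbation moves the coefficient at \<open>q\<close> to
    \<open>q'\<close>, where it appears as a coefficient of \<open>s ^ j\<close>.\<close>
  define q' where "q' = q + of_nat j * \<nu>"
  obtain J0 :: nat where J0: "q' < m + of_nat (Suc J0) * \<nu>" using ex_nat_mult_gt[OF \<nu>] by blast
  define J where "J = max j J0"
  have J: "q' < m + of_nat (Suc J) * \<nu>"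
  proof -
    have "of_nat (Suc J0) * \<nu> \<le> of_nat (Suc J) * \<nu>" using \<nu> by (intro mult_right_mono) (auto simp: J_def)
    then show ?thesis using J0 by linarith
  qed
  define a where "a i K = (\<Sum>k\<le>K. real (k choose i) * \<sigma> ^ i * lc_coeff (T k) (q' - of_nat i * \<nu>))" for i K
  have "\<forall>i\<le>J. convergent (a i)"
  proof (rule poly_coeffs_convergent)
    fix s :: real assume s: "0 < s"
    define w where "w = of_real (s * \<sigma>) * lc_mono \<nu>"
    obtain l where l: "weak_lim (\<lambda>K. \<Sum>k\<le>K. T k * (1 + w) ^ k) l"
      using conv[OF s] by (auto simp: w_def \<nu>_def)
    have w: "ord_ge \<nu> w"
      unfolding w_def by (rule ord_ge_mult2[OF ord_ge_of_real ord_ge_mono_lc]) simp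
    have wj: "w ^ i = of_real ((s * \<sigma>) ^ i) * lc_mono (of_nat i * \<nu>)" for i
      by (induction i) (simp_all add: lc_mono_0 w_def lc_mono_mult[symmetric] algebra_simps)
    have co: "lc_coeff (T k * w ^ i) q' = (s * \<sigma>) ^ i * lc_coeff (T k) (q' - of_nat i * \<nu>)" for i k
    proof -
      have "T k * w ^ i = of_real ((s * \<sigma>) ^ i) * (lc_mono (of_nat i * \<nu>) * T k)"
        by (simp only: wj mult_ac)
      then show ?thesis by (simp only: lc_coeff_of_real_mult lc_coeff_mono_mult)
    qed
    have "lc_coeff (\<Sum>k\<le>K. T k * (1 + w) ^ k) q' = (\<Sum>i\<le>J. a i K * s ^ i)" for K
    proof -
      have "lc_coeff (\<Sum>k\<le>K. T k * (1 + w) ^ k) q' =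
        (\<Sum>k\<le>K. \<Sum>i\<le>J. real (k choose i) * ((s * \<sigma>) ^ i * lc_coeff (T k) (q' - of_nat i * \<nu>)))"
        using lc_coeff_mult_binomial[OF m w \<nu> J, of _ 1] by (simp add: co)
      also have "\<dots> = (\<Sum>i\<le>J. \<Sum>k\<le>K. real (k choose i) * ((s * \<sigma>) ^ i * lc_coeff (T k) (q' - of_nat i * \<nu>)))"
        by (rule sum.swap)
      also have "\<dots> = (\<Sum>i\<le>J. a i K * s ^ i)"
        unfolding a_def sum_distrib_right by (intro sum.cong) (auto simp: power_mult_distrib)
      finally show ?thesis .
    qed
    then show "convergent (\<lambda>K. \<Sum>i\<le>J. a i K * s ^ i)"
      using weak_lim_coeff[OF l, of q'] by (auto simp: convergent_def)
  qed
  then have "convergent (a j)" by (simp add: J_def)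
  then have "convergent (\<lambda>K. inverse (\<sigma> ^ j) * a j K)"
    by (intro convergent_mult convergent_const)
  moreover have "inverse (\<sigma> ^ j) * a j K = (\<Sum>k\<le>K. real (k choose j) * lc_coeff (T k) q)" for K
    unfolding a_def sum_distrib_left q'_def using \<sigma> by (intro sum.cong) auto
  ultimately show ?thesis by simp
qed

section \<open>Coefficientwise integration\<close>

text \<open>The second condition bounds the supports jointly over the whole parameter interval; it
  makes the coefficientwise integral left-finite again and leaves finitely many terms in each
  coefficient of a product.\<close>

definition tame :: "(real \<Rightarrow> lc) \<Rightarrow> bool" where
  "tame u \<longleftrightarrow> (\<forall>q. continuous_on {0..1} (\<lambda>t. lc_coeff (u t) q)) \<and>
    (\<forall>Q. finite {q. q \<le> Q \<and> (\<exists>t\<in>{0..1}. lc_coeff (u t) q \<noteq> 0)})"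

lemma tame_continuous: "tame u \<Longrightarrow> continuous_on {0..1} (\<lambda>t. lc_coeff (u t) q)"
  by (simp add: tame_def)

lemma tame_finite: "tame u \<Longrightarrow> finite {q. q \<le> Q \<and> (\<exists>t\<in>{0..1}. lc_coeff (u t) q \<noteq> 0)}"
  by (simp add: tame_def)

lemma finite_low_imp_bound:
  assumes "finite {q. q \<le> 0 \<and> P (q::rat)}"
  shows "\<exists>m. \<forall>q<m. \<not> P q"
proof -
  define m where "m = Min (insert 0 {q. q \<le> 0 \<and> P q})"
  have "\<not> P q" if "q < m" for q
  proof
    assume "P q"
    have "m \<le> 0" unfolding m_def using assms by (intro Min_le) auto
    then have "q \<le> 0" using that by linarith
    then have "m \<le> q" unfolding m_def using assms \<open>P q\<close> by (intro Min_le) auto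
    then show False using that by simp
  qed
  then show ?thesis by blast
qed

lemma tame_ord:
  assumes "tame u"
  shows "\<exists>m. \<forall>t\<in>{0..1}. ord_ge m (u t)"
  using finite_low_imp_bound[OF tame_finite[OF assms, of 0]] unfolding ord_ge_def by blast

lemma tame_const: "tame (\<lambda>t. c)"
  unfolding tame_def
proof (intro conjI allI)
  fix Q
  show "finite {q. q \<le> Q \<and> (\<exists>t\<in>{0..1::real}. lc_coeff c q \<noteq> 0)}"
    by (rule finite_subset[OF _ finite_lc_trunc[of c Q]]) auto
qed simp

lemma tame_of_real:
  assumes "continuous_on {0..1} g"
  shows "tame (\<lambda>t. of_real (g t))"
proof -
  have "{q. q \<le> Q \<and> (\<exists>t\<in>{0..1}. lc_coeff (of_real (g t)) q \<noteq> 0)} \<subseteq> {0}" for Q by auto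
  then have "finite {q. q \<le> Q \<and> (\<exists>t\<in>{0..1}. lc_coeff (of_real (g t)) q \<noteq> 0)}" for Q
    by (meson finite.emptyI finite_insert finite_subset)
  moreover have "continuous_on {0..1} (\<lambda>t. lc_coeff (of_real (g t)) q)" for q
    by (cases "q = 0") (auto simp: assms)
  ultimately show ?thesis unfolding tame_def by blast
qed

lemma tame_add:
  assumes "tame u" "tame v"
  shows "tame (\<lambda>t. u t + v t)"
  unfolding tame_def
proof (intro conjI allI)
  fix q show "continuous_on {0..1} (\<lambda>t. lc_coeff (u t + v t) q)"
    using assms by (auto intro!: continuous_on_add tame_continuous)
next
  fix Q
  have "{q. q \<le> Q \<and> (\<exists>t\<in>{0..1}. lc_coeff (u t + v t) q \<noteq> 0)} \<subseteq>
    {q. q \<le> Q \<and> (\<exists>t\<in>{0..1}. lc_coeff (u t) q \<noteq> 0)} \<union> {q. q \<le> Q \<and> (\<exists>t\<in>{0..1}. lc_coeff (v t) q \<noteq> 0)}"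
    by auto
  then show "finite {q. q \<le> Q \<and> (\<exists>t\<in>{0..1}. lc_coeff (u t + v t) q \<noteq> 0)}"
    by (rule finite_subset) (use assms in \<open>simp add: tame_finite\<close>)
qed

text \<open>Lower bounds of both supports confine either summand of an exponent up to
  \<open>Q\<close> to a finite set.\<close>

lemma finite_product_support:
  assumes U: "\<And>Q. finite {q. q \<le> Q \<and> U (q::rat)}" and V: "\<And>Q. finite {q. q \<le> Q \<and> V (q::rat)}"
  shows "finite {q. q \<le> Q \<and> (\<exists>p. U p \<and> V (q - p))}"
proof -
  obtain m where m: "\<And>q. U q \<Longrightarrow> m \<le> q" using finite_low_imp_bound[OF U[of 0]] not_less by blast
  obtain n where n: "\<And>q. V q \<Longrightarrow> n \<le> q" using finite_low_imp_bound[OF V[of 0]] not_less by blast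
  have "q \<in> (\<lambda>(p, r). p + r) ` ({q. q \<le> Q - n \<and> U q} \<times> {q. q \<le> Q - m \<and> V q})"
    if "q \<le> Q" "U p" "V (q - p)" for q p
    using that m[OF that(2)] n[OF that(3)] by (intro rev_image_eqI[of "(p, q - p)"]) auto
  then have "{q. q \<le> Q \<and> (\<exists>p. U p \<and> V (q - p))} \<subseteq>
    (\<lambda>(p, r). p + r) ` ({q. q \<le> Q - n \<and> U q} \<times> {q. q \<le> Q - m \<and> V q})" by blast
  then show ?thesis by (rule finite_subset) (intro finite_imageI finite_cartesian_product U V)
qed

lemma lc_coeff_mult_nonzeroD:
  assumes "lc_coeff (x * y) q \<noteq> 0"
  shows "\<exists>p. lc_coeff x p \<noteq> 0 \<and> lc_coeff y (q - p) \<noteq> 0"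
proof -
  obtain p where "p \<in> {p. lc_coeff x p \<noteq> 0 \<and> lc_coeff y (q - p) \<noteq> 0}"
    using sum.not_neutral_contains_not_neutral[OF assms[unfolded lc_coeff_mult]] by blast
  then show ?thesis by blast
qed

lemma tame_mult:
  assumes "tame u" "tame v"
  shows "tame (\<lambda>t. u t * v t)"
  unfolding tame_def
proof (intro conjI allI)
  fix q
  obtain n where n: "\<And>t. t \<in> {0..1} \<Longrightarrow> ord_ge n (v t)" using tame_ord[OF assms(2)] by blast
  define S where "S = {p. p \<le> q - n \<and> (\<exists>t\<in>{0..1}. lc_coeff (u t) p \<noteq> 0)}"
  have S: "finite S" unfolding S_def by (rule tame_finite[OF assms(1)])
  have eq: "lc_coeff (u t * v t) q = (\<Sum>p\<in>S. lc_coeff (u t) p * lc_coeff (v t) (q - p))" if t: "t \<in> {0..1}" for t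
  proof (rule lc_coeff_mult_left[OF S])
    fix p assume "lc_coeff (u t) p \<noteq> 0" "lc_coeff (v t) (q - p) \<noteq> 0"
    moreover have "n \<le> q - p" using calculation(2) ord_geD[OF n[OF t]] not_less by blast
    ultimately show "p \<in> S" unfolding S_def using t by auto
  qed
  have "continuous_on {0..1} (\<lambda>t. \<Sum>p\<in>S. lc_coeff (u t) p * lc_coeff (v t) (q - p))"
    using assms by (intro continuous_on_sum continuous_on_mult tame_continuous)
  then show "continuous_on {0..1} (\<lambda>t. lc_coeff (u t * v t) q)"
    by (rule continuous_on_eq) (simp add: eq)
next
  fix Q
  have "{q. q \<le> Q \<and> (\<exists>t\<in>{0..1}. lc_coeff (u t * v t) q \<noteq> 0)} \<subseteq>
    {q. q \<le> Q \<and> (\<exists>p. (\<exists>t\<in>{0..1}. lc_coeff (u t) p \<noteq> 0) \<and> (\<exists>t\<in>{0..1}. lc_coeff (v t) (q - p) \<noteq> 0))}"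
    using lc_coeff_mult_nonzeroD by blast
  then show "finite {q. q \<le> Q \<and> (\<exists>t\<in>{0..1}. lc_coeff (u t * v t) q \<noteq> 0)}"
    by (rule finite_subset) (intro finite_product_support tame_finite assms)
qed

lemma tame_power: "tame u \<Longrightarrow> tame (\<lambda>t. u t ^ n)"
  by (induction n) (auto intro: tame_const tame_mult)

lemma tame_sum: "(\<And>i. i \<in> S \<Longrightarrow> tame (u i)) \<Longrightarrow> tame (\<lambda>t. \<Sum>i\<in>S. u i t)"
  by (induction S rule: infinite_finite_induct) (auto intro: tame_const tame_add)

lemma tame_bound:
  assumes "tame u"
  shows "\<exists>C. \<forall>t\<in>{0..1}. \<bar>lc_coeff (u t) q\<bar> \<le> C"
proof -
  have "compact ((\<lambda>t. lc_coeff (u t) q) ` {0..1})"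
    by (intro compact_continuous_image tame_continuous assms) auto
  then have "bounded ((\<lambda>t. lc_coeff (u t) q) ` {0..1})" by (rule compact_imp_bounded)
  then obtain C where "\<forall>x\<in>(\<lambda>t. lc_coeff (u t) q) ` {0..1}. norm x \<le> C"
    unfolding bounded_iff by (elim exE)
  then have "\<forall>t\<in>{0..1}. \<bar>lc_coeff (u t) q\<bar> \<le> C" by simp
  then show ?thesis by (rule exI)
qed

text \<open>Meaningful for tame \<open>u\<close>; otherwise the family of integrals may fail to be
  left-finite, and then the value of \<open>Abs_lc\<close> is unspecified.\<close>

definition lc_int :: "(real \<Rightarrow> lc) \<Rightarrow> lc" where
  "lc_int u = Abs_lc (\<lambda>q. integral {0..1} (\<lambda>t. lc_coeff (u t) q))"

lemma lc_coeff_int: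
  assumes "tame u"
  shows "lc_coeff (lc_int u) q = integral {0..1} (\<lambda>t. lc_coeff (u t) q)"
proof -
  have "left_finite {q. integral {0..1} (\<lambda>t. lc_coeff (u t) q) \<noteq> 0}"
    unfolding left_finite_def
  proof
    fix Q
    have "{x \<in> {q. integral {0..1} (\<lambda>t. lc_coeff (u t) q) \<noteq> 0}. x \<le> Q} \<subseteq>
      {q. q \<le> Q \<and> (\<exists>t\<in>{0..1}. lc_coeff (u t) q \<noteq> 0)}"
    proof
      fix q assume q: "q \<in> {x \<in> {q. integral {0..1} (\<lambda>t. lc_coeff (u t) q) \<noteq> 0}. x \<le> Q}"
      have "\<exists>t\<in>{0..1}. lc_coeff (u t) q \<noteq> 0"
      proof (rule ccontr)
        assume "\<not> ?thesis"
        then have "integral {0..1} (\<lambda>t. lc_coeff (u t) q) = integral {0..1} (\<lambda>t::real. 0)"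
          by (intro Henstock_Kurzweil_Integration.integral_cong) auto
        then show False using q by simp
      qed
      then show "q \<in> {q. q \<le> Q \<and> (\<exists>t\<in>{0..1}. lc_coeff (u t) q \<noteq> 0)}" using q by simp
    qed
    then show "finite {x \<in> {q. integral {0..1} (\<lambda>t. lc_coeff (u t) q) \<noteq> 0}. x \<le> Q}"
      by (rule finite_subset) (rule tame_finite[OF assms])
  qed
  then show ?thesis unfolding lc_int_def by (subst Abs_lc_inverse) auto
qed

lemma tame_integrable: "tame u \<Longrightarrow> (\<lambda>t. lc_coeff (u t) q) integrable_on {0..1}"
  by (rule integrable_continuous_real) (rule tame_continuous)

lemma lc_int_add: "tame u \<Longrightarrow> tame v \<Longrightarrow> lc_int (\<lambda>t. u t + v t) = lc_int u + lc_int v"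
  by (rule lc_eqI) (simp add: lc_coeff_int tame_add integral_add tame_integrable)

lemma lc_int_const: "lc_int (\<lambda>t. c) = c"
  by (rule lc_eqI) (simp add: lc_coeff_int tame_const)

lemma lc_int_sum: "(\<And>i. i \<in> S \<Longrightarrow> tame (u i)) \<Longrightarrow> lc_int (\<lambda>t. \<Sum>i\<in>S. u i t) = (\<Sum>i\<in>S. lc_int (u i))"
  by (induction S rule: infinite_finite_induct) (auto simp: lc_int_const lc_int_add tame_sum)

text \<open>Linearity over the whole field, not only over the reals: by the common order bound
  \<open>m\<close> of a tame function, each coefficient of the product is one finite sum for all
  \<open>t\<close>.\<close>

lemma lc_int_cmult:
  assumes "tame u"
  shows "lc_int (\<lambda>t. c * u t) = c * lc_int u"
proof (rule lc_eqI)
  fix q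
  obtain m where m: "\<And>t. t \<in> {0..1} \<Longrightarrow> ord_ge m (u t)" using tame_ord[OF assms] by blast
  have m': "ord_ge m (lc_int u)" unfolding ord_ge_def
  proof (intro allI impI)
    fix q assume "q < m"
    then have "integral {0..1} (\<lambda>t. lc_coeff (u t) q) = integral {0..1} (\<lambda>t::real. 0)"
      by (intro Henstock_Kurzweil_Integration.integral_cong) (use m ord_geD in auto)
    then show "lc_coeff (lc_int u) q = 0" by (simp add: lc_coeff_int[OF assms])
  qed
  define S where "S = {p. lc_coeff c p \<noteq> 0 \<and> p \<le> q - m}"
  have S: "finite S" unfolding S_def by (rule finite_lc_trunc)
  have "lc_coeff (lc_int (\<lambda>t. c * u t)) q = integral {0..1} (\<lambda>t. lc_coeff (c * u t) q)"
    by (intro lc_coeff_int tame_mult tame_const assms)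
  also have "\<dots> = integral {0..1} (\<lambda>t. \<Sum>p\<in>S. lc_coeff c p * lc_coeff (u t) (q - p))"
    using lc_coeff_mult_ord[OF m, of _ c q] by (intro Henstock_Kurzweil_Integration.integral_cong) (simp add: mult.commute S_def)
  also have "\<dots> = (\<Sum>p\<in>S. lc_coeff c p * lc_coeff (lc_int u) (q - p))"
    using S assms by (simp add: integral_sum tame_integrable lc_coeff_int integrable_on_mult_right)
  also have "\<dots> = lc_coeff (c * lc_int u) q"
    using lc_coeff_mult_ord[OF m', of c q] by (simp add: mult.commute S_def)
  finally show "lc_coeff (lc_int (\<lambda>t. c * u t)) q = lc_coeff (c * lc_int u) q" .
qed

text \<open>End points are left out because the intervals to be integrated over may be open, and
  there the integrand is not controlled.\<close>

lemma lc_int_cong_open: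
  assumes "tame u" "tame v" "\<And>t. 0 < t \<Longrightarrow> t < 1 \<Longrightarrow> u t = v t"
  shows "lc_int u = lc_int v"
proof (rule lc_eqI)
  fix q
  have "integral {0..1} (\<lambda>t. lc_coeff (u t) q) = integral {0..1} (\<lambda>t. lc_coeff (v t) q)"
    by (rule integral_spike[of "{0,1}"]) (use assms(3) in \<open>auto simp: less_le\<close>)
  then show "lc_coeff (lc_int u) q = lc_coeff (lc_int v) q" by (simp add: lc_coeff_int assms)
qed

lemma lc_int_power_real: "lc_int (\<lambda>t. of_real (t ^ n)) = of_real (1 / real (Suc n))"
proof (rule lc_eqI)
  fix q
  have t: "tame (\<lambda>t. of_real (t ^ n))" by (intro tame_of_real continuous_intros)
  have "((\<lambda>t::real. t ^ n) has_integral (1 ^ Suc n / real (Suc n) - 0 ^ Suc n / real (Suc n))) {0..1}"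
  proof (rule fundamental_theorem_of_calculus)
    fix x :: real
    have "((\<lambda>t. t ^ Suc n / real (Suc n)) has_field_derivative (real (Suc n) * x ^ n) / real (Suc n)) (at x within {0..1})"
      by (rule DERIV_cdivide) (use DERIV_power_Suc[OF DERIV_ident, of n x "{0..1}"] in simp)
    then show "((\<lambda>t. t ^ Suc n / real (Suc n)) has_vector_derivative x ^ n) (at x within {0..1})"
      by (simp add: has_real_derivative_iff_has_vector_derivative del: power_Suc of_nat_Suc)
  qed simp
  then have "integral {0..1} (\<lambda>t::real. t ^ n) = 1 / real (Suc n)" by (simp add: integral_unique)
  then show "lc_coeff (lc_int (\<lambda>t. of_real (t ^ n))) q = lc_coeff (of_real (1 / real (Suc n))) q"
    unfolding lc_coeff_int[OF t] by (cases "q = 0") (auto simp del: of_real_power)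
qed

text \<open>The fundamental theorem for monomials along the segment from \<open>x\<close> to
  \<open>x + \<theta>\<close>. Binomial expansion reduces it to the integrals of
  \<open>t ^ j\<close> and to
  \<open>(j + 1) * (k + 1 choose j + 1) = (k + 1) * (k choose j)\<close>.\<close>

lemma lc_int_segment_power:
  "\<theta> * lc_int (\<lambda>t. (x + of_real t * \<theta>) ^ k) = of_real (1 / real (Suc k)) * ((x + \<theta>) ^ Suc k - x ^ Suc k)"
proof -
  have tm: "tame (\<lambda>t. of_real (t ^ j))" for j by (intro tame_of_real continuous_intros)
  have "(x + of_real t * \<theta>) ^ k = (\<Sum>j\<le>k. (of_nat (k choose j) * \<theta> ^ j * x ^ (k - j)) * of_real (t ^ j))" for t
    unfolding add.commute[of x] binomial_ring by (rule sum.cong) (simp_all add: power_mult_distrib mult_ac)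
  then have "lc_int (\<lambda>t. (x + of_real t * \<theta>) ^ k) =
    lc_int (\<lambda>t. \<Sum>j\<le>k. (of_nat (k choose j) * \<theta> ^ j * x ^ (k - j)) * of_real (t ^ j))" by simp
  also have "\<dots> = (\<Sum>j\<le>k. lc_int (\<lambda>t. (of_nat (k choose j) * \<theta> ^ j * x ^ (k - j)) * of_real (t ^ j)))"
    by (rule lc_int_sum) (intro tame_mult tame_const tm)
  also have "\<dots> = (\<Sum>j\<le>k. (of_nat (k choose j) * \<theta> ^ j * x ^ (k - j)) * of_real (1 / real (Suc j)))"
    by (simp only: lc_int_cmult[OF tm] lc_int_power_real)
  finally have 1: "\<theta> * lc_int (\<lambda>t. (x + of_real t * \<theta>) ^ k) =
    (\<Sum>j\<le>k. \<theta> * ((of_nat (k choose j) * \<theta> ^ j * x ^ (k - j)) * of_real (1 / real (Suc j))))"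
    by (simp add: sum_distrib_left)
  have "(\<theta> + x) ^ Suc k = x ^ Suc k + (\<Sum>j\<le>k. of_nat (Suc k choose Suc j) * \<theta> ^ Suc j * x ^ (k - j))"
    unfolding binomial_ring sum.atMost_Suc_shift by simp
  then have "of_real (1 / real (Suc k)) * ((x + \<theta>) ^ Suc k - x ^ Suc k) =
    (\<Sum>j\<le>k. of_real (1 / real (Suc k)) * (of_nat (Suc k choose Suc j) * \<theta> ^ Suc j * x ^ (k - j)))"
    by (simp add: add.commute[of x] sum_distrib_left)
  also have "\<dots> = (\<Sum>j\<le>k. \<theta> * ((of_nat (k choose j) * \<theta> ^ j * x ^ (k - j)) * of_real (1 / real (Suc j))))"
  proof (rule sum.cong[OF refl])
    fix j
    have "real (Suc j) * real (Suc k choose Suc j) = real (Suc k) * real (k choose j)"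
      using Suc_times_binomial_eq[of k j] by (metis mult.commute of_nat_mult)
    then have "real (k choose j) * (1 / real (Suc j)) = (1 / real (Suc k)) * real (Suc k choose Suc j)"
      by (simp add: field_simps del: of_nat_Suc binomial_Suc_Suc)
    then have e: "(of_real (real (k choose j) * (1 / real (Suc j))) :: lc)
      = of_real ((1 / real (Suc k)) * real (Suc k choose Suc j))" by (rule arg_cong)
    have e: "(of_nat (k choose j) * of_real (1 / real (Suc j)) :: lc)
      = of_real (1 / real (Suc k)) * of_nat (Suc k choose Suc j)"
      using e by (simp only: of_real_mult of_real_of_nat_eq)
    have "\<theta> * ((of_nat (k choose j) * \<theta> ^ j * x ^ (k - j)) * of_real (1 / real (Suc j)))
      = (of_nat (k choose j) * of_real (1 / real (Suc j))) * (\<theta> ^ Suc j * x ^ (k - j))"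
      by (simp only: power_Suc mult_ac)
    then show "of_real (1 / real (Suc k)) * (of_nat (Suc k choose Suc j) * \<theta> ^ Suc j * x ^ (k - j))
      = \<theta> * ((of_nat (k choose j) * \<theta> ^ j * x ^ (k - j)) * of_real (1 / real (Suc j)))"
      unfolding e by (simp only: mult_ac)
  qed
  finally show ?thesis using 1 by simp
qed

text \<open>The sign is decided at the lowest exponent \<open>q\<close> that occurs for any
  parameter. There the coefficient is nonnegative, as it leads wherever it does not vanish; being
  continuous and not identically zero, it has a positive integral.\<close>

lemma lc_int_nonneg:
  assumes "tame u" "\<And>t. 0 < t \<Longrightarrow> t < 1 \<Longrightarrow> 0 \<le> u t"
  shows "0 \<le> lc_int u"
proof (rule ccontr)
  assume "\<not> 0 \<le> lc_int u"
  then have neg: "0 < - lc_int u" by simp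
  define l where "l = lc_lead (lc_int u)"
  have l: "lc_coeff (lc_int u) l < 0" using neg by (simp add: lc_pos_iff l_def)
  define W where "W = {q. q \<le> l \<and> (\<exists>t\<in>{0..1}. lc_coeff (u t) q \<noteq> 0)}"
  have W: "finite W" unfolding W_def by (rule tame_finite[OF assms(1)])
  have "W \<noteq> {}"
  proof
    assume "W = {}"
    then have "integral {0..1} (\<lambda>t. lc_coeff (u t) l) = integral {0..1} (\<lambda>t::real. 0)"
      by (intro Henstock_Kurzweil_Integration.integral_cong) (auto simp: W_def)
    then show False using l by (simp add: lc_coeff_int[OF assms(1)])
  qed
  define q where "q = Min W"
  have qW: "q \<in> W" unfolding q_def using W \<open>W \<noteq> {}\<close> by (rule Min_in)
  have below: "ord_ge q (u t)" if "t \<in> {0..1}" for t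
    unfolding ord_ge_def
  proof (intro allI impI, rule ccontr)
    fix p assume p: "p < q" "lc_coeff (u t) p \<noteq> 0"
    then have "p \<in> W" using qW that by (auto simp: W_def)
    then show False using Min_le[OF W] p unfolding q_def by fastforce
  qed
  have pos: "0 \<le> lc_coeff (u t) q" if t: "0 < t" "t < 1" for t
  proof (rule ccontr)
    assume "\<not> ?thesis"
    then have "0 < - u t" unfolding lc_pos_iff2 using below[of t] t by (intro exI[of _ q]) auto
    then show False using assms(2)[OF t] by simp
  qed
  have posc: "0 \<le> lc_coeff (u t) q" if t: "t \<in> {0..1}" for t
    by (rule continuous_ge_on_closure[of "{0<..<1}"])
      (use tame_continuous[OF assms(1)] t pos in auto)
  have "integral {0..1} (\<lambda>t. lc_coeff (u t) q) \<noteq> 0"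
    using integral_eq_0_iff[OF tame_continuous[OF assms(1), of q]] posc qW by (auto simp: W_def)
  moreover have "0 \<le> integral {0..1} (\<lambda>t. lc_coeff (u t) q)"
    by (rule integral_nonneg) (use tame_integrable[OF assms(1)] posc in auto)
  ultimately have "0 < lc_coeff (lc_int u) q" by (simp add: lc_coeff_int[OF assms(1)])
  moreover have "lc_coeff (lc_int u) q = 0" if "q < l"
    using that lc_coeff_below_lead unfolding l_def by blast
  moreover have "q \<le> l" using qW by (auto simp: W_def)
  ultimately show False using l by (metis less_asym less_irrefl order_le_imp_less_or_eq)
qed

section \<open>Power series with rapidly decreasing coefficients on the unit disc\<close>

text \<open>Rapid decay, rather than a radius of convergence above 1, is what weak convergence on an
  interval provides. It suffices up to the boundary of the unit disc and survives infinitesimal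
  perturbation of the argument.\<close>

definition good :: "(nat \<Rightarrow> lc) \<Rightarrow> bool" where
  "good b \<longleftrightarrow> (\<forall>Q. finite {q. q \<le> Q \<and> (\<exists>k. lc_coeff (b k) q \<noteq> 0)}) \<and>
    (\<forall>q. rapid (\<lambda>k. lc_coeff (b k) q))"

text \<open>The argument itself may exceed 1 by an infinitesimal, as happens after the base point
  has been moved inwards.\<close>

definition udisc :: "lc \<Rightarrow> bool" where
  "udisc \<tau> \<longleftrightarrow> ord_ge 0 \<tau> \<and> \<bar>lc_coeff \<tau> 0\<bar> \<le> 1"

text \<open>Meaningful only for good \<open>b\<close> and \<open>\<tau>\<close> in the unit disc; otherwise \<open>Abs_lc\<close> may get a function
  without left-finite support or the real series may diverge.\<close>

definition ev :: "(nat \<Rightarrow> lc) \<Rightarrow> lc \<Rightarrow> lc" where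
  "ev b \<tau> = Abs_lc (\<lambda>q. \<Sum>k. lc_coeff (b k * \<tau> ^ k) q)"

text \<open>Coefficients of the termwise antiderivative that vanishes at 0.\<close>

definition anti :: "(nat \<Rightarrow> lc) \<Rightarrow> nat \<Rightarrow> lc" where
  "anti b k = (case k of 0 \<Rightarrow> 0 | Suc i \<Rightarrow> of_real (1 / real (Suc i)) * b i)"

text \<open>Coefficients of the series multiplied by its variable.\<close>

definition shift :: "(nat \<Rightarrow> lc) \<Rightarrow> nat \<Rightarrow> lc" where
  "shift b k = (case k of 0 \<Rightarrow> 0 | Suc i \<Rightarrow> b i)"

lemma good_finite: "good b \<Longrightarrow> finite {q. q \<le> Q \<and> (\<exists>k. lc_coeff (b k) q \<noteq> 0)}"
  by (simp add: good_def)

lemma good_rapid: "good b \<Longrightarrow> rapid (\<lambda>k. lc_coeff (b k) q)"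
  by (simp add: good_def)

lemma finite_low_imp_ord:
  assumes "finite {q. q \<le> 0 \<and> (\<exists>k. lc_coeff (b k) q \<noteq> 0)}"
  shows "\<exists>m. \<forall>k. ord_ge m (b k)"
  using finite_low_imp_bound[OF assms] unfolding ord_ge_def by blast

lemma good_ord: "good b \<Longrightarrow> \<exists>m. \<forall>k. ord_ge m (b k)"
  by (rule finite_low_imp_ord[OF good_finite])

lemma good_add:
  assumes "good b" "good c"
  shows "good (\<lambda>k. b k + c k)"
  unfolding good_def
proof (intro conjI allI)
  fix Q
  have "{q. q \<le> Q \<and> (\<exists>k. lc_coeff (b k + c k) q \<noteq> 0)} \<subseteq>
    {q. q \<le> Q \<and> (\<exists>k. lc_coeff (b k) q \<noteq> 0)} \<union> {q. q \<le> Q \<and> (\<exists>k. lc_coeff (c k) q \<noteq> 0)}"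
    by auto
  then show "finite {q. q \<le> Q \<and> (\<exists>k. lc_coeff (b k + c k) q \<noteq> 0)}"
    by (rule finite_subset) (use assms in \<open>simp add: good_finite\<close>)
next
  fix q show "rapid (\<lambda>k. lc_coeff (b k + c k) q)"
    using rapid_add[OF good_rapid[OF assms(1)] good_rapid[OF assms(2)]] by simp
qed

lemma good_cmult:
  assumes "good b"
  shows "good (\<lambda>k. c * b k)"
  unfolding good_def
proof (intro conjI allI)
  fix Q
  have "{q. q \<le> Q \<and> (\<exists>k. lc_coeff (c * b k) q \<noteq> 0)} \<subseteq>
    {q. q \<le> Q \<and> (\<exists>p. lc_coeff c p \<noteq> 0 \<and> (\<exists>k. lc_coeff (b k) (q - p) \<noteq> 0))}"
    using lc_coeff_mult_nonzeroD by blast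
  moreover have "finite {q. q \<le> Q \<and> lc_coeff c q \<noteq> 0}" for Q
    by (rule finite_subset[OF _ finite_lc_trunc[of c Q]]) auto
  ultimately show "finite {q. q \<le> Q \<and> (\<exists>k. lc_coeff (c * b k) q \<noteq> 0)}"
    by (elim finite_subset, intro finite_product_support good_finite assms)
next
  fix q
  obtain m where m: "\<And>k. ord_ge m (b k)" using good_ord[OF assms] by blast
  have "rapid (\<lambda>k. \<Sum>p | lc_coeff c p \<noteq> 0 \<and> p \<le> q - m. lc_coeff c p * lc_coeff (b k) (q - p))"
    by (intro rapid_sum rapid_cmult good_rapid assms)
  then show "rapid (\<lambda>k. lc_coeff (c * b k) q)"
    using lc_coeff_mult_ord[OF m, of _ c q] by (simp add: mult.commute)
qed

lemma good_shift:
  assumes "good b"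
  shows "good (shift b)"
  unfolding good_def
proof (intro conjI allI)
  fix Q
  have "\<exists>k. lc_coeff (b k) q \<noteq> 0" if "lc_coeff (shift b k) q \<noteq> 0" for k q
    using that by (cases k) (auto simp: shift_def simp del: of_real_divide)
  then have "{q. q \<le> Q \<and> (\<exists>k. lc_coeff (shift b k) q \<noteq> 0)} \<subseteq> {q. q \<le> Q \<and> (\<exists>k. lc_coeff (b k) q \<noteq> 0)}"
    by blast
  then show "finite {q. q \<le> Q \<and> (\<exists>k. lc_coeff (shift b k) q \<noteq> 0)}"
    by (rule finite_subset) (rule good_finite[OF assms])
next
  fix q show "rapid (\<lambda>k. lc_coeff (shift b k) q)"
    by (rule rapid_Suc) (simp add: shift_def good_rapid[OF assms])
qed

lemma good_anti:
  assumes "good b"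
  shows "good (anti b)"
  unfolding good_def
proof (intro conjI allI)
  fix Q
  have "\<exists>k. lc_coeff (b k) q \<noteq> 0" if "lc_coeff (anti b k) q \<noteq> 0" for k q
    using that by (cases k) (auto simp: anti_def simp del: of_real_divide)
  then have "{q. q \<le> Q \<and> (\<exists>k. lc_coeff (anti b k) q \<noteq> 0)} \<subseteq> {q. q \<le> Q \<and> (\<exists>k. lc_coeff (b k) q \<noteq> 0)}"
    by blast
  then show "finite {q. q \<le> Q \<and> (\<exists>k. lc_coeff (anti b k) q \<noteq> 0)}"
    by (rule finite_subset) (rule good_finite[OF assms])
next
  fix q
  have *: "rapid (\<lambda>k. 1 / real (Suc k) * lc_coeff (b k) q)"
  proof (rule rapid_le[OF good_rapid[OF assms, of q], of _ 1 0])
    fix k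
    have "1 / real (Suc k) * \<bar>lc_coeff (b k) q\<bar> \<le> 1 * \<bar>lc_coeff (b k) q\<bar>"
      by (rule mult_right_mono) simp_all
    then show "\<bar>1 / real (Suc k) * lc_coeff (b k) q\<bar> \<le> 1 * real (Suc k) ^ 0 * \<bar>lc_coeff (b k) q\<bar>"
      by (simp add: abs_mult)
  qed
  show "rapid (\<lambda>k. lc_coeff (anti b k) q)"
    by (rule rapid_Suc) (use * in \<open>simp add: anti_def del: of_real_divide\<close>)
qed

text \<open>
  On a path \<open>\<tau> = s + \<iota>\<close> with real part \<open>s\<close> in \<open>[-1, 1]\<close> and infinitesimal part \<open>\<iota>\<close>,
  a coefficient of \<open>b k * \<tau> ^ k\<close> only involves boundedly many powers of \<open>\<iota>\<close>.
\<close>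

lemma suminf_nonzeroD:
  fixes f :: "nat \<Rightarrow> real"
  assumes "suminf f \<noteq> 0"
  shows "\<exists>k. f k \<noteq> 0"
proof (rule ccontr)
  assume "\<not> ?thesis"
  then have "f = (\<lambda>k. 0)" by auto
  then show False using assms by simp
qed

text \<open>Constant paths give evaluation at a point, segments give integration, so both rest on
  the same estimates. The order bound \<open>\<mu>\<close> is common to all parameters in order that
  the cut-off \<open>J\<close> be so too.\<close>

locale good_path =
  fixes b :: "nat \<Rightarrow> lc" and s :: "real \<Rightarrow> real" and \<iota> :: "real \<Rightarrow> lc" and \<mu> :: rat
  assumes good: "good b" and scont: "continuous_on {0..1} s" and sle: "\<And>t. t \<in> {0..1} \<Longrightarrow> \<bar>s t\<bar> \<le> 1"
    and tame\<iota>: "tame \<iota>" and \<mu>: "0 < \<mu>" and ord\<iota>: "\<And>t. t \<in> {0..1} \<Longrightarrow> ord_ge \<mu> (\<iota> t)"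
begin

definition "\<tau> t = of_real (s t) + \<iota> t"

lemma finite_support: "finite {q. q \<le> Q \<and> (\<exists>t\<in>{0..1}. \<exists>k. lc_coeff (b k * \<tau> t ^ k) q \<noteq> 0)}"
proof -
  obtain m where m: "\<And>k. ord_ge m (b k)" using good_ord[OF good] by blast
  obtain J where J: "Q < m + of_nat (Suc J) * \<mu>" using ex_nat_mult_gt[OF \<mu>] by blast
  define S where "S j = {q. q \<le> Q \<and> (\<exists>p. (\<exists>k. lc_coeff (b k) p \<noteq> 0) \<and> (\<exists>t\<in>{0..1}. lc_coeff (\<iota> t ^ j) (q - p) \<noteq> 0))}" for j
  have "{q. q \<le> Q \<and> (\<exists>t\<in>{0..1}. \<exists>k. lc_coeff (b k * \<tau> t ^ k) q \<noteq> 0)} \<subseteq> (\<Union>j\<le>J. S j)"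
  proof
    fix q assume "q \<in> {q. q \<le> Q \<and> (\<exists>t\<in>{0..1}. \<exists>k. lc_coeff (b k * \<tau> t ^ k) q \<noteq> 0)}"
    then obtain t k where q: "q \<le> Q" "t \<in> {0..1}" "lc_coeff (b k * \<tau> t ^ k) q \<noteq> 0" by blast
    have "q < m + of_nat (Suc J) * \<mu>" using q(1) J by simp
    from lc_coeff_mult_binomial[OF m ord\<iota>[OF q(2)] \<mu> this, of k "s t" k] q(3)
    have "(\<Sum>j\<le>J. real (k choose j) * s t ^ (k - j) * lc_coeff (b k * \<iota> t ^ j) q) \<noteq> 0"
      by (simp add: \<tau>_def)
    then obtain j where j: "j \<le> J" "lc_coeff (b k * \<iota> t ^ j) q \<noteq> 0"
      by (metis (no_types, lifting) atMost_iff mult_zero_right sum.neutral)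
    then have "q \<in> S j" unfolding S_def using lc_coeff_mult_nonzeroD[OF j(2)] q by blast
    then show "q \<in> (\<Union>j\<le>J. S j)" using j by blast
  qed
  moreover have "finite (S j)" for j unfolding S_def
    by (intro finite_product_support good_finite good tame_finite tame_power tame\<iota>)
  ultimately show ?thesis by (meson finite_UN finite_atMost finite_subset)
qed

text \<open>A majorant independent of \<open>t\<close>, for the Weierstrass test: only
  \<open>j \<le> J\<close> matter, \<open>k choose j\<close> is at most \<open>(k + 1) ^ j\<close>,
  and the coefficients of \<open>\<iota> ^ j\<close> are continuous, hence bounded, on
  [0,1].\<close>

lemma dominated: "\<exists>a. rapid a \<and> (\<forall>t\<in>{0..1}. \<forall>k. \<bar>lc_coeff (b k * \<tau> t ^ k) q\<bar> \<le> a k)"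
proof -
  obtain m where m: "\<And>k. ord_ge m (b k)" using good_ord[OF good] by blast
  obtain J where J: "q < m + of_nat (Suc J) * \<mu>" using ex_nat_mult_gt[OF \<mu>] by blast
  define P where "P = {p. p \<le> q \<and> (\<exists>k. lc_coeff (b k) p \<noteq> 0)}"
  have P: "finite P" unfolding P_def by (rule good_finite[OF good])
  have "\<forall>x. \<exists>C. \<forall>t\<in>{0..1}. \<bar>lc_coeff (\<iota> t ^ fst x) (snd x)\<bar> \<le> C"
    using tame_bound[OF tame_power[OF tame\<iota>]] by blast
  from choice[OF this] obtain M where "\<forall>x. \<forall>t\<in>{0..1}. \<bar>lc_coeff (\<iota> t ^ fst x) (snd x)\<bar> \<le> M x" by blast
  then have M: "\<bar>lc_coeff (\<iota> t ^ j) r\<bar> \<le> M (j, r)" if "t \<in> {0..1}" for t j r using that by force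
  define a where "a k = (\<Sum>j\<le>J. real (k choose j) * (\<Sum>p\<in>P. M (j, q - p) * \<bar>lc_coeff (b k) p\<bar>))" for k
  have "rapid a" unfolding a_def
  proof (intro rapid_sum)
    fix j
    have "rapid (\<lambda>k. \<Sum>p\<in>P. M (j, q - p) * \<bar>lc_coeff (b k) p\<bar>)"
      by (intro rapid_sum rapid_cmult rapid_le[OF good_rapid[OF good], of _ 1 0]) auto
    then show "rapid (\<lambda>k. real (k choose j) * (\<Sum>p\<in>P. M (j, q - p) * \<bar>lc_coeff (b k) p\<bar>))"
    proof (rule rapid_le[of _ _ 1 j])
      fix k
      have "real (k choose j) \<le> real (Suc k) ^ j"
      proof (cases "j \<le> k")
        case True
        then have "k choose j \<le> k ^ j" by (rule binomial_le_pow)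
        also have "\<dots> \<le> Suc k ^ j" by (intro power_mono) auto
        finally show ?thesis by (metis of_nat_le_iff of_nat_power)
      qed (simp add: binomial_eq_0)
      then show "\<bar>real (k choose j) * (\<Sum>p\<in>P. M (j, q - p) * \<bar>lc_coeff (b k) p\<bar>)\<bar>
         \<le> 1 * real (Suc k) ^ j * \<bar>\<Sum>p\<in>P. M (j, q - p) * \<bar>lc_coeff (b k) p\<bar>\<bar>"
        unfolding abs_mult by (intro mult_right_mono) auto
    qed
  qed
  moreover have "\<bar>lc_coeff (b k * \<tau> t ^ k) q\<bar> \<le> a k" if t: "t \<in> {0..1}" for t k
  proof -
    have "lc_coeff (b k * \<tau> t ^ k) q = (\<Sum>j\<le>J. real (k choose j) * s t ^ (k - j) * lc_coeff (b k * \<iota> t ^ j) q)"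
      unfolding \<tau>_def by (rule lc_coeff_mult_binomial[OF m ord\<iota>[OF t] \<mu> J])
    also have "\<bar>\<dots>\<bar> \<le> (\<Sum>j\<le>J. \<bar>real (k choose j) * s t ^ (k - j) * lc_coeff (b k * \<iota> t ^ j) q\<bar>)"
      by (rule sum_abs)
    also have "\<dots> \<le> a k" unfolding a_def
    proof (rule sum_mono)
      fix j
      have "\<bar>s t ^ (k - j)\<bar> \<le> 1" using sle[OF t] by (simp add: power_abs power_le_one)
      then have "\<bar>real (k choose j) * s t ^ (k - j)\<bar> \<le> real (k choose j)"
        by (simp add: abs_mult mult_left_le)
      moreover have "\<bar>lc_coeff (b k * \<iota> t ^ j) q\<bar> \<le> (\<Sum>p\<in>P. M (j, q - p) * \<bar>lc_coeff (b k) p\<bar>)"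
      proof -
        have o: "ord_ge 0 (\<iota> t ^ j)" using ord\<iota>[OF t] \<mu> by (intro ord_ge_power0) (auto elim: ord_ge_mono)
        have "lc_coeff (b k * \<iota> t ^ j) q = (\<Sum>p\<in>P. lc_coeff (b k) p * lc_coeff (\<iota> t ^ j) (q - p))"
        proof (rule lc_coeff_mult_left[OF P])
          fix p assume "lc_coeff (b k) p \<noteq> 0" "lc_coeff (\<iota> t ^ j) (q - p) \<noteq> 0"
          moreover have "0 \<le> q - p" using calculation(2) ord_geD[OF o] not_less by blast
          ultimately show "p \<in> P" unfolding P_def by auto
        qed
        also have "\<bar>\<dots>\<bar> \<le> (\<Sum>p\<in>P. \<bar>lc_coeff (b k) p * lc_coeff (\<iota> t ^ j) (q - p)\<bar>)" by (rule sum_abs)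
        also have "\<dots> \<le> (\<Sum>p\<in>P. M (j, q - p) * \<bar>lc_coeff (b k) p\<bar>)"
          unfolding abs_mult mult.commute[of "\<bar>lc_coeff (b k) _\<bar>"]
          by (intro sum_mono mult_right_mono M[OF t]) auto
        finally show ?thesis .
      qed
      ultimately show "\<bar>real (k choose j) * s t ^ (k - j) * lc_coeff (b k * \<iota> t ^ j) q\<bar>
        \<le> real (k choose j) * (\<Sum>p\<in>P. M (j, q - p) * \<bar>lc_coeff (b k) p\<bar>)"
        unfolding abs_mult[of _ "lc_coeff _ _"] by (intro mult_mono) auto
    qed
    finally show ?thesis .
  qed
  ultimately show ?thesis by blast
qed

lemma summable_coeff: "t \<in> {0..1} \<Longrightarrow> summable (\<lambda>k. lc_coeff (b k * \<tau> t ^ k) q)"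
proof -
  assume t: "t \<in> {0..1}"
  obtain a where a: "rapid a" "\<And>k. \<bar>lc_coeff (b k * \<tau> t ^ k) q\<bar> \<le> a k" using dominated t by blast
  have "a k \<ge> 0" for k using a(2)[of k] by (rule order.trans[OF abs_ge_zero])
  then have "summable a" using rapid_summable[OF a(1)] by simp
  then show ?thesis by (rule summable_comparison_test[rotated]) (use a(2) in auto)
qed

lemma coeff_ev: "t \<in> {0..1} \<Longrightarrow> lc_coeff (ev b (\<tau> t)) q = (\<Sum>k. lc_coeff (b k * \<tau> t ^ k) q)"
proof -
  assume t: "t \<in> {0..1}"
  have "left_finite {q. (\<Sum>k. lc_coeff (b k * \<tau> t ^ k) q) \<noteq> 0}"
    unfolding left_finite_def
  proof
    fix Q
    have "\<exists>k. lc_coeff (b k * \<tau> t ^ k) q \<noteq> 0" if "(\<Sum>k. lc_coeff (b k * \<tau> t ^ k) q) \<noteq> 0" for q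
      using that by (rule suminf_nonzeroD)
    note * = this
    have "{x \<in> {q. (\<Sum>k. lc_coeff (b k * \<tau> t ^ k) q) \<noteq> 0}. x \<le> Q} \<subseteq>
      {q. q \<le> Q \<and> (\<exists>t\<in>{0..1}. \<exists>k. lc_coeff (b k * \<tau> t ^ k) q \<noteq> 0)}"
    proof
      fix q assume "q \<in> {x \<in> {q. (\<Sum>k. lc_coeff (b k * \<tau> t ^ k) q) \<noteq> 0}. x \<le> Q}"
      then have "q \<le> Q" "(\<Sum>k. lc_coeff (b k * \<tau> t ^ k) q) \<noteq> 0" by simp_all
      then show "q \<in> {q. q \<le> Q \<and> (\<exists>t\<in>{0..1}. \<exists>k. lc_coeff (b k * \<tau> t ^ k) q \<noteq> 0)}"
        by (intro CollectI conjI bexI[OF _ t] *)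
    qed
    then show "finite {x \<in> {q. (\<Sum>k. lc_coeff (b k * \<tau> t ^ k) q) \<noteq> 0}. x \<le> Q}"
      by (rule finite_subset) (rule finite_support)
  qed
  then show ?thesis unfolding ev_def by (subst Abs_lc_inverse) auto
qed

lemma uniform: "uniform_limit {0..1} (\<lambda>n t. \<Sum>k<n. lc_coeff (b k * \<tau> t ^ k) q)
    (\<lambda>t. \<Sum>k. lc_coeff (b k * \<tau> t ^ k) q) sequentially"
proof -
  obtain a where a: "rapid a" "\<And>t k. t \<in> {0..1} \<Longrightarrow> \<bar>lc_coeff (b k * \<tau> t ^ k) q\<bar> \<le> a k" using dominated by blast
  have "a k \<ge> 0" for k using a(2)[of 0 k] by (intro order.trans[OF abs_ge_zero]) auto
  then have "summable a" using rapid_summable[OF a(1)] by simp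
  then show ?thesis by (intro Weierstrass_m_test_ev) (use a(2) in auto)
qed

lemma tame_term: "tame (\<lambda>t. b k * \<tau> t ^ k)"
  unfolding \<tau>_def by (intro tame_mult tame_const tame_power tame_add tame_of_real scont tame\<iota>)

lemma continuous_partial: "continuous_on {0..1} (\<lambda>t. \<Sum>k<n. lc_coeff (b k * \<tau> t ^ k) q)"
  by (intro continuous_on_sum tame_continuous tame_term)

lemma tame_ev: "tame (\<lambda>t. ev b (\<tau> t))"
  unfolding tame_def
proof (intro conjI allI)
  fix q
  have "continuous_on {0..1} (\<lambda>t. \<Sum>k. lc_coeff (b k * \<tau> t ^ k) q)"
    by (rule uniform_limit_theorem[OF _ uniform]) (simp_all add: continuous_partial)
  then show "continuous_on {0..1} (\<lambda>t. lc_coeff (ev b (\<tau> t)) q)"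
    by (rule continuous_on_eq) (simp add: coeff_ev)
next
  fix Q
  have "{q. q \<le> Q \<and> (\<exists>t\<in>{0..1}. lc_coeff (ev b (\<tau> t)) q \<noteq> 0)} \<subseteq>
    {q. q \<le> Q \<and> (\<exists>t\<in>{0..1}. \<exists>k. lc_coeff (b k * \<tau> t ^ k) q \<noteq> 0)}"
  proof safe
    fix q t assume t: "t \<in> {0..1}" and "lc_coeff (ev b (\<tau> t)) q \<noteq> 0"
    then have "(\<Sum>k. lc_coeff (b k * \<tau> t ^ k) q) \<noteq> 0" by (simp add: coeff_ev)
    then have "\<exists>k. lc_coeff (b k * \<tau> t ^ k) q \<noteq> 0" by (rule suminf_nonzeroD)
    then show "\<exists>t\<in>{0..1}. \<exists>k. lc_coeff (b k * \<tau> t ^ k) q \<noteq> 0" using t by blast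
  qed
  then show "finite {q. q \<le> Q \<and> (\<exists>t\<in>{0..1}. lc_coeff (ev b (\<tau> t)) q \<noteq> 0)}"
    by (rule finite_subset) (rule finite_support)
qed

text \<open>Uniform convergence of each coefficient on [0,1] allows the series and the integral to
  be exchanged.\<close>

lemma sums_int: "(\<lambda>k. lc_coeff (lc_int (\<lambda>t. b k * \<tau> t ^ k)) q) sums lc_coeff (lc_int (\<lambda>t. ev b (\<tau> t))) q"
proof -
  obtain I J where I: "\<And>n. ((\<lambda>t. \<Sum>k<n. lc_coeff (b k * \<tau> t ^ k) q) has_integral I n) {0..1}"
    and J: "((\<lambda>t. \<Sum>k. lc_coeff (b k * \<tau> t ^ k) q) has_integral J) {0..1}" and lim: "I \<longlonglongrightarrow> J"
    using uniform_limit_integral[OF uniform continuous_partial, of q] by auto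
  have Ieq: "I n = (\<Sum>k<n. lc_coeff (lc_int (\<lambda>t. b k * \<tau> t ^ k)) q)" for n
  proof -
    have "I n = integral {0..1} (\<lambda>t. \<Sum>k<n. lc_coeff (b k * \<tau> t ^ k) q)" by (rule integral_unique[OF I, symmetric])
    also have "\<dots> = (\<Sum>k<n. integral {0..1} (\<lambda>t. lc_coeff (b k * \<tau> t ^ k) q))"
      by (rule integral_sum) (auto intro: tame_integrable tame_term)
    finally show ?thesis by (simp add: lc_coeff_int tame_term)
  qed
  have "lc_coeff (lc_int (\<lambda>t. ev b (\<tau> t))) q = J"
  proof -
    have "lc_coeff (lc_int (\<lambda>t. ev b (\<tau> t))) q = integral {0..1} (\<lambda>t. \<Sum>k. lc_coeff (b k * \<tau> t ^ k) q)"
      unfolding lc_coeff_int[OF tame_ev]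
      by (rule Henstock_Kurzweil_Integration.integral_cong) (simp add: coeff_ev)
    then show ?thesis using J by (simp add: integral_unique)
  qed
  then show ?thesis unfolding sums_def Ieq[symmetric] using lim by simp
qed

end

section \<open>Evaluation at single points of the unit disc\<close>

lemma udisc_split:
  assumes "udisc x"
  obtains \<mu> where "0 < \<mu>" "ord_ge \<mu> (x - of_real (lc_coeff x 0))"
  using assms infsml_standard_part[of x] unfolding udisc_def infsml_def by blast

lemma good_path_const:
  assumes "good b" "udisc x"
  obtains \<mu> where "good_path b (\<lambda>t. lc_coeff x 0) (\<lambda>t. x - of_real (lc_coeff x 0)) \<mu>"
proof -
  obtain \<mu> where "0 < \<mu>" "ord_ge \<mu> (x - of_real (lc_coeff x 0))" using udisc_split[OF assms(2)] .
  then have "good_path b (\<lambda>t. lc_coeff x 0) (\<lambda>t. x - of_real (lc_coeff x 0)) \<mu>"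
    by unfold_locales (use assms in \<open>auto simp: udisc_def tame_const\<close>)
  then show ?thesis using that by blast
qed

lemma
  assumes "good b" "udisc x"
  shows summable_ev: "summable (\<lambda>k. lc_coeff (b k * x ^ k) q)"
    and coeff_ev: "lc_coeff (ev b x) q = (\<Sum>k. lc_coeff (b k * x ^ k) q)"
    and finite_ev: "finite {q. q \<le> Q \<and> (\<exists>k. lc_coeff (b k * x ^ k) q \<noteq> 0)}"
proof -
  obtain \<mu> where "good_path b (\<lambda>t. lc_coeff x 0) (\<lambda>t. x - of_real (lc_coeff x 0)) \<mu>"
    using good_path_const[OF assms] .
  then interpret good_path b "\<lambda>t. lc_coeff x 0" "\<lambda>t. x - of_real (lc_coeff x 0)" \<mu> .
  have x: "\<tau> t = x" for t by (simp add: \<tau>_def)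
  show "summable (\<lambda>k. lc_coeff (b k * x ^ k) q)" using summable_coeff[of 0 q] by (simp add: x)
  show "lc_coeff (ev b x) q = (\<Sum>k. lc_coeff (b k * x ^ k) q)" using coeff_ev[of 0 q] by (simp add: x)
  have "{q. q \<le> Q \<and> (\<exists>k. lc_coeff (b k * x ^ k) q \<noteq> 0)} \<subseteq>
    {q. q \<le> Q \<and> (\<exists>t\<in>{0..1::real}. \<exists>k. lc_coeff (b k * x ^ k) q \<noteq> 0)}"
    by (auto intro!: bexI[of _ 0])
  then show "finite {q. q \<le> Q \<and> (\<exists>k. lc_coeff (b k * x ^ k) q \<noteq> 0)}"
    by (rule finite_subset) (rule finite_support[of Q, unfolded x])
qed

lemma sums_ev:
  assumes "good b" "udisc x"
  shows "(\<lambda>k. lc_coeff (b k * x ^ k) q) sums lc_coeff (ev b x) q"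
  unfolding coeff_ev[OF assms] by (rule summable_sums[OF summable_ev[OF assms]])

lemma ev_eqI:
  assumes "good b" "udisc x" "\<And>q. (\<lambda>k. lc_coeff (b k * x ^ k) q) sums lc_coeff y q"
  shows "ev b x = y"
  by (rule lc_eqI) (rule sums_unique2[OF sums_ev[OF assms(1,2)] assms(3)])

lemma weak_lim_ev:
  assumes "good b" "udisc x"
  shows "weak_lim (\<lambda>K. \<Sum>k\<le>K. b k * x ^ k) (ev b x)"
proof (rule weak_limI)
  fix q
  show "(\<lambda>n. lc_coeff (\<Sum>k\<le>n. b k * x ^ k) q) \<longlonglongrightarrow> lc_coeff (ev b x) q"
    using sums_ev[OF assms, of q] by (simp add: sums_def_le)
next
  fix Q
  have "{q. q \<le> Q \<and> (\<exists>n. lc_coeff (\<Sum>k\<le>n. b k * x ^ k) q \<noteq> 0)} \<subseteq>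
    {q. q \<le> Q \<and> (\<exists>k. lc_coeff (b k * x ^ k) q \<noteq> 0)}"
    by (auto dest: sum.not_neutral_contains_not_neutral)
  then show "finite {q. q \<le> Q \<and> (\<exists>n. lc_coeff (\<Sum>k\<le>n. b k * x ^ k) q \<noteq> 0)}"
    by (rule finite_subset) (rule finite_ev[OF assms])
qed

lemma ev_add: "good b \<Longrightarrow> good c \<Longrightarrow> udisc x \<Longrightarrow> ev (\<lambda>k. b k + c k) x = ev b x + ev c x"
  by (rule ev_eqI[OF good_add]) (auto simp: distrib_right intro!: sums_add sums_ev)

lemma sums_coeff_cmult:
  assumes m: "\<And>k. ord_ge m (X k)" and s: "\<And>q. (\<lambda>k. lc_coeff (X k) q) sums lc_coeff y q"
  shows "(\<lambda>k. lc_coeff (c * X k) q) sums lc_coeff (c * y) q"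
proof -
  have y: "ord_ge m y" unfolding ord_ge_def
  proof (intro allI impI)
    fix q assume q: "q < m"
    have "(\<lambda>k. 0) sums lc_coeff y q" using s[of q] ord_geD[OF m q] by simp
    then show "lc_coeff y q = 0" using sums_zero sums_unique2 by blast
  qed
  have "(\<lambda>k. \<Sum>p | lc_coeff c p \<noteq> 0 \<and> p \<le> q - m. lc_coeff c p * lc_coeff (X k) (q - p)) sums
    (\<Sum>p | lc_coeff c p \<noteq> 0 \<and> p \<le> q - m. lc_coeff c p * lc_coeff y (q - p))"
    by (intro sums_sum sums_mult s)
  then show ?thesis
    using lc_coeff_mult_ord[OF m, of _ c q] lc_coeff_mult_ord[OF y, of c q] by (simp add: mult.commute)
qed

lemma ev_cmult:
  assumes "good b" "udisc x"
  shows "ev (\<lambda>k. c * b k) x = c * ev b x"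
proof (rule ev_eqI[OF good_cmult[OF assms(1)] assms(2)])
  fix q
  obtain m where m: "\<And>k. ord_ge m (b k * x ^ k)" using finite_low_imp_ord[OF finite_ev[OF assms]] by blast
  show "(\<lambda>k. lc_coeff (c * b k * x ^ k) q) sums lc_coeff (c * ev b x) q"
    using sums_coeff_cmult[OF m sums_ev[OF assms], of c q] by (simp only: mult.assoc)
qed

lemma ev_shift:
  assumes "good b" "udisc x"
  shows "ev (shift b) x = x * ev b x"
proof (rule ev_eqI[OF good_shift[OF assms(1)] assms(2)])
  fix q
  have "(\<lambda>k. lc_coeff (x * b k * x ^ k) q) sums lc_coeff (x * ev b x) q"
    using sums_ev[OF good_cmult[OF assms(1)] assms(2), of x q] ev_cmult[OF assms, of x] by simp
  then have "(\<lambda>k. lc_coeff (shift b (Suc k) * x ^ Suc k) q) sums lc_coeff (x * ev b x) q"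
    by (simp add: shift_def mult_ac)
  then show "(\<lambda>k. lc_coeff (shift b k * x ^ k) q) sums lc_coeff (x * ev b x) q"
    by (subst (asm) sums_Suc_iff) (simp add: shift_def)
qed

text \<open>\<open>y ^ k - x ^ k\<close> is divisible by \<open>y - x\<close> with a cofactor of
  order at least 0, so one bound \<open>m\<close> on the coefficients serves all terms and all pairs
  of points.\<close>

lemma ev_Lipschitz:
  assumes "good b"
  shows "\<exists>m. \<forall>x y n. udisc x \<longrightarrow> udisc y \<longrightarrow> ord_ge n (y - x) \<longrightarrow> ord_ge (m + n) (ev b y - ev b x)"
proof -
  obtain m where m: "\<And>k. ord_ge m (b k)" using good_ord[OF assms] by blast
  show ?thesis
  proof (intro exI[of _ m] allI impI)
    fix x y n assume *: "udisc x" "udisc y" "ord_ge n (y - x)"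
    have "ord_ge (m + n) (b k * (y ^ k - x ^ k))" for k
      by (intro ord_ge_mult m ord_ge_power_diff) (use * in \<open>auto simp: udisc_def\<close>)
    then have z: "lc_coeff (b k * y ^ k) q - lc_coeff (b k * x ^ k) q = 0" if "q < m + n" for k q
      using ord_geD that by (fastforce simp: right_diff_distrib)
    show "ord_ge (m + n) (ev b y - ev b x)" unfolding ord_ge_def
    proof (intro allI impI)
      fix q assume "q < m + n"
      have "(\<lambda>k. lc_coeff (b k * y ^ k) q - lc_coeff (b k * x ^ k) q) sums lc_coeff (ev b y - ev b x) q"
        using sums_diff[OF sums_ev[OF assms *(2)] sums_ev[OF assms *(1)]] by simp
      then show "lc_coeff (ev b y - ev b x) q = 0"
        unfolding z[OF \<open>q < m + n\<close>] using sums_zero sums_unique2 by blast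
    qed
  qed
qed

lemma
  assumes "good b" "udisc x" "udisc y"
  shows tame_ev_segment: "tame (\<lambda>t. ev b (x + of_real t * (y - x)))"
    and ev_anti_diff: "ev (anti b) y - ev (anti b) x = (y - x) * lc_int (\<lambda>t. ev b (x + of_real t * (y - x)))"
proof -
  \<comment> \<open>Standard and infinitesimal parts are interpolated separately: convexity keeps
    the former in [-1,1], and the latter keeps order at least \<open>\<mu>\<close>.\<close>
  define s where "s t = (1 - t) * lc_coeff x 0 + t * lc_coeff y 0" for t
  define \<iota> where "\<iota> t = (x - of_real (lc_coeff x 0)) + of_real t * ((y - of_real (lc_coeff y 0)) - (x - of_real (lc_coeff x 0)))" for t
  obtain \<mu>x where \<mu>x: "0 < \<mu>x" "ord_ge \<mu>x (x - of_real (lc_coeff x 0))" using udisc_split[OF assms(2)] .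
  obtain \<mu>y where \<mu>y: "0 < \<mu>y" "ord_ge \<mu>y (y - of_real (lc_coeff y 0))" using udisc_split[OF assms(3)] .
  define \<mu> where "\<mu> = min \<mu>x \<mu>y"
  have \<mu>: "0 < \<mu>" "ord_ge \<mu> (x - of_real (lc_coeff x 0))" "ord_ge \<mu> (y - of_real (lc_coeff y 0))"
    using \<mu>x \<mu>y by (auto simp: \<mu>_def elim: ord_ge_mono)
  have gp: "good_path c s \<iota> \<mu>" if "good c" for c
  proof
    show "continuous_on {0..1} s" unfolding s_def by (intro continuous_intros)
    show "\<bar>s t\<bar> \<le> 1" if t: "t \<in> {0..1}" for t
    proof -
      have "\<bar>s t\<bar> \<le> (1 - t) * \<bar>lc_coeff x 0\<bar> + t * \<bar>lc_coeff y 0\<bar>"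
        unfolding s_def using t by (intro order.trans[OF abs_triangle_ineq]) (simp add: abs_mult)
      also have "\<dots> \<le> (1 - t) * 1 + t * 1"
        using assms t by (intro add_mono mult_left_mono) (auto simp: udisc_def)
      finally show ?thesis by simp
    qed
    show "tame \<iota>" unfolding \<iota>_def by (intro tame_add tame_const tame_mult tame_of_real continuous_intros)
    show "ord_ge \<mu> (\<iota> t)" for t unfolding \<iota>_def
      by (rule ord_ge_add[OF \<mu>(2) ord_ge_mult2[OF ord_ge_of_real ord_ge_diff[OF \<mu>(3,2)]]]) simp
  qed (use \<mu> that in auto)
  interpret good_path b s \<iota> \<mu> by (rule gp[OF assms(1)])
  \<comment> \<open>With the coefficients multiplied by \<open>y - x\<close>, the termwise integrals
    are exactly the differences of the terms of \<open>anti b\<close>.\<close>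
  interpret c: good_path "\<lambda>k. (y - x) * b k" s \<iota> \<mu> by (rule gp[OF good_cmult[OF assms(1)]])
  have \<tau>: "\<tau> t = x + of_real t * (y - x)" for t
    by (simp add: \<tau>_def s_def \<iota>_def algebra_simps)
  have c\<tau>: "c.\<tau> t = x + of_real t * (y - x)" for t
    by (simp add: c.\<tau>_def s_def \<iota>_def algebra_simps)
  show tm: "tame (\<lambda>t. ev b (x + of_real t * (y - x)))" using tame_ev by (simp add: \<tau>)
  have ud: "udisc (\<tau> t)" if "t \<in> {0..1}" for t
  proof -
    have "ord_ge 0 (\<iota> t)" "lc_coeff (\<iota> t) 0 = 0"
      using ord\<iota>[OF that] \<mu>(1) ord_ge_mono[of \<mu> "\<iota> t" 0] ord_geD[of \<mu> "\<iota> t" 0] by auto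
    then show ?thesis using sle[OF that] by (simp add: udisc_def \<tau>_def ord_ge_add)
  qed
  have tm2: "tame (\<lambda>t. x + of_real t * (y - x))"
    by (intro tame_add tame_const tame_mult tame_of_real continuous_intros)
  have int: "lc_int (\<lambda>t. (y - x) * b k * c.\<tau> t ^ k) = anti b (Suc k) * y ^ Suc k - anti b (Suc k) * x ^ Suc k" for k
  proof -
    have "lc_int (\<lambda>t. (y - x) * b k * c.\<tau> t ^ k) = b k * ((y - x) * lc_int (\<lambda>t. (x + of_real t * (y - x)) ^ k))"
      unfolding c\<tau> by (subst lc_int_cmult[OF tame_power[OF tm2]]) (simp only: mult_ac)
    also have "\<dots> = anti b (Suc k) * (y ^ Suc k - x ^ Suc k)"
      unfolding lc_int_segment_power anti_def by (simp add: mult_ac)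
    finally show ?thesis by (simp only: right_diff_distrib)
  qed
  have "lc_int (\<lambda>t. ev (\<lambda>k. (y - x) * b k) (c.\<tau> t)) = lc_int (\<lambda>t. (y - x) * ev b (\<tau> t))"
    by (rule lc_int_cong_open[OF c.tame_ev tame_mult[OF tame_const tame_ev]])
      (use ev_cmult[OF assms(1) ud, of _ "y - x"] in \<open>simp add: \<tau> c\<tau>\<close>)
  also have "\<dots> = (y - x) * lc_int (\<lambda>t. ev b (\<tau> t))" by (rule lc_int_cmult[OF tame_ev])
  finally have R: "lc_int (\<lambda>t. ev (\<lambda>k. (y - x) * b k) (c.\<tau> t)) = (y - x) * lc_int (\<lambda>t. ev b (\<tau> t))" .
  show "ev (anti b) y - ev (anti b) x = (y - x) * lc_int (\<lambda>t. ev b (x + of_real t * (y - x)))"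
  proof (rule lc_eqI)
    fix q
    have "(\<lambda>k. lc_coeff (anti b k * y ^ k) q - lc_coeff (anti b k * x ^ k) q) sums
      (lc_coeff (ev (anti b) y) q - lc_coeff (ev (anti b) x) q)"
      by (intro sums_diff sums_ev good_anti assms)
    then have 1: "(\<lambda>k. lc_coeff (anti b (Suc k) * y ^ Suc k) q - lc_coeff (anti b (Suc k) * x ^ Suc k) q) sums
      (lc_coeff (ev (anti b) y) q - lc_coeff (ev (anti b) x) q)"
      by (subst sums_Suc_iff) (simp add: anti_def)
    have 2: "(\<lambda>k. lc_coeff (anti b (Suc k) * y ^ Suc k) q - lc_coeff (anti b (Suc k) * x ^ Suc k) q) sums
      lc_coeff ((y - x) * lc_int (\<lambda>t. ev b (\<tau> t))) q"
      using c.sums_int[of q] unfolding int R by simp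
    show "lc_coeff (ev (anti b) y - ev (anti b) x) q =
      lc_coeff ((y - x) * lc_int (\<lambda>t. ev b (x + of_real t * (y - x)))) q"
      using sums_unique2[OF 1 2] by (simp add: \<tau>)
  qed
qed

section \<open>Normal form of simple functions\<close>

instance lc :: real_field ..

lemma rapid_eventually_zero:
  assumes "\<And>k. k \<ge> n \<Longrightarrow> a k = 0"
  shows "rapid a"
  unfolding rapid_def
proof
  fix j
  have "real k ^ j * \<bar>a k\<bar> \<le> (\<Sum>k<n. real k ^ j * \<bar>a k\<bar>)" for k
  proof (cases "k < n")
    case True
    then show ?thesis by (intro member_le_sum[of k _ "\<lambda>k. real k ^ j * \<bar>a k\<bar>"]) auto
  next
    case False
    then show ?thesis using assms[of k] by (simp add: sum_nonneg)
  qed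
  then show "\<exists>C. \<forall>k. real k ^ j * \<bar>a k\<bar> \<le> C" by blast
qed

lemma fsigma_unit_ball: "fsigma (ball (0::complex) 1)"
proof -
  have "ball (0::complex) 1 = (\<Union>n. cball 0 (1 - inverse (real (Suc n))))"
  proof
    show "ball (0::complex) 1 \<subseteq> (\<Union>n. cball 0 (1 - inverse (real (Suc n))))"
    proof
      fix z :: complex assume "z \<in> ball 0 1"
      then obtain n where "inverse (real (Suc n)) < 1 - norm z"
        using reals_Archimedean[of "1 - norm z"] by auto
      then show "z \<in> (\<Union>n. cball 0 (1 - inverse (real (Suc n))))"
        by (intro UN_I[of n]) (auto simp del: of_nat_Suc)
    qed
    show "(\<Union>n. cball 0 (1 - inverse (real (Suc n)))) \<subseteq> ball (0::complex) 1"
    proof safe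
      fix n and z :: complex assume "z \<in> cball 0 (1 - inverse (real (Suc n)))"
      moreover have "0 < inverse (real (Suc n))" by simp
      ultimately show "z \<in> ball 0 1" unfolding mem_cball mem_ball by linarith
    qed
  qed
  then show ?thesis by (simp only: fsigma.intros closed_cball)
qed

text \<open>The complex series with the same coefficients is holomorphic in the open unit disc and
  not identically zero there, so its zeros are countable.\<close>

lemma countable_zeros_rapid:
  fixes a :: "nat \<Rightarrow> real"
  assumes a: "rapid a" and nz: "a m \<noteq> 0"
  shows "countable {s. \<bar>s\<bar> < 1 \<and> (\<lambda>k. a k * s ^ k) sums 0}"
proof -
  define \<phi> :: "complex \<Rightarrow> complex" where "\<phi> z = (\<Sum>k. of_real (a k) * z ^ k)" for z
  have sm: "(\<lambda>k. of_real (a k) * z ^ k) sums \<phi> z" if "z \<in> ball 0 1" for z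
  proof -
    have "summable (\<lambda>k. of_real (a k) * z ^ k)"
    proof (rule summable_comparison_test[OF _ rapid_summable[OF a]], intro exI allI impI)
      fix k
      have "norm z ^ k \<le> 1" using that by (intro power_le_one) auto
      then show "norm (of_real (a k) * z ^ k) \<le> \<bar>a k\<bar>"
        by (simp add: norm_mult norm_power mult_left_le)
    qed
    then show ?thesis by (simp add: \<phi>_def summable_sums)
  qed
  have hol: "\<phi> holomorphic_on ball 0 1"
    using power_series_holomorphic[of 0 1 "\<lambda>k. of_real (a k)" \<phi>] sm by simp
  have nonzero: "\<exists>z\<in>ball 0 1. \<phi> z \<noteq> 0"
  proof (rule ccontr)
    assume "\<not> ?thesis"
    then have z: "\<phi> z = 0" if "z \<in> ball 0 1" for z using that by blast
    have "(\<lambda>k. of_real (a k) * (0::complex) ^ k) sums of_real (a 0)"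
      using powser_sums_zero[of "\<lambda>k. complex_of_real (a k)"] by simp
    then have "of_real (a 0) = \<phi> 0" using sm[of 0] sums_unique2 by fastforce
    then have "a 0 = 0" using z[of 0] by simp
    then have "m > 0" using nz by (cases m) auto
    have mz: "complex_of_real (a m) \<noteq> 0" using nz by simp
    \<comment> \<open>If the function vanished on the whole disc, 0 would be a zero that is not
      isolated, against \<open>a m \<noteq> 0\<close>.\<close>
    obtain s where "0 < s" and s: "\<And>z. z \<in> cball 0 s - {0} \<Longrightarrow> \<phi> z \<noteq> 0"
      by (rule powser_0_nonzero[of 1 0 "\<lambda>k. complex_of_real (a k)" \<phi> m]) (use sm z mz \<open>m > 0\<close> in auto)
    define w where "w = complex_of_real (min s (1/2))"
    have "w \<in> cball 0 s - {0}" "w \<in> ball 0 1" using \<open>0 < s\<close> by (auto simp: w_def)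
    then show False using s z by blast
  qed
  have cnt: "countable {z \<in> ball 0 1. \<phi> z = 0}"
  proof (cases "\<phi> constant_on ball 0 1")
    case True
    then have "{z \<in> ball 0 1. \<phi> z = 0} = {}" using nonzero unfolding constant_on_def by auto
    then show ?thesis by (simp only: countable_empty)
  next
    case False
    then show ?thesis by (intro holomorphic_countable_zeros hol) (auto simp: fsigma_unit_ball)
  qed
  have "complex_of_real ` {s. \<bar>s\<bar> < 1 \<and> (\<lambda>k. a k * s ^ k) sums 0} \<subseteq> {z \<in> ball 0 1. \<phi> z = 0}"
  proof safe
    fix s :: real assume s: "\<bar>s\<bar> < 1" "(\<lambda>k. a k * s ^ k) sums 0"
    show b: "complex_of_real s \<in> ball 0 1" using s by simp
    have "(\<lambda>k. complex_of_real (a k * s ^ k)) sums complex_of_real 0" using s(2) by (rule sums_of_real)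
    then show "\<phi> (complex_of_real s) = 0" using sm[OF b] sums_unique2 by fastforce
  qed
  then have "countable (complex_of_real ` {s. \<bar>s\<bar> < 1 \<and> (\<lambda>k. a k * s ^ k) sums 0})"
    using cnt by (rule countable_subset)
  then show ?thesis by (rule countable_image_inj_on) (simp add: inj_on_def)
qed

text \<open>
  If infinitely many coefficient functions were nonzero, then a real point outside their
  countably many zeros would give a value with infinite support below \<open>Q\<close>.
\<close>

lemma regular_coefficients:
  fixes \<beta> :: "nat \<Rightarrow> rat \<Rightarrow> real"
  assumes rap: "\<And>q. rapid (\<lambda>k. \<beta> k q)" and "s1 < s2"
    and val: "\<And>s. s1 < s \<Longrightarrow> s < s2 \<Longrightarrow> \<bar>s\<bar> < 1 \<and> (\<exists>l. \<forall>q. (\<lambda>k. \<beta> k q * s ^ k) sums lc_coeff l q)"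
  shows "finite {q. q \<le> Q \<and> (\<exists>k. \<beta> k q \<noteq> 0)}"
proof (rule ccontr)
  assume "infinite {q. q \<le> Q \<and> (\<exists>k. \<beta> k q \<noteq> 0)}"
  then obtain g :: "nat \<Rightarrow> rat" where g: "inj g" "range g \<subseteq> {q. q \<le> Q \<and> (\<exists>k. \<beta> k q \<noteq> 0)}"
    using infinite_countable_subset by blast
  define Z where "Z i = {s. \<bar>s\<bar> < 1 \<and> (\<lambda>k. \<beta> k (g i) * s ^ k) sums 0}" for i
  have "countable (Z i)" for i
  proof -
    obtain k where "\<beta> k (g i) \<noteq> 0" using g(2) by blast
    then show ?thesis unfolding Z_def using countable_zeros_rapid[OF rap] by blast
  qed
  then have "countable (\<Union>i. Z i)" by simp
  then have "\<not> {s1<..<s2} \<subseteq> (\<Union>i. Z i)"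
    using uncountable_open_interval[of s1 s2] \<open>s1 < s2\<close> countable_subset by blast
  then obtain s where "s \<in> {s1<..<s2}" "s \<notin> (\<Union>i. Z i)" by blast
  then have s: "s1 < s" "s < s2" "\<And>i. s \<notin> Z i" by auto
  obtain l where l: "\<And>q. (\<lambda>k. \<beta> k q * s ^ k) sums lc_coeff l q" "\<bar>s\<bar> < 1" using val[OF s(1,2)] by blast
  have "lc_coeff l (g i) \<noteq> 0" for i using s(3)[of i] l(1)[of "g i"] l(2) by (auto simp: Z_def)
  then have "range g \<subseteq> {q. lc_coeff l q \<noteq> 0 \<and> q \<le> Q}" using g(2) by auto
  then have "finite (range g)" using finite_lc_trunc finite_subset by blast
  then show False using g(1) finite_imageD infinite_UNIV_nat by blast
qed

text \<open>At the right end point the perturbation has to decrease the point, elsewhere in the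
  interval it may increase it. \<open>\<sigma>\<close> encodes this direction relative to the sign
  of the leading coefficient of \<open>y\<close>, and a large \<open>N\<close> keeps the perturbed
  point from crossing the other end.\<close>

lemma perturb_inside:
  assumes "y \<noteq> 0" "A < B" "A \<le> x + y" "x + y \<le> (B::lc)"
  shows "\<exists>N>0. \<exists>\<sigma>. \<sigma> \<noteq> 0 \<and> (\<forall>u. ord_ge (of_nat N) u \<longrightarrow> 0 < \<sigma> * lc_coeff u (of_nat N) \<longrightarrow>
    A < x + y * (1 + u) \<and> x + y * (1 + u) < B)"
proof -
  define c where "c = lc_coeff y (lc_lead y)"
  have c: "c \<noteq> 0" using lc_lead_props(1)[OF assms(1)] by (simp add: c_def)
  have prod: "ord_ge (lc_lead y + of_nat N) (y * u)"
    "lc_coeff (y * u) (lc_lead y + of_nat N) = c * lc_coeff u (of_nat N)" if "ord_ge (of_nat N) u" for N u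
    using ord_ge_mult[OF ord_ge_lead that] lc_coeff_mult_lowest[OF ord_ge_lead that] by (auto simp: c_def)
  have pos: "0 < y * u" if "ord_ge (of_nat N) u" "0 < c * lc_coeff u (of_nat N)" for u N
    unfolding lc_pos_iff2 using prod[OF that(1)] that(2) by (intro exI[of _ "lc_lead y + of_nat N"]) simp
  have small: "\<exists>N>0. \<forall>u. ord_ge (of_nat N) u \<longrightarrow> \<bar>y * u\<bar> < g" if g: "0 < g" for g
  proof -
    obtain N :: nat where N: "lc_lead g - lc_lead y < of_nat N" using ex_nat_gt_rat by blast
    have "\<bar>y * u\<bar> < g" if u: "ord_ge (of_nat (Suc N)) u" for u
      by (rule abs_less_of_ord[OF prod(1)[OF u] g]) (use N in simp)
    then show ?thesis by (intro exI[of _ "Suc N"]) simp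
  qed
  show ?thesis
  proof (cases "x + y < B")
    case True
    obtain N where N: "N > 0" "\<And>u. ord_ge (of_nat N) u \<Longrightarrow> \<bar>y * u\<bar> < B - (x + y)"
      using small[of "B - (x + y)"] True by auto
    have "A < x + y * (1 + u) \<and> x + y * (1 + u) < B"
      if u: "ord_ge (of_nat N) u" "0 < c * lc_coeff u (of_nat N)" for u
      using N(2)[OF u(1)] pos[OF u] assms(3) by (auto simp: distrib_left algebra_simps)
    then show ?thesis using N(1) c by blast
  next
    case False
    then have B: "x + y = B" using assms by simp
    obtain N where N: "N > 0" "\<And>u. ord_ge (of_nat N) u \<Longrightarrow> \<bar>y * u\<bar> < B - A"
      using small[of "B - A"] assms by auto
    have "A < x + y * (1 + u) \<and> x + y * (1 + u) < B"
      if u: "ord_ge (of_nat N) u" "0 < - c * lc_coeff u (of_nat N)" for u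
    proof -
      have "0 < y * (- u)" by (rule pos[of N]) (use u in auto)
      moreover have "x + y * (1 + u) = B + y * u" using B by (simp add: algebra_simps)
      ultimately show ?thesis using N(2)[OF u(1)] by (simp add: abs_if split: if_splits)
    qed
    then show ?thesis using N(1) c by (intro exI[of _ N] conjI exI[of _ "- c"]) auto
  qed
qed

lemma tendsto_coeff_cmult:
  assumes m: "\<And>K. ord_ge m (X K)" and s: "\<And>q. (\<lambda>K. lc_coeff (X K) q) \<longlonglongrightarrow> lc_coeff y q"
  shows "(\<lambda>K. lc_coeff (c * X K) q) \<longlonglongrightarrow> lc_coeff (c * y) q"
proof -
  have y: "ord_ge m y" unfolding ord_ge_def
  proof (intro allI impI)
    fix q assume q: "q < m"
    have "(\<lambda>K. 0) \<longlonglongrightarrow> lc_coeff y q" using s[of q] ord_geD[OF m q] by simp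
    then show "lc_coeff y q = 0" using LIMSEQ_unique[OF tendsto_const] by metis
  qed
  have "(\<lambda>K. \<Sum>p | lc_coeff c p \<noteq> 0 \<and> p \<le> q - m. lc_coeff c p * lc_coeff (X K) (q - p)) \<longlonglongrightarrow>
    (\<Sum>p | lc_coeff c p \<noteq> 0 \<and> p \<le> q - m. lc_coeff c p * lc_coeff y (q - p))"
    by (intro tendsto_sum tendsto_mult tendsto_const s)
  then show ?thesis
    using lc_coeff_mult_ord[OF m, of _ c q] lc_coeff_mult_ord[OF y, of c q] by (simp add: mult.commute)
qed

lemma sums_anti:
  assumes "good b" "udisc x"
  shows "(\<lambda>k. lc_coeff (h * (anti b (Suc k) * x ^ Suc k)) q) sums lc_coeff (h * ev (anti b) x) q"
proof -
  obtain m where m: "\<And>k. ord_ge m (anti b k * x ^ k)"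
    using finite_low_imp_ord[OF finite_ev[OF good_anti[OF assms(1)] assms(2)]] by blast
  have "(\<lambda>k. lc_coeff (h * (anti b k * x ^ k)) q) sums lc_coeff (h * ev (anti b) x) q"
    by (rule sums_coeff_cmult[OF m sums_ev[OF good_anti[OF assms(1)] assms(2)]])
  then show ?thesis by (subst sums_Suc_iff) (simp add: anti_def)
qed

text \<open>The slack \<open>4 * lc_mono 1\<close> is the price of moving the base point inwards by
  \<open>lc_mono 1\<close> times the length of the interval.\<close>

lemma udiscI:
  assumes "\<bar>x\<bar> \<le> 1 + 4 * lc_mono 1"
  shows "udisc x"
proof -
  have o: "ord_ge 0 (1 + 4 * lc_mono 1)"
    using ord_ge_mult2[of 0 "4" 1 "lc_mono 1" 0] ord_ge_of_real[of 4] by (intro ord_ge_add) auto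
  have o4: "lc_coeff (4 * lc_mono 1) 0 = 0" using lc_coeff_of_real_mult[of 4 "lc_mono 1" 0] by simp
  have x: "ord_ge 0 x" by (rule ord_ge_of_abs_le[OF assms o])
  have "x \<le> 1 + 4 * lc_mono 1" "- x \<le> 1 + 4 * lc_mono 1" using assms by (auto simp: abs_le_iff)
  then have "lc_coeff x 0 \<le> 1" "lc_coeff (- x) 0 \<le> 1"
    using lc_coeff0_mono[of x "1 + 4 * lc_mono 1"] lc_coeff0_mono[of "- x" "1 + 4 * lc_mono 1"] x o o4 by auto
  then show ?thesis using x by (simp add: udisc_def)
qed

lemma udisc_le1: "\<bar>x\<bar> \<le> 1 \<Longrightarrow> udisc x"
proof -
  assume "\<bar>x\<bar> \<le> 1"
  then show ?thesis using lc_mono_pos[of 1] by (intro udiscI) linarith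
qed

text \<open>
  The base point \<open>y\<close> is the end point of larger absolute value, moved inwards by an
  infinitesimal fraction of the length: then \<open>z / y\<close> is, up to an infinitesimal, in
  \<open>[-1, 1]\<close> for all points \<open>z\<close> of the interval.
\<close>

lemma base_point:
  fixes e1 e2 :: lc
  assumes "e1 < e2"
  obtains y \<sigma> where "y \<noteq> 0" "e1 < y" "y < e2" "\<And>z. e1 \<le> z \<Longrightarrow> z \<le> e2 \<Longrightarrow> udisc (z / y)"
    "\<bar>\<sigma>\<bar> = 1"
    "\<And>s::real. 0 < s \<Longrightarrow> s < 1/2 \<Longrightarrow> e1 < y + (e2 - e1) * of_real (\<sigma> * s) \<and> y + (e2 - e1) * of_real (\<sigma> * s) < e2"
proof -
  define H where "H = e2 - e1"
  define \<epsilon> where "\<epsilon> = lc_mono 1"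
  have H: "0 < H" using assms by (simp add: H_def)
  have e: "0 < \<epsilon>" "\<epsilon> < of_real (1/4)"
    using infsml_abs_less[of \<epsilon> "1/4"] by (auto simp: \<epsilon>_def)
  have "4 * of_real (1/4) = (1::lc)" using of_real_mult[of 4 "1/4", where ?'a = lc] by simp
  then have e4: "4 * \<epsilon> < 1" using e by linarith
  note result = that
  \<comment> \<open>\<open>E\<close> is the end point of larger absolute value, and the sign
    \<open>\<sigma>\<close> points from it into the interval.\<close>
  have main: thesis
    if y: "y = E + of_real \<sigma> * (\<epsilon> * H)" and E: "\<And>z. e1 \<le> z \<Longrightarrow> z \<le> e2 \<Longrightarrow> \<bar>z\<bar> \<le> \<bar>E\<bar>" and \<sigma>: "\<bar>\<sigma>\<bar> = 1"
      and inside: "\<And>d. 0 < d \<Longrightarrow> d < H \<Longrightarrow> e1 < E + of_real \<sigma> * d \<and> E + of_real \<sigma> * d < e2" for E \<sigma> y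
  proof -
    have eH: "0 < \<epsilon> * H" using e H by simp
    have "4 * (\<epsilon> * H) < H" using mult_strict_right_mono[OF e4 H] by (simp add: mult_ac)
    then have e4H: "4 * (\<epsilon> * H) < H" .
    have HE: "H \<le> 2 * \<bar>E\<bar>" using E[of e1] E[of e2] assms by (simp add: H_def)
    have as: "\<bar>of_real \<sigma> * (\<epsilon> * H)\<bar> = \<epsilon> * H" using \<sigma> e H by (simp add: abs_mult)
    have Ey: "\<bar>E\<bar> \<le> \<bar>y\<bar> + \<epsilon> * H"
      using abs_triangle_ineq4[of y "of_real \<sigma> * (\<epsilon> * H)"] as by (simp add: y)
    \<comment> \<open>From \<open>H \<le> 2 * \<bar>E\<bar>\<close>,
      \<open>\<bar>E\<bar> \<le> \<bar>y\<bar> + \<epsilon> * H\<close> and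
      \<open>4 * (\<epsilon> * H) < H\<close>; it makes the shift \<open>\<epsilon> * H\<close>
      infinitesimal relative to \<open>y\<close> as well.\<close>
    have Hy: "H \<le> 4 * \<bar>y\<bar>" using Ey HE e4H by linarith
    then have y0: "y \<noteq> 0" using H by auto
    have "\<epsilon> * H \<le> \<epsilon> * (4 * \<bar>y\<bar>)" using Hy e by (intro mult_left_mono) auto
    then have E2: "\<bar>E\<bar> \<le> \<bar>y\<bar> * (1 + 4 * \<epsilon>)" using Ey by (simp add: algebra_simps)
    have ud: "udisc (z / y)" if "e1 \<le> z" "z \<le> e2" for z
    proof (rule udiscI)
      have "\<bar>z\<bar> \<le> \<bar>y\<bar> * (1 + 4 * \<epsilon>)" using E[OF that] E2 by simp
      then show "\<bar>z / y\<bar> \<le> 1 + 4 * lc_mono 1"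
        using y0 by (simp add: abs_divide pos_divide_le_eq \<epsilon>_def mult.commute)
    qed
    have "\<epsilon> * H < H" using e4H eH by linarith
    then have yin: "e1 < y \<and> y < e2" unfolding y by (intro inside eH)
    have sin: "e1 < y + (e2 - e1) * of_real (\<sigma> * s) \<and> y + (e2 - e1) * of_real (\<sigma> * s) < e2"
      if s: "0 < s" "s < 1/2" for s :: real
    proof -
      have eq: "y + (e2 - e1) * of_real (\<sigma> * s) = E + of_real \<sigma> * (\<epsilon> * H + of_real s * H)"
        by (simp add: y H_def algebra_simps)
      have "of_real s < (of_real (1/2) :: lc)" using s by (simp only: of_real_lc_less_iff)
      then have s2: "of_real s * H < of_real (1/2) * H" using H by (intro mult_strict_right_mono)
      have "of_real (1/2) * H = H / 2" by simp
      then have "\<epsilon> * H + of_real s * H < H" using s2 e4H eH by linarith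
      moreover have "0 < \<epsilon> * H + of_real s * H" using e H s by (intro add_pos_pos mult_pos_pos) auto
      ultimately show ?thesis unfolding eq by (intro inside)
    qed
    show thesis
      by (rule result[of y \<sigma>]) (use y0 yin ud \<sigma> sin in \<open>auto simp: H_def\<close>)
  qed
  show thesis
  proof (cases "\<bar>e1\<bar> \<le> \<bar>e2\<bar>")
    case True
    then have "e2 \<ge> 0" using assms by (auto simp: abs_if split: if_splits)
    show thesis by (rule main[of _ e2 "-1", OF refl]) (use True assms in \<open>auto simp: H_def abs_if split: if_splits\<close>)
  next
    case False
    show thesis by (rule main[of _ e1 1, OF refl]) (use False assms in \<open>auto simp: H_def abs_if split: if_splits\<close>)
  qed
qed


section \<open>The series normalised at a base point\<close>

lemma sum_inverse_Suc_binomial: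
  "1 / real (Suc k) * real (Suc k choose Suc j) = 1 / real (Suc j) * real (k choose j)"
proof -
  have "real (Suc j) * real (Suc k choose Suc j) = real (Suc k) * real (k choose j)"
    using Suc_times_binomial_eq[of k j] by (metis mult.commute of_nat_mult)
  then show ?thesis by (simp add: field_simps del: of_nat_Suc binomial_Suc_Suc)
qed

text \<open>In the coordinate \<open>(x - x0) / y\<close> the whole interval lies in the unit disc
  and the base point has coordinate 1, around which sufficiently small perturbations stay inside.
  \<open>S\<close> is fixed only up to end points, so that all four kinds of intervals are
  covered.\<close>

locale raw_series =
  fixes A B x0 y :: lc and S :: "lc set" and c :: "nat \<Rightarrow> lc" and f :: "lc \<Rightarrow> lc"
  assumes AB: "A < B" and S: "{x. A < x \<and> x < B} \<subseteq> S" "S \<subseteq> {A..B}"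
    and series: "weak_power_series c x0 f S"
    and y: "y \<noteq> 0" "A < x0 + y" "x0 + y < B"
    and yud: "\<And>x. A \<le> x \<Longrightarrow> x \<le> B \<Longrightarrow> udisc ((x - x0) / y)"
begin

definition "T k = c k * y ^ k"

lemma lim: "x \<in> S \<Longrightarrow> weak_lim (\<lambda>K. \<Sum>k\<le>K. T k * ((x - x0) / y) ^ k) (f x)"
proof -
  assume "x \<in> S"
  then have "weak_lim (\<lambda>K. \<Sum>k\<le>K. c k * (x - x0) ^ k) (f x)"
    using series by (simp add: weak_power_series_def)
  moreover have "T k * ((x - x0) / y) ^ k = c k * (x - x0) ^ k" for k
    using y(1) by (simp add: T_def power_divide)
  ultimately show ?thesis by simp
qed

lemma T_ord: "\<exists>m. \<forall>k. ord_ge m (T k)"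
  and T_binomial: "convergent (\<lambda>K. \<Sum>k\<le>K. real (k choose j) * lc_coeff (T k) q)"
proof -
  obtain N \<sigma> where N: "N > 0" "\<sigma> \<noteq> 0"
    and ins: "\<And>u. ord_ge (of_nat N) u \<Longrightarrow> 0 < \<sigma> * lc_coeff u (of_nat N) \<Longrightarrow>
      A < x0 + y * (1 + u) \<and> x0 + y * (1 + u) < B"
    using perturb_inside[OF y(1) AB, of x0] y by (metis less_imp_le)
  have conv: "\<exists>l. weak_lim (\<lambda>K. \<Sum>k\<le>K. T k * (1 + u) ^ k) l"
    if u: "ord_ge (of_nat N) u" "0 < \<sigma> * lc_coeff u (of_nat N)" for u
  proof -
    have "x0 + y * (1 + u) \<in> S" using ins[OF u] S by blast
    from lim[OF this] show ?thesis using y(1) by auto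
  qed
  have "\<exists>m. \<forall>k. ord_ge m (T k)"
    by (rule uniform_ord_ge_of_weakly_convergent[OF N(1), of \<sigma>], rule conv)
      (use N in \<open>auto simp: zero_less_mult_iff linorder_neq_iff\<close>)
  then show "\<exists>m. \<forall>k. ord_ge m (T k)" .
  then obtain m where m: "\<And>k. ord_ge m (T k)" by blast
  show "convergent (\<lambda>K. \<Sum>k\<le>K. real (k choose j) * lc_coeff (T k) q)"
  proof (rule binomial_sums_convergent[OF m N(1) N(2)])
    fix s :: real assume s: "0 < s"
    show "\<exists>l. weak_lim (\<lambda>K. \<Sum>k\<le>K. T k * (1 + of_real (s * \<sigma>) * lc_mono (of_nat N)) ^ k) l"
    proof (rule conv)
      show "ord_ge (of_nat N) (of_real (s * \<sigma>) * lc_mono (of_nat N))"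
        by (rule ord_ge_mult2[OF ord_ge_of_real ord_ge_mono_lc]) simp
      have "0 < \<sigma> * \<sigma>" using N(2) by (auto simp: zero_less_mult_iff linorder_neq_iff)
      then have "0 < s * (\<sigma> * \<sigma>)" using s by (rule mult_pos_pos[rotated])
      then show "0 < \<sigma> * lc_coeff (of_real (s * \<sigma>) * lc_mono (of_nat N)) (of_nat N)"
        unfolding lc_coeff_of_real_mult by (simp add: mult_ac)
    qed
  qed
qed

lemma T_rapid: "rapid (\<lambda>k. lc_coeff (T k) q)"
  by (rule rapidI_binomial) (rule T_binomial)

text \<open>The factor \<open>y\<close> in front comes from the substitution
  \<open>x = x0 + y * z\<close>.\<close>

lemma antilim: 
  assumes "weak_antiderivative c x0 F S" "x \<in> S"
  shows "(\<lambda>K. \<Sum>k\<le>K. lc_coeff (y * (of_real (1 / real (Suc k)) * (T k * ((x - x0) / y) ^ Suc k))) q) \<longlonglongrightarrow> lc_coeff (F x) q"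
proof -
  have "weak_lim (\<lambda>K. \<Sum>k\<le>K. (1 / real (Suc k)) *\<^sub>R (c k * (x - x0) ^ Suc k)) (F x)"
    using assms unfolding weak_antiderivative_def by blast
  moreover have "(1 / real (Suc k)) *\<^sub>R (c k * (x - x0) ^ Suc k) =
    y * (of_real (1 / real (Suc k)) * (T k * ((x - x0) / y) ^ Suc k))" for k
  proof -
    have "c k * (x - x0) ^ Suc k = y * (T k * ((x - x0) / y) ^ Suc k)"
      using y(1) by (simp add: T_def power_divide)
    then show ?thesis by (simp only: scaleR_conv_of_real mult_ac)
  qed
  ultimately have "weak_lim (\<lambda>K. \<Sum>k\<le>K. y * (of_real (1 / real (Suc k)) * (T k * ((x - x0) / y) ^ Suc k))) (F x)"
    by simp
  from weak_lim_coeff[OF this] show ?thesis by simp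
qed

text \<open>If the length of the interval is comparable to \<open>y\<close>, the given series is already normal.\<close>

lemma comparable:
  assumes "\<not> infsml ((B - A) / y)"
  shows "good T" "x \<in> S \<Longrightarrow> f x = ev T ((x - x0) / y)"
    "weak_antiderivative c x0 F S \<Longrightarrow> x \<in> S \<Longrightarrow> F x = y * ev (anti T) ((x - x0) / y)"
proof -
  \<comment> \<open>Standard parts of the coordinates of the end points. They differ because the
    length is not infinitesimal relative to \<open>y\<close>, so the real coordinates strictly
    between them belong to points of \<open>S\<close>.\<close>
  define a1 where "a1 = lc_coeff ((A - x0) / y) 0"
  define a2 where "a2 = lc_coeff ((B - x0) / y) 0"
  have ud: "udisc ((A - x0) / y)" "udisc ((B - x0) / y)" using yud AB by auto
  have "(B - A) / y = (B - x0) / y - (A - x0) / y" by (simp add: diff_divide_distrib)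
  then have "ord_ge 0 ((B - A) / y)" "lc_coeff ((B - A) / y) 0 = a2 - a1"
    using ud by (auto simp: udisc_def a1_def a2_def ord_ge_diff)
  then have ne: "a1 \<noteq> a2" using assms by (auto simp: infsml_iff)
  have sin: "A < x0 + y * of_real s \<and> x0 + y * of_real s < B" if s: "min a1 a2 < s" "s < max a1 a2" for s
  proof (cases "0 < y")
    case True
    then have "(A - x0) / y < (B - x0) / y" using AB by (simp add: divide_strict_right_mono)
    then have "a1 \<le> a2" unfolding a1_def a2_def using ud by (intro lc_coeff0_mono) (auto simp: udisc_def)
    then have "(A - x0) / y < of_real s" "of_real s < (B - x0) / y"
      using s ud by (auto intro!: lc_less_of_coeff0 simp: udisc_def a1_def a2_def)
    then show ?thesis using True by (simp add: field_simps)
  next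
    case False
    then have y: "y < 0" using y(1) by simp
    then have "(B - x0) / y < (A - x0) / y" using AB by (simp add: divide_strict_right_mono_neg)
    then have "a2 \<le> a1" unfolding a1_def a2_def using ud by (intro lc_coeff0_mono) (auto simp: udisc_def)
    then have "(B - x0) / y < of_real s" "of_real s < (A - x0) / y"
      using s ud by (auto intro!: lc_less_of_coeff0 simp: udisc_def a1_def a2_def)
    then show ?thesis using y by (simp add: field_simps)
  qed
  have "finite {q. q \<le> Q \<and> (\<exists>k. lc_coeff (T k) q \<noteq> 0)}" for Q
  proof (rule regular_coefficients[OF T_rapid])
    show "min a1 a2 < max a1 a2" using ne by auto
  next
    fix s assume s: "min a1 a2 < s" "s < max a1 a2"
    have "\<bar>a1\<bar> \<le> 1" "\<bar>a2\<bar> \<le> 1" using ud by (auto simp: udisc_def a1_def a2_def)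
    then have "\<bar>s\<bar> < 1" using s by linarith
    moreover have "(\<lambda>k. lc_coeff (T k) q * s ^ k) sums lc_coeff (f (x0 + y * of_real s)) q" for q
    proof -
      have "x0 + y * of_real s \<in> S" using sin[OF s] S by blast
      from weak_lim_coeff[OF lim[OF this], of q] show ?thesis
        using y(1) by (simp add: sums_def_le mult.commute[of "T _"] of_real_power[symmetric] mult.commute[of _ "s ^ _"]
          del: of_real_power)
    qed
    ultimately show "\<bar>s\<bar> < 1 \<and> (\<exists>l. \<forall>q. (\<lambda>k. lc_coeff (T k) q * s ^ k) sums lc_coeff l q)" by blast
  qed
  then show g: "good T" unfolding good_def using T_rapid by blast
  show "f x = ev T ((x - x0) / y)" if "x \<in> S"
  proof -
    have "udisc ((x - x0) / y)" using yud S that by auto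
    then show ?thesis using weak_lim_unique[OF lim[OF that] weak_lim_ev[OF g]] by blast
  qed
  show "F x = y * ev (anti T) ((x - x0) / y)" if F: "weak_antiderivative c x0 F S" and x: "x \<in> S"
  proof (rule lc_eqI)
    fix q
    have "udisc ((x - x0) / y)" using yud S x by auto
    from sums_anti[OF g this, of y q]
    have "(\<lambda>K. \<Sum>k\<le>K. lc_coeff (y * (of_real (1 / real (Suc k)) * (T k * ((x - x0) / y) ^ Suc k))) q)
      \<longlonglongrightarrow> lc_coeff (y * ev (anti T) ((x - x0) / y)) q"
      unfolding sums_def_le by (simp add: anti_def mult.assoc del: of_real_divide power_Suc)
    then show "lc_coeff (F x) q = lc_coeff (y * ev (anti T) ((x - x0) / y)) q"
      using antilim[OF F x] LIMSEQ_unique by blast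
  qed
qed

end

text \<open>
  If the interval is infinitesimally short compared to \<open>y\<close>, the coefficients of the given series
  need not have a common left-finite support; the series is expanded again at \<open>x0 + y\<close>, in units of
  the length of the interval.
\<close>

locale short_series = raw_series +
  fixes s1 s2 :: real
  assumes short: "infsml ((B - A) / y)"
    and s12: "s1 < s2" "-1 < s1" "s2 < 1"
    and inside: "\<And>s. s1 < s \<Longrightarrow> s < s2 \<Longrightarrow> A < x0 + y + (B - A) * of_real s \<and> x0 + y + (B - A) * of_real s < B"
begin

definition "H = B - A"
definition "\<omega> = H / y"
text \<open>Partial sums of the j-th coefficient of the re-expanded series:
  \<open>(x - x0) / y = 1 + \<omega> * \<tau> x\<close>, and the binomial theorem collects the
  powers of \<open>\<tau> x\<close>.\<close>

definition "X j K = (\<Sum>k\<le>K. of_nat (k choose j) * T k * \<omega> ^ j)" for j K :: nat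
definition "\<beta> j q = lim (\<lambda>K. lc_coeff (X j K) q)"
text \<open>Justified by \<open>\<beta>_finite\<close>, which makes the support of each
  \<open>\<beta> j\<close> left-finite.\<close>

definition "b j = Abs_lc (\<beta> j)"
definition "m = (SOME m. \<forall>k. ord_ge m (T k))"
definition "\<mu> = (SOME \<mu>. 0 < \<mu> \<and> ord_ge \<mu> \<omega>)"
definition "\<tau> x = (x - (x0 + y)) / H"

lemma H: "0 < H" "y * \<omega> = H"
  using AB y(1) by (auto simp: H_def \<omega>_def)

lemma m: "ord_ge m (T k)"
  using someI_ex[OF T_ord] unfolding m_def by blast

lemma \<mu>: "0 < \<mu>" "ord_ge \<mu> \<omega>"
proof -
  have "\<exists>\<mu>. 0 < \<mu> \<and> ord_ge \<mu> \<omega>" using short unfolding infsml_def \<omega>_def H_def by blast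
  then show "0 < \<mu>" "ord_ge \<mu> \<omega>" using someI_ex[of "\<lambda>\<mu>. 0 < \<mu> \<and> ord_ge \<mu> \<omega>"] unfolding \<mu>_def by blast+
qed

lemma ord_X: "ord_ge (m + of_nat j * \<mu>) (X j K)"
  unfolding X_def
proof (rule ord_ge_sum)
  fix k
  have "ord_ge m (of_nat (k choose j) * T k)"
    using ord_ge_mult2[OF ord_ge_of_real[of "real (k choose j)"] m[of k], of m] by simp
  then show "ord_ge (m + of_nat j * \<mu>) (of_nat (k choose j) * T k * \<omega> ^ j)"
    by (intro ord_ge_mult ord_ge_power \<mu>)
qed

lemma X_lim: "(\<lambda>K. lc_coeff (X j K) q) \<longlonglongrightarrow> \<beta> j q"
proof -
  define P where "P = {p. lc_coeff (\<omega> ^ j) p \<noteq> 0 \<and> p \<le> q - m}"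
  have "lc_coeff (X j K) q = (\<Sum>p\<in>P. lc_coeff (\<omega> ^ j) p * (\<Sum>k\<le>K. real (k choose j) * lc_coeff (T k) (q - p)))" for K
  proof -
    have "lc_coeff (X j K) q = (\<Sum>k\<le>K. real (k choose j) * lc_coeff (T k * \<omega> ^ j) q)"
      unfolding X_def by (simp add: mult.assoc)
    also have "\<dots> = (\<Sum>k\<le>K. \<Sum>p\<in>P. lc_coeff (\<omega> ^ j) p * (real (k choose j) * lc_coeff (T k) (q - p)))"
      using lc_coeff_mult_ord[OF m, of _ "\<omega> ^ j" q] by (simp add: P_def sum_distrib_left mult_ac)
    also have "\<dots> = (\<Sum>p\<in>P. lc_coeff (\<omega> ^ j) p * (\<Sum>k\<le>K. real (k choose j) * lc_coeff (T k) (q - p)))"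
      by (subst sum.swap) (simp add: sum_distrib_left)
    finally show ?thesis .
  qed
  moreover have "convergent (\<lambda>K. \<Sum>p\<in>P. lc_coeff (\<omega> ^ j) p * (\<Sum>k\<le>K. real (k choose j) * lc_coeff (T k) (q - p)))"
    by (intro convergent_sum convergent_mult convergent_const T_binomial)
  ultimately show ?thesis unfolding \<beta>_def by (simp add: convergent_LIMSEQ_iff)
qed

lemma \<beta>_zero: "q < m + of_nat j * \<mu> \<Longrightarrow> \<beta> j q = 0"
  using X_lim[of j q] ord_geD[OF ord_X[of j]] LIMSEQ_unique[OF tendsto_const] by force

lemma \<beta>_eventually_zero:
  assumes "q < m + of_nat (Suc J) * \<mu>" "j \<ge> Suc J"
  shows "q < m + of_nat j * \<mu>" "\<beta> j q = 0"
proof -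
  have "of_nat (Suc J) * \<mu> \<le> of_nat j * \<mu>" using \<mu> assms by (intro mult_right_mono) auto
  then show "q < m + of_nat j * \<mu>" using assms by linarith
  then show "\<beta> j q = 0" by (rule \<beta>_zero)
qed

text \<open>Decay is trivial after re-expansion: the j-th coefficient has order at least
  \<open>m + j * \<mu>\<close>, so at a fixed exponent only finitely many are nonzero.\<close>

lemma \<beta>_rapid: "rapid (\<lambda>j. \<beta> j q)"
proof -
  obtain J :: nat where "q < m + of_nat (Suc J) * \<mu>" using ex_nat_mult_gt[OF \<mu>(1)] by blast
  then show ?thesis by (intro rapid_eventually_zero[of "Suc J"]) (rule \<beta>_eventually_zero)
qed

lemma \<tau>: "udisc (\<tau> x)" if "A \<le> x" "x \<le> B"
proof -
  have "\<bar>x - (x0 + y)\<bar> \<le> H" using that y by (auto simp: H_def abs_le_iff)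
  then show ?thesis using H unfolding \<tau>_def by (intro udisc_le1) (simp add: abs_divide)
qed

lemma reexpand: "(x - x0) / y = 1 + \<omega> * \<tau> x"
  using H y(1) by (simp add: \<tau>_def \<omega>_def field_simps)

text \<open>At a fixed exponent only \<open>j \<le> J\<close> contribute, so the limit over
  \<open>K\<close> never has to be exchanged with an infinite sum.\<close>

lemma value_lim:
  assumes x: "x \<in> S" and J: "q < m + of_nat (Suc J) * \<mu>"
  shows "(\<lambda>K. \<Sum>j\<le>J. lc_coeff (\<tau> x ^ j * X j K) q) \<longlonglongrightarrow> lc_coeff (f x) q"
proof -
  have ud: "udisc (\<tau> x)" using x S \<tau> by auto
  have w: "ord_ge \<mu> (\<omega> * \<tau> x)" using ud \<mu> by (intro ord_ge_mult2[of \<mu> _ 0]) (auto simp: udisc_def)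
  have "lc_coeff (\<Sum>k\<le>K. T k * ((x - x0) / y) ^ k) q = (\<Sum>j\<le>J. lc_coeff (\<tau> x ^ j * X j K) q)" for K
  proof -
    have "lc_coeff (\<Sum>k\<le>K. T k * ((x - x0) / y) ^ k) q =
      (\<Sum>k\<le>K. \<Sum>j\<le>J. real (k choose j) * lc_coeff (T k * (\<omega> * \<tau> x) ^ j) q)"
      unfolding reexpand using lc_coeff_mult_binomial[OF m w \<mu>(1) J, of _ 1] by simp
    also have "\<dots> = (\<Sum>j\<le>J. \<Sum>k\<le>K. real (k choose j) * lc_coeff (T k * (\<omega> * \<tau> x) ^ j) q)"
      by (rule sum.swap)
    also have "\<dots> = (\<Sum>j\<le>J. lc_coeff (\<tau> x ^ j * X j K) q)"
    proof (rule sum.cong[OF refl])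
      fix j
      have "\<tau> x ^ j * X j K = (\<Sum>k\<le>K. of_nat (k choose j) * (T k * (\<omega> * \<tau> x) ^ j))"
        unfolding X_def sum_distrib_left by (rule sum.cong) (simp_all add: power_mult_distrib mult_ac)
      then show "(\<Sum>k\<le>K. real (k choose j) * lc_coeff (T k * (\<omega> * \<tau> x) ^ j) q) = lc_coeff (\<tau> x ^ j * X j K) q"
        by (simp only: lc_coeff_sum lc_coeff_of_nat_mult)
    qed
    finally show ?thesis .
  qed
  then show ?thesis using weak_lim_coeff[OF lim[OF x], of q] by presburger
qed

lemma \<beta>_finite: "finite {q. q \<le> Q \<and> (\<exists>j. \<beta> j q \<noteq> 0)}"
proof (rule regular_coefficients[OF \<beta>_rapid s12(1)])
  fix s assume s: "s1 < s" "s < s2"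
  define x where "x = x0 + y + H * of_real s"
  have x: "x \<in> S" using inside[OF s] S unfolding x_def H_def by blast
  have \<tau>x: "\<tau> x = of_real s" using H by (simp add: x_def \<tau>_def)
  have "(\<lambda>j. \<beta> j q * s ^ j) sums lc_coeff (f x) q" for q
  proof -
    obtain J :: nat where J: "q < m + of_nat (Suc J) * \<mu>" using ex_nat_mult_gt[OF \<mu>(1)] by blast
    have "(\<lambda>K. \<Sum>j\<le>J. s ^ j * lc_coeff (X j K) q) \<longlonglongrightarrow> (\<Sum>j\<le>J. s ^ j * \<beta> j q)"
      by (intro tendsto_sum tendsto_mult tendsto_const X_lim)
    moreover have "lc_coeff (\<tau> x ^ j * X j K) q = s ^ j * lc_coeff (X j K) q" for j K
      unfolding \<tau>x of_real_power[symmetric] lc_coeff_of_real_mult ..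
    ultimately have "lc_coeff (f x) q = (\<Sum>j\<le>J. s ^ j * \<beta> j q)"
      using value_lim[OF x J] LIMSEQ_unique by simp
    moreover have "(\<lambda>j. s ^ j * \<beta> j q) sums (\<Sum>j\<le>J. s ^ j * \<beta> j q)"
      by (rule sums_finite) (use \<beta>_eventually_zero[OF J] in auto)
    ultimately show ?thesis by (simp add: mult.commute)
  qed
  then show "\<bar>s\<bar> < 1 \<and> (\<exists>l. \<forall>q. (\<lambda>k. \<beta> k q * s ^ k) sums lc_coeff l q)" using s s12 by auto
qed

lemma b_coeff: "lc_coeff (b j) q = \<beta> j q"
proof -
  have "left_finite {q. \<beta> j q \<noteq> 0}"
    unfolding left_finite_def
    by (intro allI finite_subset[OF _ \<beta>_finite]) auto
  then show ?thesis unfolding b_def by (subst Abs_lc_inverse) auto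
qed

lemma good_b: "good b"
  unfolding good_def b_coeff using \<beta>_finite \<beta>_rapid by blast

lemma ord_b: "ord_ge (m + of_nat j * \<mu>) (b j)"
  using \<beta>_zero by (simp add: ord_ge_def b_coeff)

lemma X_lim_mult: "(\<lambda>K. lc_coeff (z * X j K) q) \<longlonglongrightarrow> lc_coeff (z * b j) q"
  by (rule tendsto_coeff_cmult[OF ord_X]) (simp add: b_coeff X_lim)

lemma normal_value: "f x = ev b (\<tau> x)" if x: "x \<in> S"
proof (rule lc_eqI)
  fix q
  have ud: "udisc (\<tau> x)" using x S \<tau> by auto
  obtain J :: nat where J: "q < m + of_nat (Suc J) * \<mu>" using ex_nat_mult_gt[OF \<mu>(1)] by blast
  have "(\<lambda>K. \<Sum>j\<le>J. lc_coeff (\<tau> x ^ j * X j K) q) \<longlonglongrightarrow> (\<Sum>j\<le>J. lc_coeff (\<tau> x ^ j * b j) q)"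
    by (intro tendsto_sum X_lim_mult)
  then have "lc_coeff (f x) q = (\<Sum>j\<le>J. lc_coeff (\<tau> x ^ j * b j) q)"
    using value_lim[OF x J] LIMSEQ_unique by blast
  moreover have "(\<lambda>j. lc_coeff (b j * \<tau> x ^ j) q) sums (\<Sum>j\<le>J. lc_coeff (b j * \<tau> x ^ j) q)"
  proof (rule sums_finite)
    fix j assume "j \<notin> {..J}"
    then have "q < m + of_nat j * \<mu> + 0" using \<beta>_eventually_zero(1)[OF J, of j] by simp
    then show "lc_coeff (b j * \<tau> x ^ j) q = 0"
      by (rule ord_geD[OF ord_ge_mult[OF ord_b ord_ge_power0], rotated]) (use ud in \<open>simp add: udisc_def\<close>)
  qed simp
  ultimately show "lc_coeff (f x) q = lc_coeff (ev b (\<tau> x)) q"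
    using sums_ev[OF good_b ud] sums_unique2 by (metis (no_types, lifting) mult.commute sum.cong)
qed

text \<open>Differences are compared because the two antiderivatives are normalised differently: the
  given one formally at \<open>x0\<close>, that of the re-expanded series at
  \<open>x0 + y\<close>.\<close>

lemma normal_anti_value:
  assumes F: "weak_antiderivative c x0 F S" and x: "x \<in> S" and x': "x' \<in> S"
  shows "F x - F x' = H * (ev (anti b) (\<tau> x) - ev (anti b) (\<tau> x'))"
proof (rule lc_eqI)
  fix q
  obtain mH where mH: "ord_ge mH H" using ord_ge_ex by blast
  obtain my where my: "ord_ge my y" using ord_ge_ex by blast
  obtain J1 :: nat where J1: "q < (mH + m) + of_nat (Suc J1) * \<mu>" using ex_nat_mult_gt[OF \<mu>(1)] by blast
  obtain J2 :: nat where J2: "q < (my + m) + of_nat (Suc J2) * \<mu>" using ex_nat_mult_gt[OF \<mu>(1)] by blast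
  \<comment> \<open>\<open>J2\<close> belongs to the expansion of the power \<open>k + 1\<close>,
    which runs up to \<open>J + 1\<close>; \<open>J1\<close> belongs to the series in
    \<open>b\<close>.\<close>
  define J where "J = max J1 J2"
  have "of_nat (Suc J1) * \<mu> \<le> of_nat (Suc J) * \<mu>" "of_nat (Suc J2) * \<mu> \<le> of_nat (Suc (Suc J)) * \<mu>"
    using \<mu> by (intro mult_right_mono; simp add: J_def)+
  then have J: "q < (mH + m) + of_nat (Suc J) * \<mu>" "q < (my + m) + of_nat (Suc (Suc J)) * \<mu>"
    using J1 J2 by linarith+
  \<comment> \<open>The terms with \<open>j = 0\<close> are independent of the point and cancel in
    the difference, so their convergence does not have to be settled separately.\<close>
  define R where "R K = (\<Sum>k\<le>K. 1 / real (Suc k) * lc_coeff (y * T k) q)" for K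
  define Z where "Z z j = of_real (1 / real (Suc j)) * (H * \<tau> z ^ Suc j)" for z and j :: nat
  have main: "(\<lambda>K. R K + (\<Sum>j\<le>J. lc_coeff (Z z j * X j K) q)) \<longlonglongrightarrow> lc_coeff (F z) q"
    and val: "lc_coeff (H * ev (anti b) (\<tau> z)) q = (\<Sum>j\<le>J. lc_coeff (Z z j * b j) q)" if z: "z \<in> S" for z
  proof -
    have ud: "udisc (\<tau> z)" using z S \<tau> by auto
    have w: "ord_ge \<mu> (\<omega> * \<tau> z)" using ud \<mu> by (intro ord_ge_mult2[of \<mu> _ 0]) (auto simp: udisc_def)
    have "lc_coeff (y * (of_real (1 / real (Suc k)) * (T k * ((z - x0) / y) ^ Suc k))) q =
      1 / real (Suc k) * lc_coeff (y * T k) q +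
      (\<Sum>j\<le>J. lc_coeff (Z z j * (of_nat (k choose j) * T k * \<omega> ^ j)) q)" for k
    proof -
      have "lc_coeff (y * (of_real (1 / real (Suc k)) * (T k * ((z - x0) / y) ^ Suc k))) q =
        1 / real (Suc k) * lc_coeff ((y * T k) * (of_real 1 + \<omega> * \<tau> z) ^ Suc k) q"
        unfolding reexpand lc_coeff_of_real_mult[symmetric] of_real_1 by (simp only: mult_ac)
      also have "\<dots> = (\<Sum>j\<le>Suc J. 1 / real (Suc k) * real (Suc k choose j) * lc_coeff (y * T k * (\<omega> * \<tau> z) ^ j) q)"
        unfolding lc_coeff_mult_binomial[OF ord_ge_mult[OF my m] w \<mu>(1) J(2)]
        by (simp only: power_one mult_1_right sum_distrib_left mult.assoc)
      also have "\<dots> = 1 / real (Suc k) * lc_coeff (y * T k) q +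
        (\<Sum>j\<le>J. 1 / real (Suc k) * real (Suc k choose Suc j) * lc_coeff (y * T k * (\<omega> * \<tau> z) ^ Suc j) q)"
        unfolding sum.atMost_Suc_shift by simp
      also have "(\<Sum>j\<le>J. 1 / real (Suc k) * real (Suc k choose Suc j) * lc_coeff (y * T k * (\<omega> * \<tau> z) ^ Suc j) q) =
        (\<Sum>j\<le>J. lc_coeff (Z z j * (of_nat (k choose j) * T k * \<omega> ^ j)) q)"
      proof (rule sum.cong[OF refl])
        fix j
        have "y * T k * (\<omega> * \<tau> z) ^ Suc j = (y * \<omega>) * (T k * \<omega> ^ j * \<tau> z ^ Suc j)"
          by (simp add: power_mult_distrib mult_ac)
        then have "Z z j * (of_nat (k choose j) * T k * \<omega> ^ j) =
          of_real (1 / real (Suc j)) * (of_nat (k choose j) * (y * T k * (\<omega> * \<tau> z) ^ Suc j))"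
          unfolding Z_def H(2) by (simp only: mult_ac)
        then show "1 / real (Suc k) * real (Suc k choose Suc j) * lc_coeff (y * T k * (\<omega> * \<tau> z) ^ Suc j) q
          = lc_coeff (Z z j * (of_nat (k choose j) * T k * \<omega> ^ j)) q"
          unfolding sum_inverse_Suc_binomial by (simp only: lc_coeff_of_real_mult lc_coeff_of_nat_mult mult.assoc)
      qed
      finally show ?thesis .
    qed
    then have "(\<Sum>k\<le>K. lc_coeff (y * (of_real (1 / real (Suc k)) * (T k * ((z - x0) / y) ^ Suc k))) q) =
      R K + (\<Sum>j\<le>J. lc_coeff (Z z j * X j K) q)" for K
      unfolding R_def X_def by (simp add: sum.distrib sum_distrib_left sum.swap[of _ "{..J}"])
    then show "(\<lambda>K. R K + (\<Sum>j\<le>J. lc_coeff (Z z j * X j K) q)) \<longlonglongrightarrow> lc_coeff (F z) q"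
      using antilim[OF F z, of q] by presburger
    have Zb: "H * (anti b (Suc j) * \<tau> z ^ Suc j) = Z z j * b j" for j
      by (simp add: anti_def Z_def mult_ac)
    have "(\<lambda>j. lc_coeff (Z z j * b j) q) sums (\<Sum>j\<le>J. lc_coeff (Z z j * b j) q)"
    proof (rule sums_finite)
      fix j assume "j \<notin> {..J}"
      then have "of_nat (Suc J) * \<mu> \<le> of_nat j * \<mu>" using \<mu> by (intro mult_right_mono) auto
      then have q: "q < mH + (m + of_nat j * \<mu>)" using J(1) by linarith
      have "ord_ge 0 (\<tau> z ^ Suc j)" using ud by (intro ord_ge_power0) (simp add: udisc_def)
      then have "ord_ge mH (H * \<tau> z ^ Suc j)" by (rule ord_ge_mult2[OF mH]) simp
      then have "ord_ge mH (Z z j)" unfolding Z_def by (rule ord_ge_mult2[OF ord_ge_of_real]) simp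
      then show "lc_coeff (Z z j * b j) q = 0" by (rule ord_geD[OF ord_ge_mult[OF _ ord_b] q])
    qed simp
    then show "lc_coeff (H * ev (anti b) (\<tau> z)) q = (\<Sum>j\<le>J. lc_coeff (Z z j * b j) q)"
      using sums_anti[OF good_b ud, of H q] unfolding Zb using sums_unique2 by blast
  qed
  have "(\<lambda>K. \<Sum>j\<le>J. lc_coeff (Z z j * X j K) q) \<longlonglongrightarrow> (\<Sum>j\<le>J. lc_coeff (Z z j * b j) q)" for z
    by (intro tendsto_sum X_lim_mult)
  then have "(\<lambda>K. (\<Sum>j\<le>J. lc_coeff (Z x j * X j K) q) - (\<Sum>j\<le>J. lc_coeff (Z x' j * X j K) q)) \<longlonglongrightarrow>
    (\<Sum>j\<le>J. lc_coeff (Z x j * b j) q) - (\<Sum>j\<le>J. lc_coeff (Z x' j * b j) q)"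
    by (intro tendsto_diff)
  moreover have "(\<lambda>K. (\<Sum>j\<le>J. lc_coeff (Z x j * X j K) q) - (\<Sum>j\<le>J. lc_coeff (Z x' j * X j K) q)) \<longlonglongrightarrow>
    lc_coeff (F x) q - lc_coeff (F x') q"
    using tendsto_diff[OF main[OF x] main[OF x']] by simp
  ultimately show "lc_coeff (F x - F x') q = lc_coeff (H * (ev (anti b) (\<tau> x) - ev (anti b) (\<tau> x'))) q"
    using LIMSEQ_unique val[OF x] val[OF x'] by (simp add: right_diff_distrib)
qed

end

text \<open>The two cases differ in whether the length is infinitesimal relative to the base point.
  If it is not, real values of the coordinate reach into the interval; if it is, all coordinates are
  infinitely close to 1 and the unit has to be changed.\<close>

theorem normal_form:
  assumes AB: "A < B" and S: "{x. A < x \<and> x < B} \<subseteq> S" "S \<subseteq> {A..B}"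
    and series: "weak_power_series c x0 f S"
  obtains x1 h b where "h \<noteq> 0" "good b" "\<And>x. A \<le> x \<Longrightarrow> x \<le> B \<Longrightarrow> udisc ((x - x1) / h)"
    "\<And>x. x \<in> S \<Longrightarrow> f x = ev b ((x - x1) / h)"
    "\<And>F x x'. weak_antiderivative c x0 F S \<Longrightarrow> x \<in> S \<Longrightarrow> x' \<in> S \<Longrightarrow>
      F x - F x' = h * (ev (anti b) ((x - x1) / h) - ev (anti b) ((x' - x1) / h))"
proof -
  obtain y \<sigma> where y: "y \<noteq> 0" "A - x0 < y" "y < B - x0"
    and ud: "\<And>z. A - x0 \<le> z \<Longrightarrow> z \<le> B - x0 \<Longrightarrow> udisc (z / y)"
    and \<sigma>: "\<bar>\<sigma>\<bar> = 1"
    and ins: "\<And>s::real. 0 < s \<Longrightarrow> s < 1/2 \<Longrightarrow> A - x0 < y + ((B - x0) - (A - x0)) * of_real (\<sigma> * s) \<and>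
      y + ((B - x0) - (A - x0)) * of_real (\<sigma> * s) < B - x0"
    using base_point[of "A - x0" "B - x0"] AB by (metis diff_strict_right_mono)
  interpret raw_series A B x0 y S c f
    using AB S series y ud by unfold_locales (auto simp: algebra_simps)
  show thesis
  proof (cases "infsml ((B - A) / y)")
    case False
    note C = comparable[OF False]
    show thesis
      by (rule that[OF y(1) C(1) yud C(2)]) (auto simp: C(3) right_diff_distrib)
  next
    case True
    \<comment> \<open>From the base point, real multiples of the length are available on the inner
      side only, up to one half.\<close>
    define s1 where "s1 = min 0 (\<sigma> / 2)"
    define s2 where "s2 = max 0 (\<sigma> / 2)"
    have \<sigma>': "\<sigma> = 1 \<or> \<sigma> = -1" using \<sigma> by linarith
    interpret short_series A B x0 y S c f s1 s2
    proof unfold_locales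
      show "infsml ((B - A) / y)" by (rule True)
      show "s1 < s2" "-1 < s1" "s2 < 1" using \<sigma>' by (auto simp: s1_def s2_def)
      fix s assume s: "s1 < s" "s < s2"
      have \<sigma>s: "0 < \<sigma> * s" "\<sigma> * s < 1/2" "\<sigma> * (\<sigma> * s) = s" using s \<sigma>' by (auto simp: s1_def s2_def)
      show "A < x0 + y + (B - A) * of_real s \<and> x0 + y + (B - A) * of_real s < B"
        using ins[OF \<sigma>s(1,2), unfolded \<sigma>s(3)] by (simp add: algebra_simps)
    qed
    have h: "H \<noteq> 0" using H(1) by simp
    show thesis
      by (rule that[OF h good_b \<tau>[unfolded \<tau>_def] normal_value[unfolded \<tau>_def] normal_anti_value[unfolded \<tau>_def]])
  qed
qed

section \<open>Integrals of simple functions\<close>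

lemma ivl_set_bounds: "{x. lower J < x \<and> x < upper J} \<subseteq> ivl_set J" "ivl_set J \<subseteq> {lower J..upper J}"
  by (auto simp: ivl_set_def split: if_splits)

lemma weak_lim_const: "weak_lim (\<lambda>n. l) l"
  by (simp add: weak_lim_def)

lemma weak_lim_Suc:
  assumes "weak_lim X l"
  shows "weak_lim (\<lambda>n. X (Suc n)) l"
  unfolding weak_lim_def
proof (intro allI impI)
  fix e :: real assume "0 < e"
  then have "\<forall>\<^sub>F n in sequentially. \<forall>q. of_rat q \<le> 1 / e \<longrightarrow> \<bar>lc_coeff (X n - l) q\<bar> < e"
    using assms unfolding weak_lim_def by blast
  then show "\<forall>\<^sub>F n in sequentially. \<forall>q. of_rat q \<le> 1 / e \<longrightarrow> \<bar>lc_coeff (X (Suc n) - l) q\<bar> < e"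
    by (rule eventually_sequentially_Suc[THEN iffD2])
qed

lemma segment_inside:
  assumes "A < B" "0 < t" "t < 1"
  shows "A < A + of_real t * (B - A :: lc)" "A + of_real t * (B - A) < B"
proof -
  show "A < A + of_real t * (B - A)" using assms by simp
  have "(of_real t :: lc) < of_real 1" unfolding of_real_lc_less_iff by (rule assms)
  then have "of_real t * (B - A) < of_real 1 * (B - A)"
    using assms(1) by (intro mult_strict_right_mono) auto
  then show "A + of_real t * (B - A) < B" by simp
qed

lemma simple_on_subset: "simple_on f S \<Longrightarrow> S' \<subseteq> S \<Longrightarrow> simple_on f S'"
  unfolding simple_on_def weak_power_series_def by blast

lemma simple_on_cong: "(\<And>x. x \<in> S \<Longrightarrow> f x = g x) \<Longrightarrow> simple_on f S \<longleftrightarrow> simple_on g S"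
  by (simp add: simple_on_def weak_power_series_def)

lemma ivl_integral_cong: "(\<And>x. x \<in> ivl_set J \<Longrightarrow> f x = g x) \<Longrightarrow> ivl_integral f J = ivl_integral g J"
  by (simp add: ivl_integral_def weak_power_series_def)

lemma simple_on_degenerate:
  assumes "\<not> lower J < upper J"
  shows "simple_on f (ivl_set J)"
  unfolding simple_on_def weak_power_series_def
proof (intro exI ballI)
  define c where "c k = (if k = 0 then f (lower J) else 0)" for k :: nat
  fix x assume "x \<in> ivl_set J"
  then have x: "x = lower J" using ivl_set_bounds(2)[of J] assms by fastforce
  have "(\<Sum>k\<le>K. c k * (x - lower J) ^ k) = f x" for K
  proof -
    have "(\<Sum>k\<le>K. c k * (x - lower J) ^ k) = (\<Sum>k\<in>{0}. c k * (x - lower J) ^ k)"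
      by (rule sum.mono_neutral_right) (auto simp: c_def)
    then show ?thesis by (simp add: c_def x)
  qed
  then show "weak_lim (\<lambda>K. \<Sum>k\<le>K. c k * (x - lower J) ^ k) (f x)" by (simp add: weak_lim_const)
qed

text \<open>The way back from the normal form to the representation required by
  \<open>ivl_integral\<close>; the factor \<open>h\<close> of the antiderivative comes from the
  substitution \<open>x = x1 + h * t\<close>.\<close>

lemma
  assumes "h \<noteq> 0" "good b" "\<And>x. x \<in> S \<Longrightarrow> udisc ((x - x1) / h)" "\<And>x. x \<in> S \<Longrightarrow> f x = ev b ((x - x1) / h)"
  shows good_power_series: "weak_power_series (\<lambda>k. b k / h ^ k) x1 f S"
    and good_antiderivative: "weak_antiderivative (\<lambda>k. b k / h ^ k) x1 (\<lambda>x. h * ev (anti b) ((x - x1) / h)) S"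
proof -
  show "weak_power_series (\<lambda>k. b k / h ^ k) x1 f S"
    unfolding weak_power_series_def
  proof
    fix x assume "x \<in> S"
    then show "weak_lim (\<lambda>K. \<Sum>k\<le>K. b k / h ^ k * (x - x1) ^ k) (f x)"
      using weak_lim_ev[OF assms(2,3)] assms(4) by (simp add: power_divide)
  qed
  show "weak_antiderivative (\<lambda>k. b k / h ^ k) x1 (\<lambda>x. h * ev (anti b) ((x - x1) / h)) S"
    unfolding weak_antiderivative_def
  proof
    fix x assume x: "x \<in> S"
    define t where "t = (x - x1) / h"
    have t: "udisc t" "x - x1 = h * t" using assms(1) assms(3)[OF x] by (auto simp: t_def)
    have "weak_lim (\<lambda>K. \<Sum>k\<le>Suc K. h * anti b k * t ^ k) (h * ev (anti b) t)"
      using weak_lim_Suc[OF weak_lim_ev[OF good_cmult[OF good_anti[OF assms(2)]] t(1)]]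
        ev_cmult[OF good_anti[OF assms(2)] t(1)] by simp
    moreover have "(\<Sum>k\<le>Suc K. h * anti b k * t ^ k) =
      (\<Sum>k\<le>K. (1 / real (Suc k)) *\<^sub>R (b k / h ^ k * (x - x1) ^ Suc k))" for K
    proof -
      have "(\<Sum>k\<le>Suc K. h * anti b k * t ^ k) = (\<Sum>k\<le>K. h * anti b (Suc k) * t ^ Suc k)"
        unfolding sum.atMost_Suc_shift by (simp add: anti_def)
      also have "\<dots> = (\<Sum>k\<le>K. (1 / real (Suc k)) *\<^sub>R (b k / h ^ k * (x - x1) ^ Suc k))"
      proof (rule sum.cong[OF refl])
        fix k
        have "b k / h ^ k * (x - x1) ^ Suc k = h * b k * t ^ Suc k"
          using assms(1) by (simp add: t(2) power_mult_distrib)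
        then show "h * anti b (Suc k) * t ^ Suc k = (1 / real (Suc k)) *\<^sub>R (b k / h ^ k * (x - x1) ^ Suc k)"
          by (simp only: scaleR_conv_of_real anti_def nat.case) (simp only: mult_ac)
      qed
      finally show ?thesis .
    qed
    ultimately show "weak_lim (\<lambda>K. \<Sum>k\<le>K. (1 / real (Suc k)) *\<^sub>R (b k / h ^ k * (x - x1) ^ Suc k))
      (h * ev (anti b) ((x - x1) / h))" unfolding t_def[symmetric] by simp
  qed
qed

lemma ev_Lipschitz_on:
  assumes "h \<noteq> 0" "good b" and ud: "\<And>x. A \<le> x \<Longrightarrow> x \<le> B \<Longrightarrow> udisc ((x - x1) / h)"
  shows "\<exists>M>0. \<forall>x\<in>{A..B}. \<forall>x'\<in>{A..B}. \<bar>h * ev b ((x - x1) / h) - h * ev b ((x' - x1) / h)\<bar> \<le> M * \<bar>x - x'\<bar>"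
proof -
  obtain m where m: "\<And>x y n. udisc x \<Longrightarrow> udisc y \<Longrightarrow> ord_ge n (y - x) \<Longrightarrow> ord_ge (m + n) (ev b y - ev b x)"
    using ev_Lipschitz[OF assms(2)] by blast
  \<comment> \<open>The exponent \<open>m - 1\<close> instead of \<open>m\<close> gives a strict
    inequality of orders, which absorbs all leading coefficients.\<close>
  have "\<bar>h * ev b ((x - x1) / h) - h * ev b ((x' - x1) / h)\<bar> \<le> lc_mono (m - 1) * \<bar>x - x'\<bar>"
    if x: "x \<in> {A..B}" "x' \<in> {A..B}" for x x'
  proof (cases "x = x'")
    case False
    define d where "d = (x - x1) / h - (x' - x1) / h"
    have d: "x - x' = h * d" using assms(1) by (simp add: d_def diff_divide_distrib[symmetric])
    have d0: "d \<noteq> 0" using False d by auto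
    have "ord_ge (m + lc_lead d) (ev b ((x - x1) / h) - ev b ((x' - x1) / h))"
      by (rule m) (use x ud ord_ge_lead[of d] in \<open>auto simp: d_def\<close>)
    then have 1: "ord_ge (lc_lead h + (m + lc_lead d)) (h * (ev b ((x - x1) / h) - ev b ((x' - x1) / h)))"
      by (rule ord_ge_mult[OF ord_ge_lead])
    have "lc_lead \<bar>x - x'\<bar> = lc_lead h + lc_lead d"
      using lc_lead_mult(1)[OF assms(1) d0] by (simp add: abs_lc_def d)
    then have "lc_lead (lc_mono (m - 1) * \<bar>x - x'\<bar>) = m - 1 + (lc_lead h + lc_lead d)"
      using lc_lead_mult(1)[of "lc_mono (m - 1)" "\<bar>x - x'\<bar>"] False lc_mono_pos[of "m - 1"]
      by (simp add: less_le)
    moreover have "0 < lc_mono (m - 1) * \<bar>x - x'\<bar>" using False by simp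
    ultimately have "\<bar>h * (ev b ((x - x1) / h) - ev b ((x' - x1) / h))\<bar> < lc_mono (m - 1) * \<bar>x - x'\<bar>"
      by (intro abs_less_of_ord[OF 1]) simp_all
    then show ?thesis by (simp add: right_diff_distrib)
  qed simp
  then show ?thesis by (intro exI[of _ "lc_mono (m - 1)"]) auto
qed

lemma Lipschitz_limit:
  assumes "0 < M" "\<And>x x'. x \<in> {A..B} \<Longrightarrow> x' \<in> {A..B} \<Longrightarrow> \<bar>F x - F x'\<bar> \<le> M * \<bar>x - x'\<bar>"
    "S \<subseteq> {A..B}" "p \<in> {A..B}"
  shows "lc_limit_within F p S (F p)"
  unfolding lc_limit_within_def
proof (intro allI impI)
  fix e :: lc assume e: "0 < e"
  have "\<bar>F x - F p\<bar> < e" if "x \<in> S" "\<bar>x - p\<bar> < e / M" for x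
  proof -
    have "\<bar>F x - F p\<bar> \<le> M * \<bar>x - p\<bar>" using assms that by blast
    also have "\<dots> < M * (e / M)" using that assms(1) by (intro mult_strict_left_mono)
    finally show ?thesis using assms(1) by simp
  qed
  then show "\<exists>d>0. \<forall>x\<in>S. x \<noteq> p \<longrightarrow> \<bar>x - p\<bar> < d \<longrightarrow> \<bar>F x - F p\<bar> < e"
    using e assms(1) by (intro exI[of _ "e / M"]) auto
qed

lemma lc_limit_within_unique:
  assumes "A < B" "{x. A < x \<and> x < B} \<subseteq> S" "p = A \<or> p = B"
    and "lc_limit_within F p S l" "lc_limit_within F p S l'"
  shows "l = l'"
proof (rule ccontr)
  assume "l \<noteq> l'"
  define e where "e = \<bar>l - l'\<bar> / 2"
  have e: "0 < e" using \<open>l \<noteq> l'\<close> by (simp add: e_def)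
  obtain d where d: "0 < d" "\<And>x. x \<in> S \<Longrightarrow> x \<noteq> p \<Longrightarrow> \<bar>x - p\<bar> < d \<Longrightarrow> \<bar>F x - l\<bar> < e"
    using assms(4) e unfolding lc_limit_within_def by blast
  obtain d' where d': "0 < d'" "\<And>x. x \<in> S \<Longrightarrow> x \<noteq> p \<Longrightarrow> \<bar>x - p\<bar> < d' \<Longrightarrow> \<bar>F x - l'\<bar> < e"
    using assms(5) e unfolding lc_limit_within_def by blast
  define k where "k = min (min d d') (B - A) / 2"
  have k: "0 < k" "k < d" "k < d'" "k < B - A" using d(1) d'(1) assms(1) by (auto simp: k_def min_def)
  define x where "x = (if p = A then A + k else B - k)"
  have "x \<in> S" "x \<noteq> p" "\<bar>x - p\<bar> = k" using k assms by (auto simp: x_def)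
  then have "\<bar>F x - l\<bar> < e" "\<bar>F x - l'\<bar> < e" using d d' k by auto
  then have "\<bar>l - l'\<bar> < e + e" by linarith
  then show False by (simp add: e_def)
qed

lemma lc_limit_within_diff:
  assumes "lc_limit_within F p S l" "lc_limit_within G p S l'"
  shows "lc_limit_within (\<lambda>x. F x - G x) p S (l - l')"
  unfolding lc_limit_within_def
proof (intro allI impI)
  fix e :: lc assume "0 < e"
  then have e: "0 < e / 2" by simp
  obtain d where d: "0 < d" "\<And>x. x \<in> S \<Longrightarrow> x \<noteq> p \<Longrightarrow> \<bar>x - p\<bar> < d \<Longrightarrow> \<bar>F x - l\<bar> < e / 2"
    using assms(1) e unfolding lc_limit_within_def by blast
  obtain d' where d': "0 < d'" "\<And>x. x \<in> S \<Longrightarrow> x \<noteq> p \<Longrightarrow> \<bar>x - p\<bar> < d' \<Longrightarrow> \<bar>G x - l'\<bar> < e / 2"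
    using assms(2) e unfolding lc_limit_within_def by blast
  have "\<bar>F x - G x - (l - l')\<bar> < e" if "x \<in> S" "x \<noteq> p" "\<bar>x - p\<bar> < min d d'" for x
  proof -
    have "\<bar>F x - l\<bar> < e / 2" "\<bar>G x - l'\<bar> < e / 2" using d d' that by auto
    then show ?thesis by linarith
  qed
  then show "\<exists>d>0. \<forall>x\<in>S. x \<noteq> p \<longrightarrow> \<bar>x - p\<bar> < d \<longrightarrow> \<bar>F x - G x - (l - l')\<bar> < e"
    using d(1) d'(1) by (intro exI[of _ "min d d'"]) auto
qed

text \<open>
  The integral is determined by the values of \<open>f\<close> at the points dividing the interval in a real
  ratio; this makes it independent of the power series representing \<open>f\<close>.
\<close>

lemma increment_eq_lc_int:
  assumes AB: "A < B" and S: "{x. A < x \<and> x < B} \<subseteq> S" "S \<subseteq> {A..B}"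
    and series: "weak_power_series c x0 f S" and F: "weak_antiderivative c x0 F S"
    and lims: "lc_limit_within F A S l" "lc_limit_within F B S u"
  shows "\<exists>v. tame v \<and> (\<forall>t. 0 < t \<longrightarrow> t < 1 \<longrightarrow> v t = f (A + of_real t * (B - A))) \<and> u - l = (B - A) * lc_int v"
proof -
  obtain x1 h b where h: "h \<noteq> 0" and b: "good b" and ud: "\<And>x. A \<le> x \<Longrightarrow> x \<le> B \<Longrightarrow> udisc ((x - x1) / h)"
    and f: "\<And>x. x \<in> S \<Longrightarrow> f x = ev b ((x - x1) / h)"
    and anti: "\<And>x x'. x \<in> S \<Longrightarrow> x' \<in> S \<Longrightarrow> F x - F x' = h * (ev (anti b) ((x - x1) / h) - ev (anti b) ((x' - x1) / h))"
    using normal_form[OF AB S series] F by metis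
  define G where "G x = h * ev (anti b) ((x - x1) / h)" for x
  obtain M where M: "0 < M" "\<And>x x'. x \<in> {A..B} \<Longrightarrow> x' \<in> {A..B} \<Longrightarrow> \<bar>G x - G x'\<bar> \<le> M * \<bar>x - x'\<bar>"
    using ev_Lipschitz_on[OF h good_anti[OF b] ud] unfolding G_def by blast
  define \<tau>A where "\<tau>A = (A - x1) / h"
  define \<tau>B where "\<tau>B = (B - x1) / h"
  define v where "v t = ev b (\<tau>A + of_real t * (\<tau>B - \<tau>A))" for t
  have uAB: "udisc \<tau>A" "udisc \<tau>B" using ud AB by (auto simp: \<tau>A_def \<tau>B_def)
  have "\<exists>x. A < x \<and> x < B" using AB by (rule dense)
  then obtain p where p: "p \<in> S" using S by blast
  \<comment> \<open>The two antiderivatives are known to differ by a constant on \<open>S\<close>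
    only; the end points are reached through limits.\<close>
  have FG: "F x - G x = F p - G p" if "x \<in> S" for x
    using anti[OF that p] by (simp add: G_def right_diff_distrib algebra_simps)
  have const: "lc_limit_within (\<lambda>x. F x - G x) q S (F p - G p)" for q
    unfolding lc_limit_within_def using FG by (auto intro!: exI[of _ 1])
  have GA: "lc_limit_within G A S (G A)" and GB: "lc_limit_within G B S (G B)"
    by (rule Lipschitz_limit[OF M S(2)]; use AB in simp)+
  have "l - G A = F p - G p" "u - G B = F p - G p"
    using lc_limit_within_unique[OF AB S(1) _ lc_limit_within_diff[OF lims(1) GA] const]
      lc_limit_within_unique[OF AB S(1) _ lc_limit_within_diff[OF lims(2) GB] const] by auto
  then have "u - l = G B - G A" by (simp add: algebra_simps)
  also have "\<dots> = h * (ev (anti b) \<tau>B - ev (anti b) \<tau>A)"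
    by (simp only: G_def \<tau>A_def \<tau>B_def right_diff_distrib)
  also have "\<dots> = h * ((\<tau>B - \<tau>A) * lc_int v)"
    unfolding v_def ev_anti_diff[OF b uAB] ..
  also have "\<dots> = (B - A) * lc_int v" using h by (simp add: \<tau>A_def \<tau>B_def diff_divide_distrib[symmetric])
  finally have "u - l = (B - A) * lc_int v" .
  moreover have "tame v" unfolding v_def by (rule tame_ev_segment[OF b uAB])
  moreover have "v t = f (A + of_real t * (B - A))" if t: "0 < t" "t < 1" for t
  proof -
    have "A + of_real t * (B - A) \<in> S" using segment_inside[OF AB t] S(1) by blast
    moreover have "\<tau>A + of_real t * (\<tau>B - \<tau>A) = (A + of_real t * (B - A) - x1) / h"
      unfolding \<tau>A_def \<tau>B_def using h by (simp add: field_simps)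
    ultimately show ?thesis using f by (simp add: v_def)
  qed
  ultimately show ?thesis by blast
qed

lemma ivl_integral_eqI:
  assumes J: "lower J < upper J" and "weak_power_series c x0 f (ivl_set J)" "weak_antiderivative c x0 F (ivl_set J)"
    "lc_limit_within F (lower J) (ivl_set J) l" "lc_limit_within F (upper J) (ivl_set J) u"
  shows "ivl_integral f J = u - l"
proof -
  have "(THE v. \<exists>x0 c F l u. weak_power_series c x0 f (ivl_set J) \<and>
            weak_antiderivative c x0 F (ivl_set J) \<and>
            lc_limit_within F (lower J) (ivl_set J) l \<and>
            lc_limit_within F (upper J) (ivl_set J) u \<and> v = u - l) = u - l"
  proof (rule the_equality)
    show "\<exists>x0 c F l' u'. weak_power_series c x0 f (ivl_set J) \<and>
            weak_antiderivative c x0 F (ivl_set J) \<and>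
            lc_limit_within F (lower J) (ivl_set J) l' \<and>
            lc_limit_within F (upper J) (ivl_set J) u' \<and> u - l = u' - l'"
      using assms by blast
    fix v assume "\<exists>x0 c F l u. weak_power_series c x0 f (ivl_set J) \<and>
            weak_antiderivative c x0 F (ivl_set J) \<and>
            lc_limit_within F (lower J) (ivl_set J) l \<and>
            lc_limit_within F (upper J) (ivl_set J) u \<and> v = u - l"
    then obtain x0' c' F' l' u' where v: "v = u' - l'" and rep: "weak_power_series c' x0' f (ivl_set J)"
      "weak_antiderivative c' x0' F' (ivl_set J)"
      "lc_limit_within F' (lower J) (ivl_set J) l'" "lc_limit_within F' (upper J) (ivl_set J) u'" by blast
    obtain w where w: "tame w" "\<And>t. 0 < t \<Longrightarrow> t < 1 \<Longrightarrow> w t = f (lower J + of_real t * (upper J - lower J))"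
      "u - l = (upper J - lower J) * lc_int w"
      using increment_eq_lc_int[OF J ivl_set_bounds assms(2-5)] by blast
    obtain w' where w': "tame w'" "\<And>t. 0 < t \<Longrightarrow> t < 1 \<Longrightarrow> w' t = f (lower J + of_real t * (upper J - lower J))"
      "u' - l' = (upper J - lower J) * lc_int w'"
      using increment_eq_lc_int[OF J ivl_set_bounds rep] by blast
    \<comment> \<open>The two representations may have different centres and coefficients, but their
      integrands agree at all interior points in real ratio.\<close>
    have "lc_int w = lc_int w'" by (rule lc_int_cong_open) (use w w' in auto)
    then show "v = u - l" using v w(3) w'(3) by simp
  qed
  then show ?thesis unfolding ivl_integral_def using J by simp
qed

section \<open>Additivity and positivity of the integral\<close>

lemma simple_on_normal_form:
  assumes "simple_on f (ivl_set J)" "lower J < upper J"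
  obtains x1 h b where "h \<noteq> 0" "good b" "\<And>x. lower J \<le> x \<Longrightarrow> x \<le> upper J \<Longrightarrow> udisc ((x - x1) / h)"
    "\<And>x. x \<in> ivl_set J \<Longrightarrow> f x = ev b ((x - x1) / h)"
proof -
  obtain x0 c where "weak_power_series c x0 f (ivl_set J)" using assms(1) unfolding simple_on_def by blast
  from normal_form[OF assms(2) ivl_set_bounds this] that show thesis by metis
qed

lemma simple_on_antiderivative:
  assumes "simple_on f (ivl_set J)" "lower J < upper J"
  obtains c x0 F M where "weak_power_series c x0 f (ivl_set J)" "weak_antiderivative c x0 F (ivl_set J)" "0 < M"
    "\<And>x x'. x \<in> {lower J..upper J} \<Longrightarrow> x' \<in> {lower J..upper J} \<Longrightarrow> \<bar>F x - F x'\<bar> \<le> M * \<bar>x - x'\<bar>"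
proof -
  obtain x1 h b where h: "h \<noteq> 0" and b: "good b"
    and ud: "\<And>x. lower J \<le> x \<Longrightarrow> x \<le> upper J \<Longrightarrow> udisc ((x - x1) / h)"
    and f: "\<And>x. x \<in> ivl_set J \<Longrightarrow> f x = ev b ((x - x1) / h)" by (rule simple_on_normal_form[OF assms]) (rule that)
  have ud': "udisc ((x - x1) / h)" if "x \<in> ivl_set J" for x using ud that ivl_set_bounds(2)[of J] by auto
  show thesis
    using that[OF good_power_series[OF h b ud' f] good_antiderivative[OF h b ud' f]]
      ev_Lipschitz_on[OF h good_anti[OF b] ud] by blast
qed

text \<open>One antiderivative serves all subintervals at once, so that additivity and Lipschitz
  bounds reduce to statements about its increments.\<close>

lemma simple_integral_increments:
  assumes "simple_on f (ivl_set J)" "lower J < upper J"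
  obtains F M where "0 < M"
    "\<And>x x'. x \<in> {lower J..upper J} \<Longrightarrow> x' \<in> {lower J..upper J} \<Longrightarrow> \<bar>F x - F x'\<bar> \<le> M * \<bar>x - x'\<bar>"
    "\<And>K. lower K \<le> upper K \<Longrightarrow> lower K \<in> {lower J..upper J} \<Longrightarrow> upper K \<in> {lower J..upper J} \<Longrightarrow>
      ivl_set K \<subseteq> ivl_set J \<Longrightarrow> ivl_integral f K = F (upper K) - F (lower K)"
proof -
  obtain c x0 F M where ps: "weak_power_series c x0 f (ivl_set J)" "weak_antiderivative c x0 F (ivl_set J)" and M: "0 < M"
    "\<And>x x'. x \<in> {lower J..upper J} \<Longrightarrow> x' \<in> {lower J..upper J} \<Longrightarrow> \<bar>F x - F x'\<bar> \<le> M * \<bar>x - x'\<bar>"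
    by (rule simple_on_antiderivative[OF assms]) (rule that)
  show thesis
  proof (rule that[OF M])
    fix K assume K: "lower K \<le> upper K" "lower K \<in> {lower J..upper J}" "upper K \<in> {lower J..upper J}"
      "ivl_set K \<subseteq> ivl_set J"
    have sub: "ivl_set K \<subseteq> {lower J..upper J}" using K(4) ivl_set_bounds(2)[of J] by blast
    show "ivl_integral f K = F (upper K) - F (lower K)"
    proof (cases "lower K < upper K")
      case True
      have "weak_power_series c x0 f (ivl_set K)" "weak_antiderivative c x0 F (ivl_set K)"
        using ps K(4) unfolding weak_power_series_def weak_antiderivative_def by blast+
      then show ?thesis
        by (rule ivl_integral_eqI[OF True _ _ Lipschitz_limit[OF M sub K(2)] Lipschitz_limit[OF M sub K(3)]])
    next
      case False
      then show ?thesis using K(1) by (simp add: ivl_integral_def)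
    qed
  qed
qed

lemma ivl_integral_eq_lc_int:
  assumes "simple_on f (ivl_set J)" "lower J < upper J"
  obtains v where "tame v" "\<And>t. 0 < t \<Longrightarrow> t < 1 \<Longrightarrow> v t = f (lower J + of_real t * (upper J - lower J))"
    "ivl_integral f J = (upper J - lower J) * lc_int v"
proof -
  obtain c x0 F M where ps: "weak_power_series c x0 f (ivl_set J)" "weak_antiderivative c x0 F (ivl_set J)" and M: "0 < M"
    "\<And>x x'. x \<in> {lower J..upper J} \<Longrightarrow> x' \<in> {lower J..upper J} \<Longrightarrow> \<bar>F x - F x'\<bar> \<le> M * \<bar>x - x'\<bar>"
    by (rule simple_on_antiderivative[OF assms]) (rule that)
  have lims: "lc_limit_within F (lower J) (ivl_set J) (F (lower J))" "lc_limit_within F (upper J) (ivl_set J) (F (upper J))"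
    by (rule Lipschitz_limit[OF M ivl_set_bounds(2)]; use assms(2) in simp)+
  show thesis
    using increment_eq_lc_int[OF assms(2) ivl_set_bounds ps lims] ivl_integral_eqI[OF assms(2) ps lims] that
    by metis
qed

text \<open>Formulated for a combination because the series of \<open>f\<close> and \<open>g\<close>
  may have different centres and scales; after restriction to the points in real ratio the
  integrands can simply be added. Its use is to compare integrals.\<close>

lemma ivl_integral_combination_nonneg:
  assumes "simple_on f (ivl_set J)" "simple_on g (ivl_set J)"
    and nonneg: "\<And>x. x \<in> ivl_set J \<Longrightarrow> 0 \<le> \<alpha> * f x + \<beta> * g x"
  shows "0 \<le> \<alpha> * ivl_integral f J + \<beta> * ivl_integral g J"
proof (cases "lower J < upper J")
  case True
  define x where "x t = lower J + of_real t * (upper J - lower J)" for t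
  obtain v where v: "tame v" "\<And>t. 0 < t \<Longrightarrow> t < 1 \<Longrightarrow> v t = f (x t)"
    "ivl_integral f J = (upper J - lower J) * lc_int v"
    using ivl_integral_eq_lc_int[OF assms(1) True] unfolding x_def by metis
  obtain w where w: "tame w" "\<And>t. 0 < t \<Longrightarrow> t < 1 \<Longrightarrow> w t = g (x t)"
    "ivl_integral g J = (upper J - lower J) * lc_int w"
    using ivl_integral_eq_lc_int[OF assms(2) True] unfolding x_def by metis
  have t: "tame (\<lambda>t. \<alpha> * v t)" "tame (\<lambda>t. \<beta> * w t)" by (intro tame_mult tame_const v w)+
  have "0 \<le> lc_int (\<lambda>t. \<alpha> * v t + \<beta> * w t)"
  proof (rule lc_int_nonneg)
    fix t :: real assume "0 < t" "t < 1"
    then have "x t \<in> ivl_set J" using segment_inside[OF True] ivl_set_bounds(1)[of J] by (auto simp: x_def)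
    then show "0 \<le> \<alpha> * v t + \<beta> * w t" using nonneg v(2) w(2) \<open>0 < t\<close> \<open>t < 1\<close> by simp
  qed (intro tame_add t)
  then have "0 \<le> \<alpha> * lc_int v + \<beta> * lc_int w"
    by (simp add: lc_int_add[OF t] lc_int_cmult v w)
  then have "0 \<le> (upper J - lower J) * (\<alpha> * lc_int v + \<beta> * lc_int w)" using True by simp
  then show ?thesis unfolding v(3) w(3) by (simp add: algebra_simps)
next
  case False
  then show ?thesis by (simp add: ivl_integral_def)
qed

text \<open>In the coordinate \<open>t = (x - x1) / h\<close> the factor \<open>x\<close> is
  \<open>x1 + h * t\<close>, and multiplication by \<open>t\<close> is a \<open>shift\<close>;
  Horner's scheme does the rest.\<close>

lemma simple_on_mult_poly:
  fixes p :: "lc poly"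
  assumes "simple_on f (ivl_set J)"
  shows "simple_on (\<lambda>x. f x * poly p x) (ivl_set J)"
proof (cases "lower J < upper J")
  case True
  obtain x1 h b where h: "h \<noteq> 0" and b: "good b"
    and ud: "\<And>x. lower J \<le> x \<Longrightarrow> x \<le> upper J \<Longrightarrow> udisc ((x - x1) / h)"
    and f: "\<And>x. x \<in> ivl_set J \<Longrightarrow> f x = ev b ((x - x1) / h)" by (rule simple_on_normal_form[OF assms True]) (rule that)
  have ud': "udisc ((x - x1) / h)" if "x \<in> ivl_set J" for x using ud that ivl_set_bounds(2)[of J] by auto
  have "\<exists>b'. good b' \<and> (\<forall>x\<in>ivl_set J. f x * poly p x = ev b' ((x - x1) / h))"
  proof (induction p)
    case 0
    have "ev (\<lambda>k. 0 * b k) ((x - x1) / h) = 0" if "x \<in> ivl_set J" for x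
      using ev_cmult[OF b ud'[OF that], of 0] by simp
    then show ?case using good_cmult[OF b, of 0] by auto
  next
    case (pCons a p)
    then obtain b' where b': "good b'" "\<And>x. x \<in> ivl_set J \<Longrightarrow> f x * poly p x = ev b' ((x - x1) / h)" by blast
    define d where "d k = a * b k + (x1 * b' k + h * shift b' k)" for k
    have gd: "good d" unfolding d_def by (intro good_add good_cmult good_shift b b')
    have "f x * poly (pCons a p) x = ev d ((x - x1) / h)" if x: "x \<in> ivl_set J" for x
    proof -
      have hx: "h * ((x - x1) / h * z) = x * z - x1 * z" for z
        using h by (simp add: left_diff_distrib)
      have e: "ev d ((x - x1) / h) = a * f x + (x1 * (f x * poly p x) + h * ((x - x1) / h * (f x * poly p x)))"
        unfolding d_def
        by (simp add: ev_add[OF good_cmult[OF b] good_add[OF good_cmult[OF b'(1)] good_cmult[OF good_shift[OF b'(1)]]] ud'[OF x]]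
          ev_add[OF good_cmult[OF b'(1)] good_cmult[OF good_shift[OF b'(1)]] ud'[OF x]]
          ev_cmult[OF b ud'[OF x]] ev_cmult[OF b'(1) ud'[OF x]] ev_cmult[OF good_shift[OF b'(1)] ud'[OF x]]
          ev_shift[OF b'(1) ud'[OF x]] f[OF x] b'(2)[OF x, unfolded f[OF x]])
      show ?thesis unfolding e hx by (simp add: algebra_simps)
    qed
    then show ?case using gd by blast
  qed
  then obtain b' where b': "good b'" "\<And>x. x \<in> ivl_set J \<Longrightarrow> f x * poly p x = ev b' ((x - x1) / h)" by blast
  show ?thesis unfolding simple_on_def using good_power_series[OF h b'(1) ud' b'(2)] by blast
qed (rule simple_on_degenerate)

section \<open>Families of disjoint intervals\<close>

lemma ivl_bounds_in:
  assumes "lower K < upper K" "ivl_set K \<subseteq> {A..B}"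
  shows "lower K \<in> {A..B}" "upper K \<in> {A..B}"
proof -
  obtain x where x: "lower K < x" "x < upper K" using dense[OF assms(1)] by blast
  then have xAB: "A \<le> x" "x \<le> B" using assms(2) ivl_set_bounds(1)[of K] by auto
  have "A \<le> lower K"
  proof (rule ccontr)
    assume "\<not> A \<le> lower K"
    then obtain z where z: "lower K < z" "z < A" using dense[of "lower K" A] by auto
    then have "z \<in> {x. lower K < x \<and> x < upper K}" using x xAB by simp
    then have "z \<in> {A..B}" using assms(2) ivl_set_bounds(1)[of K] by blast
    then show False using z by simp
  qed
  moreover have "upper K \<le> B"
  proof (rule ccontr)
    assume "\<not> upper K \<le> B"
    then obtain z where z: "B < z" "z < upper K" using dense[of B "upper K"] by auto
    then have "z \<in> {x. lower K < x \<and> x < upper K}" using x xAB by simp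
    then have "z \<in> {A..B}" using assms(2) ivl_set_bounds(1)[of K] by blast
    then show False using z by simp
  qed
  ultimately show "lower K \<in> {A..B}" "upper K \<in> {A..B}" using assms(1) by auto
qed

text \<open>Induction along increasing right end points: of two disjoint nondegenerate intervals the
  one that ends first lies to the left, so the increments telescope. A general monotone
  \<open>H\<close> serves lengths as well as combinations with antiderivatives.\<close>

lemma sum_increments_le:
  fixes H :: "lc \<Rightarrow> lc"
  assumes fin: "finite S" and disj: "disjoint_family_on (\<lambda>i. ivl_set (K i)) S"
    and le: "\<And>i. i \<in> S \<Longrightarrow> lower (K i) \<le> upper (K i)"
    and sub: "\<And>i. i \<in> S \<Longrightarrow> ivl_set (K i) \<subseteq> {A..B}" and AB: "A \<le> B"
    and mono: "\<And>x y. A \<le> x \<Longrightarrow> x \<le> y \<Longrightarrow> y \<le> B \<Longrightarrow> H x \<le> H y"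
  shows "(\<Sum>i\<in>S. H (upper (K i)) - H (lower (K i))) \<le> H B - H A"
proof -
  \<comment> \<open>Degenerate intervals contribute 0; they may be empty and located outside
    \<open>{A..B}\<close>, so they have no place in the ordering.\<close>
  define S' where "S' = {i \<in> S. lower (K i) < upper (K i)}"
  have bnd: "lower (K i) \<in> {A..B}" "upper (K i) \<in> {A..B}" if "i \<in> S'" for i
    using that ivl_bounds_in[OF _ sub] by (auto simp: S'_def)
  have "T \<subseteq> S' \<longrightarrow> (\<forall>z. z \<in> {A..B} \<longrightarrow> (\<forall>i\<in>T. upper (K i) \<le> z) \<longrightarrow>
      (\<Sum>i\<in>T. H (upper (K i)) - H (lower (K i))) \<le> H z - H A)" if "finite T" for T
    using that
  proof (induction T rule: finite_ranking_induct[where f = "\<lambda>i. upper (K i)"])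
    case empty
    then show ?case using mono by auto
  next
    case (insert x T)
    show ?case
    proof (intro impI allI)
      fix z assume T: "insert x T \<subseteq> S'" and z: "z \<in> {A..B}" "\<forall>i\<in>insert x T. upper (K i) \<le> z"
      have IH: "\<And>z. z \<in> {A..B} \<Longrightarrow> (\<forall>i\<in>T. upper (K i) \<le> z) \<Longrightarrow>
        (\<Sum>i\<in>T. H (upper (K i)) - H (lower (K i))) \<le> H z - H A" using insert.IH T by blast
      show "(\<Sum>i\<in>insert x T. H (upper (K i)) - H (lower (K i))) \<le> H z - H A"
      proof (cases "x \<in> T")
        case True
        then show ?thesis using IH z by (simp add: insert_absorb)
      next
        case False
        have xS: "x \<in> S'" using T by blast
        have "upper (K y) \<le> lower (K x)" if y: "y \<in> T" for y
        proof (rule ccontr)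
          assume n: "\<not> upper (K y) \<le> lower (K x)"
          have yS: "y \<in> S'" "y \<noteq> x" using y T False by auto
          have "max (lower (K x)) (lower (K y)) < upper (K y)" using n yS by (auto simp: S'_def)
          then obtain w where w: "max (lower (K x)) (lower (K y)) < w" "w < upper (K y)" using dense by blast
          moreover have "upper (K y) \<le> upper (K x)" using insert.hyps y by blast
          ultimately have "w \<in> ivl_set (K x)" "w \<in> ivl_set (K y)"
            using ivl_set_bounds(1)[of "K x"] ivl_set_bounds(1)[of "K y"] by auto
          then show False using disj yS xS unfolding disjoint_family_on_def S'_def by fastforce
        qed
        then have "(\<Sum>i\<in>T. H (upper (K i)) - H (lower (K i))) \<le> H (lower (K x)) - H A"
          using bnd[OF xS] by (intro IH) auto
        moreover have "H (upper (K x)) \<le> H z" using bnd[OF xS] z by (intro mono) auto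
        ultimately show ?thesis using False insert.hyps by (simp add: algebra_simps)
      qed
    qed
  qed
  then have "(\<Sum>i\<in>S'. H (upper (K i)) - H (lower (K i))) \<le> H B - H A"
    using fin bnd AB by (auto simp: S'_def)
  moreover have "(\<Sum>i\<in>S'. H (upper (K i)) - H (lower (K i))) = (\<Sum>i\<in>S. H (upper (K i)) - H (lower (K i)))"
    by (rule sum.mono_neutral_left[OF fin]) (use le in \<open>auto simp: S'_def less_le\<close>)
  ultimately show ?thesis by simp
qed

lemma sum_lengths_le:
  assumes "finite S" "disjoint_family_on (\<lambda>i. ivl_set (K i)) S"
    "\<And>i. i \<in> S \<Longrightarrow> lower (K i) \<le> upper (K i)" "\<And>i. i \<in> S \<Longrightarrow> ivl_set (K i) \<subseteq> {A..B}" "A \<le> B"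
  shows "(\<Sum>i\<in>S. ivl_length (K i)) \<le> B - A"
  using sum_increments_le[OF assms, of "\<lambda>x. x"] by (simp add: ivl_length_def)

text \<open>If the end points would come out in the wrong order, an empty interval with equal end
  points is taken instead: the end points stay ordered and the length is 0.\<close>

definition ivl_inter :: "lc_ivl \<Rightarrow> lc_ivl \<Rightarrow> lc_ivl" where
  "ivl_inter J K = (let l = max (lower J) (lower K); u = min (upper J) (upper K) in
     if l \<le> u then Ivl l u ((lower J < l \<or> left_closed J) \<and> (lower K < l \<or> left_closed K))
       ((u < upper J \<or> right_closed J) \<and> (u < upper K \<or> right_closed K))
     else Ivl l l False False)"

lemma ivl_inter_ordered: "lower (ivl_inter J K) \<le> upper (ivl_inter J K)"
  by (simp add: ivl_inter_def Let_def)

lemma ivl_length_inter: "ivl_length (ivl_inter J K) = max 0 (min (upper J) (upper K) - max (lower J) (lower K))"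
proof (cases "max (lower J) (lower K) \<le> min (upper J) (upper K)")
  case True
  then show ?thesis by (simp add: ivl_inter_def ivl_length_def Let_def max_absorb2 del: max.bounded_iff min.bounded_iff)
next
  case False
  then have "min (upper J) (upper K) - max (lower J) (lower K) \<le> 0" by linarith
  then show ?thesis using False by (simp add: ivl_inter_def ivl_length_def Let_def max_absorb1 del: max.bounded_iff min.bounded_iff)
qed

lemma ivl_set_inter: "ivl_set (ivl_inter J K) = ivl_set J \<inter> ivl_set K"
proof (cases "max (lower J) (lower K) \<le> min (upper J) (upper K)")
  case True
  have L: "(if (lower J < max (lower J) (lower K) \<or> left_closed J) \<and> (lower K < max (lower J) (lower K) \<or> left_closed K)
      then max (lower J) (lower K) \<le> x else max (lower J) (lower K) < x) \<longleftrightarrow>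
    (if left_closed J then lower J \<le> x else lower J < x) \<and> (if left_closed K then lower K \<le> x else lower K < x)" for x
    by (auto simp: max_def)
  have U: "(if (min (upper J) (upper K) < upper J \<or> right_closed J) \<and> (min (upper J) (upper K) < upper K \<or> right_closed K)
      then x \<le> min (upper J) (upper K) else x < min (upper J) (upper K)) \<longleftrightarrow>
    (if right_closed J then x \<le> upper J else x < upper J) \<and> (if right_closed K then x \<le> upper K else x < upper K)" for x
    by (auto simp: min_def)
  have "ivl_set (ivl_inter J K) = {x.
    (if (lower J < max (lower J) (lower K) \<or> left_closed J) \<and> (lower K < max (lower J) (lower K) \<or> left_closed K)
      then max (lower J) (lower K) \<le> x else max (lower J) (lower K) < x) \<and>
    (if (min (upper J) (upper K) < upper J \<or> right_closed J) \<and> (min (upper J) (upper K) < upper K \<or> right_closed K)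
      then x \<le> min (upper J) (upper K) else x < min (upper J) (upper K))}"
    using True by (simp add: ivl_inter_def Let_def ivl_set_def)
  also have "\<dots> = ivl_set J \<inter> ivl_set K" unfolding L U ivl_set_def by blast
  finally show ?thesis .
next
  case False
  have "ivl_set (ivl_inter J K) = {}" using False by (auto simp: ivl_inter_def Let_def ivl_set_def)
  moreover have "ivl_set J \<inter> ivl_set K = {}"
  proof -
    have "x \<in> {lower J..upper J} \<Longrightarrow> x \<in> {lower K..upper K} \<Longrightarrow> False" for x using False by auto
    then show ?thesis using ivl_set_bounds(2)[of J] ivl_set_bounds(2)[of K] by blast
  qed
  ultimately show ?thesis by simp
qed

lemma ivl_set_empty_degenerate: "ivl_set (Ivl l l False False) = {}"
  by (auto simp: ivl_set_def)

lemma simple_integral_subintervals: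
  assumes "simple_on f (ivl_set J)" "lower J \<le> upper J"
  obtains F M where "0 < M"
    "\<And>x x'. x \<in> {lower J..upper J} \<Longrightarrow> x' \<in> {lower J..upper J} \<Longrightarrow> \<bar>F x - F x'\<bar> \<le> M * \<bar>x - x'\<bar>"
    "\<And>K. lower K \<le> upper K \<Longrightarrow> ivl_set K \<subseteq> ivl_set J \<Longrightarrow> ivl_integral f K = F (upper K) - F (lower K)"
proof (cases "lower J < upper J")
  case True
  obtain F M where M: "0 < M"
    "\<And>x x'. x \<in> {lower J..upper J} \<Longrightarrow> x' \<in> {lower J..upper J} \<Longrightarrow> \<bar>F x - F x'\<bar> \<le> M * \<bar>x - x'\<bar>"
    and F: "\<And>K. lower K \<le> upper K \<Longrightarrow> lower K \<in> {lower J..upper J} \<Longrightarrow> upper K \<in> {lower J..upper J} \<Longrightarrow>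
      ivl_set K \<subseteq> ivl_set J \<Longrightarrow> ivl_integral f K = F (upper K) - F (lower K)"
    using simple_integral_increments[OF assms(1) True] by metis
  show thesis
  proof (rule that[OF M])
    fix K assume K: "lower K \<le> upper K" "ivl_set K \<subseteq> ivl_set J"
    show "ivl_integral f K = F (upper K) - F (lower K)"
    proof (cases "lower K < upper K")
      case True
      have "ivl_set K \<subseteq> {lower J..upper J}" using K(2) ivl_set_bounds(2)[of J] by blast
      then show ?thesis using F[OF K(1) _ _ K(2)] ivl_bounds_in[OF True] by blast
    next
      case False
      then show ?thesis using K(1) by (simp add: ivl_integral_def)
    qed
  qed
next
  case False
  have deg: "\<not> lower K < upper K" if "ivl_set K \<subseteq> ivl_set J" for K
  proof
    assume l: "lower K < upper K"
    have "ivl_set K \<subseteq> {lower J..upper J}" using that ivl_set_bounds(2)[of J] by blast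
    from ivl_bounds_in[OF l this] show False using l False by auto
  qed
  show thesis
    by (rule that[of 1 "\<lambda>x. 0"]) (use deg in \<open>auto simp: ivl_integral_def\<close>)
qed

text \<open>With a Lipschitz constant \<open>M\<close> of the antiderivative \<open>F\<close>, both
  \<open>M * x - F x\<close> and \<open>M * x + F x\<close> are increasing, and increments of an
  increasing function over disjoint subintervals never exceed the total. The missing integral is
  thus at most \<open>M\<close> times the missing length, however the gaps are distributed.\<close>

lemma ivl_integral_approx:
  assumes "simple_on f (ivl_set J)" "lower J \<le> upper J"
  shows "\<exists>M>0. \<forall>(S :: 'i set) K. finite S \<longrightarrow> disjoint_family_on (\<lambda>i. ivl_set (K i)) S \<longrightarrow>
      (\<forall>i\<in>S. lower (K i) \<le> upper (K i)) \<longrightarrow> (\<forall>i\<in>S. ivl_set (K i) \<subseteq> ivl_set J) \<longrightarrow>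
      \<bar>ivl_integral f J - (\<Sum>i\<in>S. ivl_integral f (K i))\<bar> \<le> M * (ivl_length J - (\<Sum>i\<in>S. ivl_length (K i)))"
proof -
  obtain F M where M: "0 < M"
    "\<And>x x'. x \<in> {lower J..upper J} \<Longrightarrow> x' \<in> {lower J..upper J} \<Longrightarrow> \<bar>F x - F x'\<bar> \<le> M * \<bar>x - x'\<bar>"
    and F: "\<And>K. lower K \<le> upper K \<Longrightarrow> ivl_set K \<subseteq> ivl_set J \<Longrightarrow> ivl_integral f K = F (upper K) - F (lower K)"
    using simple_integral_subintervals[OF assms] by metis
  show ?thesis
  proof (intro exI[of _ M] conjI M(1) allI impI)
    fix S :: "'i set" and K
    assume S': "finite S" "disjoint_family_on (\<lambda>i. ivl_set (K i)) S"
      "\<forall>i\<in>S. lower (K i) \<le> upper (K i)" and sub'': "\<forall>i\<in>S. ivl_set (K i) \<subseteq> ivl_set J"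
    note S = S'(1,2) S'(3)[rule_format] and sub = sub''[rule_format]
    have sub': "\<And>i. i \<in> S \<Longrightarrow> ivl_set (K i) \<subseteq> {lower J..upper J}" using sub ivl_set_bounds(2)[of J] by blast
    have step: "M * x - F x \<le> M * y - F y" "M * x + F x \<le> M * y + F y"
      if "lower J \<le> x" "x \<le> y" "y \<le> upper J" for x y
    proof -
      have "\<bar>F x - F y\<bar> \<le> M * \<bar>x - y\<bar>" by (rule M(2)) (use that in auto)
      also have "\<dots> = M * y - M * x" using that by (simp add: right_diff_distrib)
      finally show "M * x - F x \<le> M * y - F y" "M * x + F x \<le> M * y + F y" by (auto simp: abs_le_iff)
    qed
    have "(\<Sum>i\<in>S. M * upper (K i) - F (upper (K i)) - (M * lower (K i) - F (lower (K i)))) \<le>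
      M * upper J - F (upper J) - (M * lower J - F (lower J))"
      by (rule sum_increments_le[OF S sub' assms(2), of "\<lambda>x. M * x - F x"]) (use step in auto)
    moreover have "(\<Sum>i\<in>S. M * upper (K i) + F (upper (K i)) - (M * lower (K i) + F (lower (K i)))) \<le>
      M * upper J + F (upper J) - (M * lower J + F (lower J))"
      by (rule sum_increments_le[OF S sub' assms(2), of "\<lambda>x. M * x + F x"]) (use step in auto)
    moreover have "(\<Sum>i\<in>S. ivl_integral f (K i)) = (\<Sum>i\<in>S. F (upper (K i)) - F (lower (K i)))"
      by (rule sum.cong) (use F S(3) sub in auto)
    moreover have "ivl_integral f J = F (upper J) - F (lower J)" by (rule F) (use assms in auto)
    ultimately show "\<bar>ivl_integral f J - (\<Sum>i\<in>S. ivl_integral f (K i))\<bar> \<le> M * (ivl_length J - (\<Sum>i\<in>S. ivl_length (K i)))"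
      by (simp add: ivl_length_def sum_subtractf sum.distrib sum_distrib_left[symmetric] right_diff_distrib abs_le_iff algebra_simps)
  qed
qed

text \<open>The combination of the antiderivatives is increasing, because its increments are
  integrals of a nonnegative combination; over disjoint subintervals they add up to at most the
  total.\<close>

lemma ivl_integral_combination_mono:
  assumes f: "simple_on f (ivl_set J)" and g: "simple_on g (ivl_set J)" and J: "lower J \<le> upper J"
    and nonneg: "\<And>x. x \<in> ivl_set J \<Longrightarrow> 0 \<le> \<alpha> * f x + \<beta> * g x"
    and S: "finite S" "disjoint_family_on (\<lambda>i. ivl_set (K i)) S"
      "\<And>i. i \<in> S \<Longrightarrow> lower (K i) \<le> upper (K i)" and sub: "\<And>i. i \<in> S \<Longrightarrow> ivl_set (K i) \<subseteq> ivl_set J"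
  shows "(\<Sum>i\<in>S. \<alpha> * ivl_integral f (K i) + \<beta> * ivl_integral g (K i)) \<le> \<alpha> * ivl_integral f J + \<beta> * ivl_integral g J"
proof -
  obtain F where F: "\<And>K. lower K \<le> upper K \<Longrightarrow> ivl_set K \<subseteq> ivl_set J \<Longrightarrow> ivl_integral f K = F (upper K) - F (lower K)"
    by (rule simple_integral_subintervals[OF f J]) (rule that)
  obtain G where G: "\<And>K. lower K \<le> upper K \<Longrightarrow> ivl_set K \<subseteq> ivl_set J \<Longrightarrow> ivl_integral g K = G (upper K) - G (lower K)"
    by (rule simple_integral_subintervals[OF g J]) (rule that)
  have sub': "\<And>i. i \<in> S \<Longrightarrow> ivl_set (K i) \<subseteq> {lower J..upper J}" using sub ivl_set_bounds(2)[of J] by blast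
  have step: "\<alpha> * F x + \<beta> * G x \<le> \<alpha> * F y + \<beta> * G y" if "lower J \<le> x" "x \<le> y" "y \<le> upper J" for x y
  proof -
    define L where "L = Ivl x y False False"
    have L: "lower L = x" "upper L = y" by (auto simp: L_def)
    have sL: "ivl_set L \<subseteq> ivl_set J"
      using that ivl_set_bounds(1)[of J] by (auto simp: L_def ivl_set_def)
    have "0 \<le> \<alpha> * ivl_integral f L + \<beta> * ivl_integral g L"
      by (rule ivl_integral_combination_nonneg[OF simple_on_subset[OF f sL] simple_on_subset[OF g sL]])
        (use nonneg sL in blast)
    then show ?thesis using F[OF _ sL] G[OF _ sL] that L by (simp add: algebra_simps)
  qed
  have "(\<Sum>i\<in>S. \<alpha> * F (upper (K i)) + \<beta> * G (upper (K i)) - (\<alpha> * F (lower (K i)) + \<beta> * G (lower (K i)))) \<le>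
    \<alpha> * F (upper J) + \<beta> * G (upper J) - (\<alpha> * F (lower J) + \<beta> * G (lower J))"
    by (rule sum_increments_le[OF S sub' J, of "\<lambda>x. \<alpha> * F x + \<beta> * G x"]) (use step in auto)
  moreover have "(\<Sum>i\<in>S. \<alpha> * ivl_integral f (K i) + \<beta> * ivl_integral g (K i)) =
    (\<Sum>i\<in>S. \<alpha> * F (upper (K i)) + \<beta> * G (upper (K i)) - (\<alpha> * F (lower (K i)) + \<beta> * G (lower (K i))))"
  proof (rule sum.cong[OF refl])
    fix i assume i: "i \<in> S"
    show "\<alpha> * ivl_integral f (K i) + \<beta> * ivl_integral g (K i) =
      \<alpha> * F (upper (K i)) + \<beta> * G (upper (K i)) - (\<alpha> * F (lower (K i)) + \<beta> * G (lower (K i)))"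
      unfolding F[OF S(3)[OF i] sub[OF i]] G[OF S(3)[OF i] sub[OF i]] by (simp add: algebra_simps)
  qed
  moreover have "\<alpha> * ivl_integral f J + \<beta> * ivl_integral g J =
    \<alpha> * F (upper J) + \<beta> * G (upper J) - (\<alpha> * F (lower J) + \<beta> * G (lower J))"
    unfolding F[OF J order_refl] G[OF J order_refl] by (simp add: algebra_simps)
  ultimately show ?thesis by presburger
qed

section \<open>The measure of an interval\<close>

lemma strong_lim_upper:
  assumes "strong_lim X l" "\<And>n. X n \<le> c"
  shows "l \<le> c"
proof (rule ccontr)
  assume "\<not> l \<le> c"
  then have "\<forall>\<^sub>F n in sequentially. \<bar>X n - l\<bar> < l - c" using assms(1) by (auto simp: strong_lim_def)
  then obtain n where "\<bar>X n - l\<bar> < l - c" by (auto simp: eventually_sequentially)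
  then show False using assms(2)[of n] by (auto simp: abs_if split: if_splits)
qed

lemma strong_lim_lower:
  assumes "strong_lim X l" "\<And>n. n \<ge> N \<Longrightarrow> c \<le> X n"
  shows "c \<le> l"
proof (rule ccontr)
  assume "\<not> c \<le> l"
  then have "\<forall>\<^sub>F n in sequentially. \<bar>X n - l\<bar> < c - l" using assms(1) by (auto simp: strong_lim_def)
  then obtain n where "n \<ge> N" "\<bar>X n - l\<bar> < c - l"
    unfolding eventually_sequentially by (metis max.cobounded1 max.cobounded2)
  then show False using assms(2)[of n] by (auto simp: abs_if split: if_splits)
qed

lemma strong_sums_partial_le:
  assumes "strong_sums X s" "\<And>n. 0 \<le> X n"
  shows "(\<Sum>k\<le>N. X k) \<le> s"
  by (rule strong_lim_lower[OF assms(1)[unfolded strong_sums_def], of N]) (intro sum_mono2, use assms(2) in auto)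

lemma strong_sums_finite:
  assumes "\<And>n. n > N \<Longrightarrow> X n = 0"
  shows "strong_sums X (\<Sum>k\<le>N. X k)"
proof -
  have "(\<Sum>k\<le>n. X k) = (\<Sum>k\<le>N. X k)" if "n \<ge> N" for n
    by (rule sum.mono_neutral_right) (use that assms in auto)
  then show ?thesis unfolding strong_sums_def strong_lim_iff eventually_sequentially
    by (metis diff_self ord_ge_zero)
qed

lemma clip_split:
  fixes lo hi z1 z2 p q :: lc
  assumes "lo \<le> hi" "z1 \<le> p" "p \<le> q" "q \<le> z2"
  shows "max 0 (min hi p - max lo z1) + max 0 (min hi z2 - max lo q) \<le> max 0 (min hi z2 - max lo z1)"
  using assms by (auto simp: max_def min_def)

text \<open>Removing an interval leaves a left and a right remainder, one of which keeps at least
  half of the excess \<open>e\<close>; hence the factor \<open>2 ^ n\<close>. Lengths are clipped to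
  the window because the intervals may stick out of it.\<close>

lemma gap_exists:
  assumes ord: "\<And>k. lower (J k) \<le> upper (J k)"
    and "z1 \<le> z2" "0 < e" "e \<le> z2 - z1 - (\<Sum>k<n. max 0 (min (upper (J k)) z2 - max (lower (J k)) z1))"
  shows "\<exists>g0 g1. z1 \<le> g0 \<and> g0 < g1 \<and> g1 \<le> z2 \<and> (\<forall>k<n. \<forall>x. g0 < x \<longrightarrow> x < g1 \<longrightarrow> x \<notin> ivl_set (J k)) \<and>
    e / 2 ^ n \<le> g1 - (g0::lc)"
  using assms(2-4)
proof (induction n arbitrary: z1 z2 e)
  case 0
  then show ?case by (intro exI[of _ z1] exI[of _ z2]) auto
next
  case (Suc n)
  define cl where "cl k a b = max 0 (min (upper (J k)) b - max (lower (J k)) a)" for k a b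
  define p where "p = min z2 (max z1 (lower (J n)))"
  define q where "q = max z1 (min z2 (upper (J n)))"
  have pq: "z1 \<le> p" "p \<le> q" "q \<le> z2" using ord[of n] Suc.prems(1) by (auto simp: p_def q_def max_def min_def)
  have "q - p \<le> cl n z1 z2"
    using ord[of n] Suc.prems(1) by (auto simp: p_def q_def cl_def max_def min_def)
  moreover have "(\<Sum>k<n. cl k z1 p) + (\<Sum>k<n. cl k q z2) \<le> (\<Sum>k<n. cl k z1 z2)"
    unfolding sum.distrib[symmetric] cl_def by (intro sum_mono clip_split ord pq)
  ultimately have "e \<le> (p - z1 - (\<Sum>k<n. cl k z1 p)) + (z2 - q - (\<Sum>k<n. cl k q z2))"
    using Suc.prems(3) unfolding cl_def[symmetric] by simp
  then consider "e / 2 \<le> p - z1 - (\<Sum>k<n. cl k z1 p)" | "e / 2 \<le> z2 - q - (\<Sum>k<n. cl k q z2)"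
    by linarith
  then show ?case
  proof cases
    case 1
    obtain g0 g1 where g: "z1 \<le> g0" "g0 < g1" "g1 \<le> p"
      "\<forall>k<n. \<forall>x. g0 < x \<longrightarrow> x < g1 \<longrightarrow> x \<notin> ivl_set (J k)" "e / 2 / 2 ^ n \<le> g1 - g0"
      using Suc.IH[OF pq(1) _ 1[unfolded cl_def]] Suc.prems(2) by auto
    have "x \<notin> ivl_set (J n)" if "g0 < x" "x < g1" for x
    proof -
      have "x < lower (J n)" using that g by (auto simp: p_def)
      then show ?thesis using ivl_set_bounds(2)[of "J n"] by auto
    qed
    then show ?thesis using g pq by (intro exI[of _ g0] exI[of _ g1]) (auto simp: less_Suc_eq)
  next
    case 2
    obtain g0 g1 where g: "q \<le> g0" "g0 < g1" "g1 \<le> z2"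
      "\<forall>k<n. \<forall>x. g0 < x \<longrightarrow> x < g1 \<longrightarrow> x \<notin> ivl_set (J k)" "e / 2 / 2 ^ n \<le> g1 - g0"
      using Suc.IH[OF pq(3) _ 2[unfolded cl_def]] Suc.prems(2) by auto
    have "x \<notin> ivl_set (J n)" if "g0 < x" "x < g1" for x
    proof -
      have "upper (J n) < x" using that g by (auto simp: q_def)
      then show ?thesis using ivl_set_bounds(2)[of "J n"] by auto
    qed
    then show ?thesis using g pq by (intro exI[of _ g0] exI[of _ g1]) (auto simp: less_Suc_eq)
  qed
qed

text \<open>
  All but finitely many intervals of the cover are infinitesimally short compared to the gap, so
  each of them contains at most one of the uncountably many points dividing the gap in a real ratio.
\<close>

lemma outer_sum_ge:
  assumes ord: "\<And>k. lower (J k) \<le> upper (J k)" and cover: "{A..B} \<subseteq> (\<Union>k. ivl_set (J k))"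
    and sums: "strong_sums (\<lambda>k. ivl_length (J k)) t" and AB: "A \<le> B"
  shows "B - A \<le> t"
proof (rule ccontr)
  assume "\<not> B - A \<le> t"
  define e where "e = B - A - t"
  have e: "0 < e" using \<open>\<not> B - A \<le> t\<close> by (simp add: e_def)
  \<comment> \<open>From \<open>N\<close> on, the lengths are infinitesimal relative to
    \<open>e\<close>.\<close>
  obtain N where N: "\<And>k. k \<ge> N \<Longrightarrow> ord_ge (lc_lead e + 1) (ivl_length (J k))"
    using strong_sums_terms[OF sums] unfolding eventually_sequentially by blast
  have "(\<Sum>k<N. max 0 (min (upper (J k)) B - max (lower (J k)) A)) \<le> (\<Sum>k<N. ivl_length (J k))"
    by (intro sum_mono) (use ord in \<open>auto simp: ivl_length_def max_def min_def\<close>)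
  also have "\<dots> \<le> (\<Sum>k\<le>N. ivl_length (J k))"
    by (intro sum_mono2) (use ord in \<open>auto simp: ivl_length_def\<close>)
  also have "\<dots> \<le> t" by (rule strong_sums_partial_le[OF sums]) (use ord in \<open>simp add: ivl_length_def\<close>)
  finally have "e \<le> B - A - (\<Sum>k<N. max 0 (min (upper (J k)) B - max (lower (J k)) A))" by (simp add: e_def)
  from gap_exists[of J, OF ord AB e this]
  obtain g0 g1 where g: "A \<le> g0" "g0 < g1" "g1 \<le> B"
    "\<And>k x. k < N \<Longrightarrow> g0 < x \<Longrightarrow> x < g1 \<Longrightarrow> x \<notin> ivl_set (J k)" "e / 2 ^ N \<le> g1 - g0" by blast
  define x where "x s = g0 + of_real s * (g1 - g0)" for s
  have inj: "inj_on (\<lambda>s. SOME k. x s \<in> ivl_set (J k)) {0<..<1}"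
  proof (rule inj_onI, rule ccontr)
    fix s s' assume s: "s \<in> {0<..<1}" "s' \<in> {0<..<1}" "s \<noteq> s'"
      and eq: "(SOME k. x s \<in> ivl_set (J k)) = (SOME k. x s' \<in> ivl_set (J k))"
    define k where "k = (SOME k. x s \<in> ivl_set (J k))"
    have xin: "g0 < x s \<and> x s < g1" if "s \<in> {0<..<1}" for s
      using segment_inside[OF g(2), of s] that by (simp add: x_def)
    have in_k: "x s \<in> ivl_set (J (SOME k. x s \<in> ivl_set (J k)))" if "s \<in> {0<..<1}" for s
    proof (rule someI_ex)
      have "x s \<in> {A..B}" using xin[OF that] g by auto
      then show "\<exists>k. x s \<in> ivl_set (J k)" using cover by blast
    qed
    have k: "x s \<in> ivl_set (J k)" using in_k[OF s(1)] by (simp only: k_def)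
    have k': "x s' \<in> ivl_set (J k)" using in_k[OF s(2)] unfolding k_def eq .
    have kN: "k \<ge> N" using k g(4)[of k "x s"] xin[OF s(1)] by (meson not_le)
    \<comment> \<open>A nonzero real, so \<open>r * e\<close> has the order of \<open>e\<close>
      itself, too large for an interval with index at least \<open>N\<close>.\<close>
    define r where "r = \<bar>s - s'\<bar> / 2 ^ N"
    have r: "r \<noteq> 0" using s by (simp add: r_def)
    have "x s \<in> {lower (J k)..upper (J k)}" "x s' \<in> {lower (J k)..upper (J k)}"
      using k k' ivl_set_bounds(2)[of "J k"] by blast+
    then have "\<bar>x s - x s'\<bar> \<le> ivl_length (J k)" unfolding ivl_length_def atLeastAtMost_iff by linarith
    moreover have "\<bar>x s - x s'\<bar> = of_real \<bar>s - s'\<bar> * (g1 - g0)"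
      using g(2) by (simp add: x_def left_diff_distrib[symmetric] abs_mult of_real_diff[symmetric] del: of_real_diff)
    moreover have "of_real \<bar>s - s'\<bar> * (e / 2 ^ N) \<le> of_real \<bar>s - s'\<bar> * (g1 - g0)"
      by (intro mult_left_mono g(5)) simp
    moreover have "of_real \<bar>s - s'\<bar> * (e / 2 ^ N) = of_real r * e" by (simp add: r_def)
    ultimately have "of_real r * e \<le> ivl_length (J k)" by simp
    moreover have "0 \<le> of_real r * e" using e by (simp add: r_def)
    ultimately have "ord_ge (lc_lead e + 1) (of_real r * e)" using ord_ge_of_abs_le[OF _ N[OF kN]] by simp
    then have "lc_coeff (of_real r * e) (lc_lead e) = 0" by (rule ord_geD) simp
    then show False using r e lc_lead_props(1)[of e] by simp
  qed
  then have "countable {0<..<1::real}" unfolding countable_def by blast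
  then show False using uncountable_open_interval[of "0::real" 1] by simp
qed

text \<open>Families are indexed by all natural numbers; a single interval is padded with empty
  ones.\<close>

definition single_ivl :: "lc_ivl \<Rightarrow> nat \<Rightarrow> lc_ivl" where
  "single_ivl J n = (if n = 0 then J else Ivl 0 0 False False)"

lemma single_ivl:
  assumes "lower J \<le> upper J"
  shows "disjoint_ivls (single_ivl J)" "(\<Union>n. ivl_set (single_ivl J n)) = ivl_set J"
    "strong_sums (\<lambda>n. ivl_length (single_ivl J n)) (ivl_length J)"
proof -
  show "disjoint_ivls (single_ivl J)"
    using assms by (auto simp: disjoint_ivls_def single_ivl_def disjoint_family_on_def ivl_set_empty_degenerate)
  show "(\<Union>n. ivl_set (single_ivl J n)) = ivl_set J"
  proof -
    have "ivl_set (single_ivl J n) = (if n = 0 then ivl_set J else {})" for n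
      by (simp add: single_ivl_def ivl_set_empty_degenerate)
    then show ?thesis by auto
  qed
  show "strong_sums (\<lambda>n. ivl_length (single_ivl J n)) (ivl_length J)"
    using strong_sums_finite[of 0 "\<lambda>n. ivl_length (single_ivl J n)"] by (simp add: single_ivl_def ivl_length_def)
qed

lemma inner_sum_le:
  assumes "disjoint_ivls I" "(\<Union>n. ivl_set (I n)) \<subseteq> {A..B}" "strong_sums (\<lambda>n. ivl_length (I n)) s" "A \<le> B"
  shows "s \<le> B - A"
proof (rule strong_lim_upper[OF assms(3)[unfolded strong_sums_def]])
  fix n
  show "(\<Sum>k\<le>n. ivl_length (I k)) \<le> B - A"
    by (rule sum_lengths_le) (use assms in \<open>auto simp: disjoint_ivls_def disjoint_family_on_def\<close>)
qed

lemma lc_measure_interval: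
  assumes "A \<le> B"
  shows "lc_measure {A..B} = B - A"
proof -
  define J where "J = Ivl A B True True"
  have J: "lower J \<le> upper J" "ivl_set J = {A..B}" "ivl_length J = B - A"
    using assms by (auto simp: J_def ivl_set_def ivl_length_def)
  note single = single_ivl[OF J(1), unfolded J(2,3)]
  have "B - A \<in> inner_sums {A..B}" "B - A \<in> outer_sums {A..B}"
    unfolding inner_sums_def outer_sums_def using single by blast+
  moreover have "\<forall>s\<in>inner_sums {A..B}. s \<le> B - A"
    unfolding inner_sums_def using inner_sum_le assms by blast
  moreover have "\<forall>t\<in>outer_sums {A..B}. B - A \<le> t"
    unfolding outer_sums_def using outer_sum_ge assms by (auto simp: disjoint_ivls_def)
  ultimately show ?thesis unfolding lc_measure_def
    by (intro the_equality) (auto intro: antisym)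
qed

section \<open>Integrability of dominated functions\<close>

lemma strong_lim_cmult:
  assumes "strong_lim X l"
  shows "strong_lim (\<lambda>n. c * X n) (c * l)"
  unfolding strong_lim_iff
proof
  fix m
  obtain n where n: "ord_ge n c" using ord_ge_ex by blast
  have "\<forall>\<^sub>F k in sequentially. ord_ge (m - n) (X k - l)" using assms unfolding strong_lim_iff by blast
  then show "\<forall>\<^sub>F k in sequentially. ord_ge m (c * X k - c * l)"
    by eventually_elim (unfold right_diff_distrib[symmetric], rule ord_ge_mult2[OF n], auto)
qed

lemma strong_lim_diff:
  assumes "strong_lim X l" "strong_lim Y k"
  shows "strong_lim (\<lambda>n. X n - Y n) (l - k)"
  unfolding strong_lim_iff
proof
  fix m
  have "\<forall>\<^sub>F n in sequentially. ord_ge m (X n - l)" "\<forall>\<^sub>F n in sequentially. ord_ge m (Y n - k)"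
    using assms unfolding strong_lim_iff by blast+
  then show "\<forall>\<^sub>F n in sequentially. ord_ge m (X n - Y n - (l - k))"
  proof eventually_elim
    case (elim n)
    then show ?case using ord_ge_diff[OF elim] by (simp add: algebra_simps)
  qed
qed

section \<open>Lengths left uncovered by a family\<close>

lemma ivl_length_nonneg: "lower J \<le> upper J \<Longrightarrow> 0 \<le> ivl_length J"
  by (simp add: ivl_length_def)

lemma clip_cover:
  fixes A B l u p q :: lc
  assumes "A \<le> l" "l \<le> u" "u \<le> B" "A \<le> p" "p \<le> q" "q \<le> B"
  shows "u - l \<le> max 0 (min p u - max A l) + max 0 (min q u - max p l) + max 0 (min B u - max q l)"
  using assms by (auto simp: max_def min_def)

lemma length_le_split:
  assumes K: "lower K \<le> upper K" "ivl_set K \<subseteq> {A..B}" and D: "A \<le> lower D" "lower D \<le> upper D" "upper D \<le> B"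
    and L: "lower L = A" "upper L = lower D" and R: "lower R = upper D" "upper R = B"
  shows "ivl_length K \<le> ivl_length (ivl_inter L K) + ivl_length (ivl_inter D K) + ivl_length (ivl_inter R K)"
proof (cases "lower K < upper K")
  case True
  have "A \<le> lower K" "upper K \<le> B" using ivl_bounds_in[OF True K(2)] by auto
  then show ?thesis unfolding ivl_length_inter L R ivl_length_def[of K]
    by (intro clip_cover K D)
next
  case False
  then have "ivl_length K = 0" using K by (simp add: ivl_length_def)
  then show ?thesis by (simp add: ivl_length_nonneg[OF ivl_inter_ordered])
qed

lemma disjoint_inter:
  "disjoint_family_on (\<lambda>i. ivl_set (K i)) S \<Longrightarrow> disjoint_family_on (\<lambda>i. ivl_set (ivl_inter J (K i))) S"
  unfolding disjoint_family_on_def ivl_set_inter by blast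

text \<open>Outside \<open>D\<close> the family covers at most the lengths to the left and to the
  right of \<open>D\<close>, so whatever it misses inside \<open>D\<close> it misses in
  \<open>{A..B}\<close>.\<close>

lemma missing_in_subinterval:
  assumes fin: "finite S" and disj: "disjoint_family_on (\<lambda>i. ivl_set (K i)) S"
    and ord: "\<And>i. i \<in> S \<Longrightarrow> lower (K i) \<le> upper (K i)" and sub: "\<And>i. i \<in> S \<Longrightarrow> ivl_set (K i) \<subseteq> {A..B}"
    and AB: "A \<le> B" and D: "lower D \<le> upper D" "ivl_set D \<subseteq> {A..B}"
  shows "ivl_length D - (\<Sum>i\<in>S. ivl_length (ivl_inter D (K i))) \<le> B - A - (\<Sum>i\<in>S. ivl_length (K i))"
proof (cases "lower D < upper D")
  case True
  have b: "A \<le> lower D" "upper D \<le> B" using ivl_bounds_in[OF True D(2)] by auto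
  define L where "L = Ivl A (lower D) True True"
  define R where "R = Ivl (upper D) B True True"
  have "(\<Sum>i\<in>S. ivl_length (K i)) \<le>
    (\<Sum>i\<in>S. ivl_length (ivl_inter L (K i)) + ivl_length (ivl_inter D (K i)) + ivl_length (ivl_inter R (K i)))"
    by (intro sum_mono length_le_split[where A = A and B = B] ord sub b D) (auto simp: L_def R_def)
  moreover have "(\<Sum>i\<in>S. ivl_length (ivl_inter L (K i))) \<le> lower D - A"
    by (rule sum_lengths_le[OF fin disjoint_inter[OF disj] ivl_inter_ordered _ b(1)])
      (use ivl_set_bounds(2)[of L] in \<open>auto simp: ivl_set_inter L_def\<close>)
  moreover have "(\<Sum>i\<in>S. ivl_length (ivl_inter R (K i))) \<le> B - upper D"
    by (rule sum_lengths_le[OF fin disjoint_inter[OF disj] ivl_inter_ordered _ b(2)])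
      (use ivl_set_bounds(2)[of R] in \<open>auto simp: ivl_set_inter R_def\<close>)
  ultimately show ?thesis by (simp add: sum.distrib ivl_length_def[of D])
next
  case False
  then have "ivl_length D = 0" using D by (simp add: ivl_length_def)
  moreover have "0 \<le> (\<Sum>i\<in>S. ivl_length (ivl_inter D (K i)))"
    by (intro sum_nonneg ivl_length_nonneg ivl_inter_ordered)
  moreover have "(\<Sum>i\<in>S. ivl_length (K i)) \<le> B - A" by (rule sum_lengths_le[OF fin disj ord sub AB])
  ultimately show ?thesis by simp
qed

lemma lc_has_integral_unique:
  assumes "lc_has_integral f v S" "lc_has_integral f v' S"
  shows "v = v'"
proof (rule ccontr)
  assume "v \<noteq> v'"
  define e where "e = \<bar>v - v'\<bar> / 2"
  have e: "0 < e" using \<open>v \<noteq> v'\<close> by (simp add: e_def)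
  obtain d where d: "0 < d" "\<And>I s. simple_cover f S I s \<Longrightarrow> lc_measure S - s < d \<Longrightarrow>
      \<exists>w. strong_sums (\<lambda>n. ivl_integral f (I n)) w \<and> \<bar>w - v\<bar> < e"
    using assms(1) e unfolding lc_has_integral_def by blast
  obtain d' where d': "0 < d'" "\<And>I s. simple_cover f S I s \<Longrightarrow> lc_measure S - s < d' \<Longrightarrow>
      \<exists>w. strong_sums (\<lambda>n. ivl_integral f (I n)) w \<and> \<bar>w - v'\<bar> < e"
    using assms(2) e unfolding lc_has_integral_def by blast
  \<comment> \<open>Measurability supplies a cover fine enough for both values; without one, the two
    conditions could hold vacuously.\<close>
  have "0 < min d d'" using d d' by simp
  then obtain I s where I: "simple_cover f S I s" "lc_measure S - s < min d d'"
    using assms(1) unfolding lc_has_integral_def measurable_funs_def by blast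
  obtain w where w: "strong_sums (\<lambda>n. ivl_integral f (I n)) w" "\<bar>w - v\<bar> < e" using d(2)[OF I(1)] I(2) by auto
  obtain w' where w': "strong_sums (\<lambda>n. ivl_integral f (I n)) w'" "\<bar>w' - v'\<bar> < e" using d'(2)[OF I(1)] I(2) by auto
  have "w = w'" using w(1) w'(1) strong_lim_unique unfolding strong_sums_def by blast
  then have "\<bar>v - v'\<bar> < e + e" using w(2) w'(2) by linarith
  then show False by (simp add: e_def)
qed

lemma lc_integral_eqI: "lc_has_integral f v S \<Longrightarrow> lc_integral S f = v"
  unfolding lc_integral_def using lc_has_integral_unique by blast

text \<open>\<open>bound\<close> also forces \<open>g\<close> to be nonnegative.
  \<open>simple_G\<close> passes from \<open>g\<close> to \<open>G\<close> only, which is what holds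
  for a product with a polynomial.\<close>

locale dominated_integrand =
  fixes A B C v :: lc and g G :: "lc \<Rightarrow> lc"
  assumes AB: "A < B" and int_g: "lc_has_integral g v {A..B}" and C: "0 < C"
    and bound: "\<And>x. x \<in> {A..B} \<Longrightarrow> \<bar>G x\<bar> \<le> C * g x"
    and simple_G: "\<And>K. ivl_set K \<subseteq> {A..B} \<Longrightarrow> simple_on g (ivl_set K) \<Longrightarrow> simple_on G (ivl_set K)"
begin

text \<open>Finite families with a free index type, so that a common refinement can be indexed by
  pairs.\<close>

definition gfam :: "'i set \<Rightarrow> ('i \<Rightarrow> lc_ivl) \<Rightarrow> bool" where
  "gfam S K \<longleftrightarrow> finite S \<and> disjoint_family_on (\<lambda>i. ivl_set (K i)) S \<and>
    (\<forall>i\<in>S. lower (K i) \<le> upper (K i) \<and> ivl_set (K i) \<subseteq> {A..B} \<and> simple_on g (ivl_set (K i)))"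

lemma measure_AB: "lc_measure {A..B} = B - A"
  using AB by (simp add: lc_measure_interval)

lemma int_G_le:
  assumes "ivl_set K \<subseteq> {A..B}" "simple_on g (ivl_set K)"
  shows "\<bar>ivl_integral G K\<bar> \<le> C * ivl_integral g K"
proof -
  have b: "0 \<le> C * g x + 1 * G x" "0 \<le> C * g x + (-1) * G x" if "x \<in> ivl_set K" for x
    using bound[of x] assms(1) that by (auto simp: abs_le_iff)
  have "0 \<le> C * ivl_integral g K + 1 * ivl_integral G K" "0 \<le> C * ivl_integral g K + (-1) * ivl_integral G K"
    by (intro ivl_integral_combination_nonneg assms simple_G b; assumption)+
  then show ?thesis by (simp add: abs_le_iff)
qed

text \<open>A modulus of approximation on finite families. The index type is fixed to
  \<open>nat\<close> since it cannot be quantified over; \<open>closeD\<close> transfers the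
  estimate to every countable type.\<close>

definition close :: "lc \<Rightarrow> lc \<Rightarrow> bool" where
  "close d e \<longleftrightarrow> 0 < d \<and> (\<forall>(S::nat set) K. gfam S K \<longrightarrow> B - A - (\<Sum>i\<in>S. ivl_length (K i)) < d \<longrightarrow>
    \<bar>(\<Sum>i\<in>S. ivl_integral g (K i)) - v\<bar> < e)"

lemma close_ex:
  assumes e: "0 < e"
  shows "\<exists>d. close d e"
proof -
  obtain d where d: "0 < d" "\<And>I s. simple_cover g {A..B} I s \<Longrightarrow> lc_measure {A..B} - s < d \<Longrightarrow>
      \<exists>w. strong_sums (\<lambda>n. ivl_integral g (I n)) w \<and> \<bar>w - v\<bar> < e"
    using int_g e unfolding lc_has_integral_def by blast
  have "\<bar>(\<Sum>i\<in>S. ivl_integral g (K i)) - v\<bar> < e"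
    if S: "gfam S K" and m: "B - A - (\<Sum>i\<in>S. ivl_length (K i)) < d" for S :: "nat set" and K
  proof -
    \<comment> \<open>The finite family is padded with empty intervals to a sequence as in
      \<open>simple_cover\<close>.\<close>
    define I where "I n = (if n \<in> S then K n else Ivl 0 0 False False)" for n
    have fin: "finite S" using S by (simp add: gfam_def)
    then obtain N where N: "S \<subseteq> {..N}" using finite_nat_set_iff_bounded_le by auto
    have sum: "strong_sums (\<lambda>n. \<phi> (I n)) (\<Sum>i\<in>S. \<phi> (K i))" if "\<phi> (Ivl 0 0 False False) = 0" for \<phi> :: "lc_ivl \<Rightarrow> lc"
    proof -
      have "strong_sums (\<lambda>n. \<phi> (I n)) (\<Sum>n\<le>N. \<phi> (I n))"
        by (rule strong_sums_finite) (use N that in \<open>auto simp: I_def\<close>)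
      moreover have "(\<Sum>n\<le>N. \<phi> (I n)) = (\<Sum>n\<in>S. \<phi> (I n))"
        by (rule sum.mono_neutral_right) (use N that in \<open>auto simp: I_def\<close>)
      ultimately show ?thesis by (simp add: I_def)
    qed
    have "ivl_set (I n) \<subseteq> {A..B}" for n
      using S by (cases "n \<in> S") (simp_all add: gfam_def I_def ivl_set_empty_degenerate)
    then have "(\<Union>n. ivl_set (I n)) \<subseteq> {A..B}" by blast
    moreover have "disjoint_ivls I"
      using S by (auto simp: disjoint_ivls_def gfam_def I_def disjoint_family_on_def ivl_set_empty_degenerate split: if_splits)
    moreover have "simple_on g (ivl_set (I n))" for n
      using S simple_on_degenerate[of "Ivl 0 0 False False" g] by (auto simp: I_def gfam_def)
    moreover have "strong_sums (\<lambda>n. ivl_length (I n)) (\<Sum>i\<in>S. ivl_length (K i))"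
      by (rule sum) (simp add: ivl_length_def)
    ultimately have "simple_cover g {A..B} I (\<Sum>i\<in>S. ivl_length (K i))" by (simp add: simple_cover_def)
    then obtain w where w: "strong_sums (\<lambda>n. ivl_integral g (I n)) w" "\<bar>w - v\<bar> < e"
      using d(2) m measure_AB by auto
    have "strong_sums (\<lambda>n. ivl_integral g (I n)) (\<Sum>i\<in>S. ivl_integral g (K i))"
      by (rule sum) (simp add: ivl_integral_def)
    then have "w = (\<Sum>i\<in>S. ivl_integral g (K i))" using w(1) strong_lim_unique unfolding strong_sums_def by blast
    then show ?thesis using w(2) by simp
  qed
  then show ?thesis unfolding close_def using d(1) by blast
qed

lemma closeD:
  fixes S :: "'i::countable set"
  assumes "close d e" "gfam S K" "B - A - (\<Sum>i\<in>S. ivl_length (K i)) < d"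
  shows "\<bar>(\<Sum>i\<in>S. ivl_integral g (K i)) - v\<bar> < e"
proof -
  define S' where "S' = to_nat ` S"
  define K' where "K' n = K (from_nat n)" for n
  have inj: "inj_on to_nat S" by (rule inj_on_subset[OF inj_to_nat]) simp
  have sums: "(\<Sum>i\<in>S'. \<phi> (K' i)) = (\<Sum>i\<in>S. \<phi> (K i))" for \<phi> :: "lc_ivl \<Rightarrow> lc"
    unfolding S'_def K'_def by (subst sum.reindex[OF inj]) simp
  have "disjoint_family_on (\<lambda>i. ivl_set (K' i)) S'"
    using assms(2) unfolding gfam_def disjoint_family_on_def S'_def K'_def by auto
  then have "gfam S' K'" using assms(2) unfolding gfam_def by (auto simp: S'_def K'_def)
  then show ?thesis using assms(1,3) unfolding close_def sums[symmetric] by blast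
qed

lemma fine_family:
  assumes d: "0 < d"
  shows "\<exists>(n::nat) K. gfam {..n} K \<and> B - A - (\<Sum>i\<le>n. ivl_length (K i)) < d"
proof -
  obtain I s where I: "simple_cover g {A..B} I s" "B - A - s < d"
    using int_g d measure_AB unfolding lc_has_integral_def measurable_funs_def by auto
  have "strong_lim (\<lambda>n. \<Sum>k\<le>n. ivl_length (I k)) s" using I(1) by (simp add: simple_cover_def strong_sums_def)
  moreover have "0 < d - (B - A - s)" using I by simp
  ultimately obtain n where "\<bar>(\<Sum>k\<le>n. ivl_length (I k)) - s\<bar> < d - (B - A - s)"
    unfolding strong_lim_def eventually_sequentially by blast
  then have "B - A - (\<Sum>k\<le>n. ivl_length (I k)) < d" by linarith
  moreover have "gfam {..n} I"
  proof -
    have "ivl_set (I k) \<subseteq> {A..B}" for k using I(1) unfolding simple_cover_def by blast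
    then show ?thesis using I(1) by (simp add: gfam_def simple_cover_def disjoint_ivls_def disjoint_family_on_def)
  qed
  ultimately show ?thesis by blast
qed

lemma gfam_inter:
  assumes K: "gfam S K" and fin: "finite T" and disj: "disjoint_family_on (\<lambda>j. ivl_set (J j)) T"
  shows "gfam (T \<times> S) (\<lambda>(j, i). ivl_inter (J j) (K i))"
proof -
  have "disjoint_family_on (\<lambda>(j, i). ivl_set (J j) \<inter> ivl_set (K i)) (T \<times> S)"
    using K disj unfolding gfam_def disjoint_family_on_def by fastforce
  moreover have "(\<lambda>x. ivl_set (case x of (j, i) \<Rightarrow> ivl_inter (J j) (K i))) = (\<lambda>(j, i). ivl_set (J j) \<inter> ivl_set (K i))"
    by (auto simp: ivl_set_inter)
  ultimately show ?thesis using K fin unfolding gfam_def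
    by (auto simp: ivl_inter_ordered ivl_set_inter intro: simple_on_subset)
qed

text \<open>
  Absolute continuity: a fine family for \<open>g\<close> and the same family with \<open>D\<close> cut out have almost the
  same integral of \<open>g\<close>, so \<open>g\<close>, and with it \<open>G\<close>, contributes little on \<open>D\<close>.
\<close>

lemma small_interval:
  assumes e: "0 < e"
  shows "\<exists>\<delta>>0. \<forall>D. lower D \<le> upper D \<longrightarrow> ivl_set D \<subseteq> {A..B} \<longrightarrow> simple_on G (ivl_set D) \<longrightarrow>
    ivl_length D < \<delta> \<longrightarrow> \<bar>ivl_integral G D\<bar> \<le> e"
proof -
  define e1 where "e1 = e / (4 * C)"
  have e1: "0 < e1" "C * (2 * e1) = e / 2" using e C by (auto simp: e1_def)
  obtain d0 where d0: "close d0 e1" using close_ex[OF e1(1)] by blast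
  then have d0pos: "0 < d0" by (simp add: close_def)
  have "\<bar>ivl_integral G D\<bar> \<le> e"
    if D: "lower D \<le> upper D" "ivl_set D \<subseteq> {A..B}" "simple_on G (ivl_set D)" "ivl_length D < d0 / 2" for D
  proof (cases "lower D < upper D")
    case False
    then show ?thesis using e by (simp add: ivl_integral_def)
  next
    case True
    obtain M where M: "0 < M" "\<And>(S::nat set) K. finite S \<Longrightarrow> disjoint_family_on (\<lambda>i. ivl_set (K i)) S \<Longrightarrow>
      (\<forall>i\<in>S. lower (K i) \<le> upper (K i)) \<Longrightarrow> (\<forall>i\<in>S. ivl_set (K i) \<subseteq> ivl_set D) \<Longrightarrow>
      \<bar>ivl_integral G D - (\<Sum>i\<in>S. ivl_integral G (K i))\<bar> \<le> M * (ivl_length D - (\<Sum>i\<in>S. ivl_length (K i)))"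
      using ivl_integral_approx[OF D(3,1)] by blast
    \<comment> \<open>\<open>M\<close>, and with it \<open>d'\<close>, depends on \<open>D\<close>.
      The final threshold \<open>d0 / 2\<close> does not, because \<open>d'\<close> only governs an
      auxiliary family.\<close>
    define d' where "d' = min (d0 / 2) (e / (2 * M))"
    have d': "0 < d'" "d' \<le> d0 / 2" "M * d' \<le> e / 2"
      using d0pos e M(1) by (auto simp: d'_def min_def field_simps)
    obtain n :: nat and K where K: "gfam {..n} K" "B - A - (\<Sum>i\<le>n. ivl_length (K i)) < d'"
      using fine_family[OF d'(1)] by blast
    have K': "disjoint_family_on (\<lambda>i. ivl_set (K i)) {..n}" "\<And>i. i \<le> n \<Longrightarrow> lower (K i) \<le> upper (K i)"
      "\<And>i. i \<le> n \<Longrightarrow> ivl_set (K i) \<subseteq> {A..B}" "\<And>i. i \<le> n \<Longrightarrow> simple_on g (ivl_set (K i))"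
      using K(1) by (auto simp: gfam_def)
    have b: "A \<le> lower D" "upper D \<le> B" using ivl_bounds_in[OF True D(2)] by auto
    \<comment> \<open>The flags of the two outer pieces complement those of \<open>D\<close>, so
      that the three pieces are disjoint.\<close>
    define P where "P j = (if j = 0 then Ivl A (lower D) True (\<not> left_closed D)
      else if j = 1 then Ivl (upper D) B (\<not> right_closed D) True else D)" for j :: nat
    have disjP: "disjoint_family_on (\<lambda>j. ivl_set (P j)) {..2}"
    proof -
      have "ivl_set (P 0) \<inter> ivl_set (P 1) = {}" "ivl_set (P 0) \<inter> ivl_set (P 2) = {}" "ivl_set (P 1) \<inter> ivl_set (P 2) = {}"
        using True by (auto simp: P_def ivl_set_def split: if_splits)
      moreover have "{..2} = {0, 1, 2::nat}" by auto
      ultimately show ?thesis unfolding disjoint_family_on_def by auto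
    qed
    have lens: "ivl_length (K i) \<le> ivl_length (ivl_inter (P 0) (K i)) + ivl_length (ivl_inter D (K i)) + ivl_length (ivl_inter (P 1) (K i))"
      if "i \<le> n" for i
      by (rule length_le_split[OF K'(2,3)[OF that] b(1) D(1) b(2)]) (simp_all add: P_def)
    have "(\<Sum>i\<le>n. ivl_length (ivl_inter D (K i))) \<le> upper D - lower D"
      by (rule sum_lengths_le[OF _ disjoint_inter[OF K'(1)] ivl_inter_ordered _ D(1)])
        (use ivl_set_bounds(2)[of D] in \<open>auto simp: ivl_set_inter\<close>)
    then have lenD: "(\<Sum>i\<le>n. ivl_length (ivl_inter D (K i))) < d0 / 2" using D(4) by (simp add: ivl_length_def[of D])
    have "(\<Sum>i\<le>n. ivl_length (K i)) \<le> (\<Sum>i\<le>n. ivl_length (ivl_inter (P 0) (K i))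
      + ivl_length (ivl_inter D (K i)) + ivl_length (ivl_inter (P 1) (K i)))"
      by (intro sum_mono lens) simp
    then have "B - A - ((\<Sum>i\<le>n. ivl_length (ivl_inter (P 0) (K i))) + (\<Sum>i\<le>n. ivl_length (ivl_inter (P 1) (K i)))) < d0"
      using lenD K(2) d'(2) by (simp add: sum.distrib)
    moreover have prod: "(\<Sum>x\<in>{..1}\<times>{..n}. \<phi> (case x of (j, i) \<Rightarrow> ivl_inter (P j) (K i))) =
      (\<Sum>i\<le>n. \<phi> (ivl_inter (P 0) (K i))) + (\<Sum>i\<le>n. \<phi> (ivl_inter (P 1) (K i)))" for \<phi> :: "lc_ivl \<Rightarrow> lc"
    proof -
      have "(\<Sum>x\<in>{..1}\<times>{..n}. \<phi> (case x of (j, i) \<Rightarrow> ivl_inter (P j) (K i))) =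
        (\<Sum>j\<le>1::nat. \<Sum>i\<le>n. \<phi> (ivl_inter (P j) (K i)))"
        unfolding sum.cartesian_product by (rule sum.cong) auto
      then show ?thesis by (simp add: atMost_Suc)
    qed
    moreover have "gfam ({..1} \<times> {..n}) (\<lambda>(j, i). ivl_inter (P j) (K i))"
      by (rule gfam_inter[OF K(1)]) (auto intro: disjoint_family_on_mono[OF _ disjP])
    ultimately have 1: "\<bar>(\<Sum>i\<le>n. ivl_integral g (ivl_inter (P 0) (K i))) + (\<Sum>i\<le>n. ivl_integral g (ivl_inter (P 1) (K i))) - v\<bar> < e1"
      using closeD[OF d0, of "{..1} \<times> {..n}" "\<lambda>(j, i). ivl_inter (P j) (K i)"] by simp
    have 2: "\<bar>(\<Sum>i\<le>n. ivl_integral g (K i)) - v\<bar> < e1"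
      by (rule closeD[OF d0 K(1)]) (use K(2) d' d0pos in simp)
    have three: "(\<Sum>j\<le>2. \<phi> j) = \<phi> 0 + \<phi> 1 + \<phi> 2" for \<phi> :: "nat \<Rightarrow> lc"
      by (simp add: numeral_2_eq_2 atMost_Suc)
    have 3: "ivl_integral g (ivl_inter (P 0) (K i)) + ivl_integral g (ivl_inter (P 1) (K i)) + ivl_integral g (ivl_inter D (K i))
      \<le> ivl_integral g (K i)" if i: "i \<le> n" for i
    proof -
      have "0 \<le> 1 * g x + 0 * g x" if "x \<in> ivl_set (K i)" for x
      proof -
        have "x \<in> {A..B}" using that K'(3)[OF i] by blast
        then have "0 \<le> C * g x" using bound[of x] abs_ge_zero order.trans by blast
        then show ?thesis using C by (simp add: zero_le_mult_iff)
      qed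
      then have "(\<Sum>j\<le>2. 1 * ivl_integral g (ivl_inter (P j) (K i)) + 0 * ivl_integral g (ivl_inter (P j) (K i)))
        \<le> 1 * ivl_integral g (K i) + 0 * ivl_integral g (K i)"
        by (intro ivl_integral_combination_mono K'(2,4)[OF i])
          (use disjP in \<open>auto simp: ivl_set_inter ivl_inter_ordered disjoint_family_on_def\<close>)
      then show ?thesis by (simp add: three) (simp add: P_def)
    qed
    have "(\<Sum>i\<le>n. ivl_integral g (ivl_inter (P 0) (K i)) + ivl_integral g (ivl_inter (P 1) (K i)) + ivl_integral g (ivl_inter D (K i)))
      \<le> (\<Sum>i\<le>n. ivl_integral g (K i))"
      by (intro sum_mono 3) simp
    then have gD: "(\<Sum>i\<le>n. ivl_integral g (ivl_inter D (K i))) \<le> 2 * e1"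
      using 1 2 unfolding sum.distrib by linarith
    have "\<bar>\<Sum>i\<le>n. ivl_integral G (ivl_inter D (K i))\<bar> \<le> (\<Sum>i\<le>n. \<bar>ivl_integral G (ivl_inter D (K i))\<bar>)" by (rule sum_abs)
    also have "\<dots> \<le> (\<Sum>i\<le>n. C * ivl_integral g (ivl_inter D (K i)))"
    proof (intro sum_mono int_G_le)
      fix i assume "i \<in> {..n}"
      then have "i \<le> n" by simp
      show "ivl_set (ivl_inter D (K i)) \<subseteq> {A..B}" using D(2) by (auto simp: ivl_set_inter)
      show "simple_on g (ivl_set (ivl_inter D (K i)))"
        by (rule simple_on_subset[OF K'(4)[OF \<open>i \<le> n\<close>]]) (simp add: ivl_set_inter)
    qed
    also have "\<dots> \<le> C * (2 * e1)" unfolding sum_distrib_left[symmetric] using gD C by (intro mult_left_mono) auto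
    finally have 4: "\<bar>\<Sum>i\<le>n. ivl_integral G (ivl_inter D (K i))\<bar> \<le> e / 2" using e1 by simp
    have "\<bar>ivl_integral G D - (\<Sum>i\<le>n. ivl_integral G (ivl_inter D (K i)))\<bar>
      \<le> M * (ivl_length D - (\<Sum>i\<le>n. ivl_length (ivl_inter D (K i))))"
      by (rule M(2)[OF _ disjoint_inter[OF K'(1)]]) (simp_all add: ivl_set_inter ivl_inter_ordered)
    also have "\<dots> \<le> M * d'"
    proof (intro mult_left_mono)
      have "ivl_length D - (\<Sum>i\<le>n. ivl_length (ivl_inter D (K i))) \<le> B - A - (\<Sum>i\<le>n. ivl_length (K i))"
        by (rule missing_in_subinterval[OF _ K'(1)]) (use K' AB D in auto)
      then show "ivl_length D - (\<Sum>i\<le>n. ivl_length (ivl_inter D (K i))) \<le> d'" using K(2) by simp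
    qed (use M in simp)
    finally show ?thesis using 4 d'(3) by linarith
  qed
  then show ?thesis using d0pos by (intro exI[of _ "d0 / 2"]) auto
qed

text \<open>The lengths of a convergent family tend to 0, hence so do the integrals by
  \<open>small_interval\<close>, and null terms suffice for strong convergence.\<close>

lemma cover_sums:
  assumes "simple_cover G {A..B} I s"
  shows "\<exists>w. strong_sums (\<lambda>n. ivl_integral G (I n)) w"
proof (rule strong_sums_of_terms)
  fix m
  obtain \<delta> where \<delta>: "0 < \<delta>" "\<And>D. lower D \<le> upper D \<Longrightarrow> ivl_set D \<subseteq> {A..B} \<Longrightarrow> simple_on G (ivl_set D) \<Longrightarrow>
    ivl_length D < \<delta> \<Longrightarrow> \<bar>ivl_integral G D\<bar> \<le> lc_mono m" using small_interval[OF lc_mono_pos] by blast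
  have "strong_sums (\<lambda>n. ivl_length (I n)) s" using assms by (simp add: simple_cover_def)
  then have "\<forall>\<^sub>F n in sequentially. ord_ge (lc_lead \<delta> + 1) (ivl_length (I n))"
    by (rule strong_sums_terms)
  then show "\<forall>\<^sub>F n in sequentially. ord_ge m (ivl_integral G (I n))"
  proof eventually_elim
    case (elim n)
    have "\<bar>ivl_length (I n)\<bar> < \<delta>" by (rule abs_less_of_ord[OF elim \<delta>(1)]) simp
    then have len: "ivl_length (I n) < \<delta>" by linarith
    have "lower (I n) \<le> upper (I n)" "ivl_set (I n) \<subseteq> {A..B}" "simple_on G (ivl_set (I n))"
      using assms unfolding simple_cover_def disjoint_ivls_def by blast+
    from \<delta>(2)[OF this len] have "\<bar>ivl_integral G (I n)\<bar> \<le> lc_mono m" .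
    then show ?case by (rule ord_ge_of_abs_le) simp
  qed
qed

text \<open>
  Both sums are compared with the one over the common refinement: on the intervals of \<open>I\<close> because
  the integral of \<open>G\<close> is Lipschitz there, on those of \<open>K\<close> because \<open>G\<close> is dominated by \<open>g\<close>, for
  which the refinement is again a fine family.
\<close>

lemma cover_vs_family:
  assumes e: "0 < e"
  shows "\<exists>d0>0. \<forall>I s. simple_cover G {A..B} I s \<longrightarrow> B - A - s < d0 \<longrightarrow>
    (\<exists>N0. \<forall>N\<ge>N0. \<exists>d'>0. \<forall>(n::nat) K. gfam {..n} K \<longrightarrow> B - A - (\<Sum>i\<le>n. ivl_length (K i)) < d' \<longrightarrow>
      \<bar>(\<Sum>k\<le>N. ivl_integral G (I k)) - (\<Sum>i\<le>n. ivl_integral G (K i))\<bar> \<le> (1 + 2 * C) * e)"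
proof -
  obtain d1 where d1: "close d1 e" using close_ex[OF e] by blast
  then have d1pos: "0 < d1" by (simp add: close_def)
  have "\<exists>N0. \<forall>N\<ge>N0. \<exists>d'>0. \<forall>(n::nat) K. gfam {..n} K \<longrightarrow> B - A - (\<Sum>i\<le>n. ivl_length (K i)) < d' \<longrightarrow>
      \<bar>(\<Sum>k\<le>N. ivl_integral G (I k)) - (\<Sum>i\<le>n. ivl_integral G (K i))\<bar> \<le> (1 + 2 * C) * e"
    if I: "simple_cover G {A..B} I s" "B - A - s < d1 / 2" for I s
  proof -
    have Iord: "lower (I k) \<le> upper (I k)" and Isub: "ivl_set (I k) \<subseteq> {A..B}" and Isimple: "simple_on G (ivl_set (I k))" for k
      using I(1) unfolding simple_cover_def disjoint_ivls_def by blast+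
    have Idisj: "disjoint_family_on (\<lambda>k. ivl_set (I k)) T" for T
      using I(1) by (auto simp: simple_cover_def disjoint_ivls_def disjoint_family_on_def)
    have "strong_lim (\<lambda>n. \<Sum>k\<le>n. ivl_length (I k)) s" using I(1) by (simp add: simple_cover_def strong_sums_def)
    moreover have "0 < d1 / 2 - (B - A - s)" using I by simp
    ultimately obtain N0 where N0: "\<And>N. N \<ge> N0 \<Longrightarrow> \<bar>(\<Sum>k\<le>N. ivl_length (I k)) - s\<bar> < d1 / 2 - (B - A - s)"
      unfolding strong_lim_def eventually_sequentially by blast
    \<comment> \<open>The Lipschitz constants of the intervals need not have a common bound; this is
      why finite initial parts of \<open>I\<close> are compared and \<open>d'\<close> depends on
      \<open>N\<close>.\<close>
    have "\<forall>k. \<exists>M>0. \<forall>(S::nat set) K. finite S \<longrightarrow> disjoint_family_on (\<lambda>i. ivl_set (K i)) S \<longrightarrow>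
      (\<forall>i\<in>S. lower (K i) \<le> upper (K i)) \<longrightarrow> (\<forall>i\<in>S. ivl_set (K i) \<subseteq> ivl_set (I k)) \<longrightarrow>
      \<bar>ivl_integral G (I k) - (\<Sum>i\<in>S. ivl_integral G (K i))\<bar> \<le> M * (ivl_length (I k) - (\<Sum>i\<in>S. ivl_length (K i)))"
      using ivl_integral_approx[OF Isimple Iord] by blast
    from choice[OF this] obtain M where M': "\<forall>k. 0 < M k \<and> (\<forall>(S::nat set) K. finite S \<longrightarrow> disjoint_family_on (\<lambda>i. ivl_set (K i)) S \<longrightarrow>
      (\<forall>i\<in>S. lower (K i) \<le> upper (K i)) \<longrightarrow> (\<forall>i\<in>S. ivl_set (K i) \<subseteq> ivl_set (I k)) \<longrightarrow>
      \<bar>ivl_integral G (I k) - (\<Sum>i\<in>S. ivl_integral G (K i))\<bar> \<le> M k * (ivl_length (I k) - (\<Sum>i\<in>S. ivl_length (K i))))"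
      by (elim exE)
    have M: "0 < M k" "finite S \<Longrightarrow> disjoint_family_on (\<lambda>i. ivl_set (K i)) S \<Longrightarrow>
      (\<forall>i\<in>S. lower (K i) \<le> upper (K i)) \<Longrightarrow> (\<forall>i\<in>S. ivl_set (K i) \<subseteq> ivl_set (I k)) \<Longrightarrow>
      \<bar>ivl_integral G (I k) - (\<Sum>i\<in>S. ivl_integral G (K i))\<bar> \<le> M k * (ivl_length (I k) - (\<Sum>i\<in>S. ivl_length (K i)))"
      for k and S :: "nat set" and K
      using M'[THEN spec[of _ k]] by simp_all
    have "\<exists>d'>0. \<forall>(n::nat) K. gfam {..n} K \<longrightarrow> B - A - (\<Sum>i\<le>n. ivl_length (K i)) < d' \<longrightarrow>
      \<bar>(\<Sum>k\<le>N. ivl_integral G (I k)) - (\<Sum>i\<le>n. ivl_integral G (K i))\<bar> \<le> (1 + 2 * C) * e" if N: "N \<ge> N0" for N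
    proof -
      define Mt where "Mt = (\<Sum>k\<le>N. M k)"
      have Mt: "0 < Mt" unfolding Mt_def using M(1) by (intro sum_pos) auto
      \<comment> \<open>The first bound keeps the length missed by the refinement below
        \<open>d1\<close>, as each of the \<open>N + 1\<close> intervals misses at most
        \<open>d'\<close>; the second keeps the sum of the Lipschitz errors at most
        \<open>e\<close>.\<close>
      define d' where "d' = min (d1 / (2 * of_nat (Suc N))) (e / Mt)"
      have Npos: "0 < (of_nat (Suc N) :: lc)" by (simp only: of_nat_0_less_iff zero_less_Suc)
      have d': "0 < d'" using d1pos e Mt Npos by (simp add: d'_def)
      have "d' \<le> d1 / (2 * of_nat (Suc N))" by (simp add: d'_def)
      then have dN: "of_nat (Suc N) * d' \<le> d1 / 2"
        using Npos by (simp add: field_simps del: of_nat_Suc)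
      have "d' \<le> e / Mt" by (simp add: d'_def)
      then have dM: "Mt * d' \<le> e" using Mt by (simp add: field_simps)
      have "1 * d' \<le> of_nat (Suc N) * d'" using d' by (intro mult_right_mono) (auto simp: add_increasing)
      then have d'd1: "d' \<le> d1" using dN d1pos by simp
      have "\<bar>(\<Sum>k\<le>N. ivl_integral G (I k)) - (\<Sum>i\<le>n. ivl_integral G (K i))\<bar> \<le> (1 + 2 * C) * e"
        if K: "gfam {..n} K" "B - A - (\<Sum>i\<le>n. ivl_length (K i)) < d'" for n :: nat and K
      proof -
        have K': "disjoint_family_on (\<lambda>i. ivl_set (K i)) {..n}" "\<And>i. i \<le> n \<Longrightarrow> lower (K i) \<le> upper (K i)"
          "\<And>i. i \<le> n \<Longrightarrow> ivl_set (K i) \<subseteq> {A..B}" "\<And>i. i \<le> n \<Longrightarrow> simple_on g (ivl_set (K i))"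
          using K(1) by (auto simp: gfam_def)
        define R where "R k i = ivl_inter (I k) (K i)" for k i
        have miss: "ivl_length (I k) - (\<Sum>i\<le>n. ivl_length (R k i)) \<le> d'" for k
        proof -
          have "ivl_length (I k) - (\<Sum>i\<le>n. ivl_length (R k i)) \<le> B - A - (\<Sum>i\<le>n. ivl_length (K i))"
            unfolding R_def by (rule missing_in_subinterval[OF _ K'(1)]) (use K' AB Iord Isub in auto)
          then show ?thesis using K(2) by simp
        qed
        have sR: "(\<Sum>x\<in>{..N}\<times>{..n}. \<phi> (case x of (k, i) \<Rightarrow> ivl_inter (I k) (K i))) = (\<Sum>k\<le>N. \<Sum>i\<le>n. \<phi> (R k i))" for \<phi> :: "lc_ivl \<Rightarrow> lc"
          unfolding sum.cartesian_product R_def by (rule sum.cong) auto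
        have "(\<Sum>k\<le>N. ivl_length (I k) - (\<Sum>i\<le>n. ivl_length (R k i))) \<le> (\<Sum>k\<le>N. d')"
          by (intro sum_mono miss)
        also have "\<dots> = of_nat (Suc N) * d'" by simp
        finally have "(\<Sum>k\<le>N. ivl_length (I k)) - (\<Sum>k\<le>N. \<Sum>i\<le>n. ivl_length (R k i)) \<le> d1 / 2"
          using dN by (simp add: sum_subtractf)
        then have "B - A - (\<Sum>k\<le>N. \<Sum>i\<le>n. ivl_length (R k i)) < d1"
          using N0[OF N] by linarith
        then have "\<bar>(\<Sum>k\<le>N. \<Sum>i\<le>n. ivl_integral g (R k i)) - v\<bar> < e"
          using closeD[OF d1 gfam_inter[OF K(1) _ Idisj, of "{..N}"]] by (simp add: sR)
        moreover have "\<bar>(\<Sum>i\<le>n. ivl_integral g (K i)) - v\<bar> < e"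
          by (rule closeD[OF d1 K(1)]) (use K(2) d'd1 in simp)
        ultimately have gdiff: "(\<Sum>i\<le>n. ivl_integral g (K i)) - (\<Sum>k\<le>N. \<Sum>i\<le>n. ivl_integral g (R k i)) \<le> 2 * e"
          by linarith
        have "\<bar>(\<Sum>k\<le>N. ivl_integral G (I k)) - (\<Sum>k\<le>N. \<Sum>i\<le>n. ivl_integral G (R k i))\<bar>
          \<le> (\<Sum>k\<le>N. \<bar>ivl_integral G (I k) - (\<Sum>i\<le>n. ivl_integral G (R k i))\<bar>)"
          unfolding sum_subtractf[symmetric] by (rule sum_abs)
        also have "\<dots> \<le> (\<Sum>k\<le>N. M k * d')"
        proof (rule sum_mono)
          fix k
          have "\<bar>ivl_integral G (I k) - (\<Sum>i\<le>n. ivl_integral G (R k i))\<bar> \<le> M k * (ivl_length (I k) - (\<Sum>i\<le>n. ivl_length (R k i)))"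
            unfolding R_def by (rule M(2)[OF _ disjoint_inter[OF K'(1)]]) (auto simp: ivl_inter_ordered ivl_set_inter)
          also have "\<dots> \<le> M k * d'" using M(1)[of k] by (intro mult_left_mono miss) simp
          finally show "\<bar>ivl_integral G (I k) - (\<Sum>i\<le>n. ivl_integral G (R k i))\<bar> \<le> M k * d'" .
        qed
        also have "\<dots> \<le> e" using dM by (simp add: Mt_def sum_distrib_right)
        finally have first: "\<bar>(\<Sum>k\<le>N. ivl_integral G (I k)) - (\<Sum>k\<le>N. \<Sum>i\<le>n. ivl_integral G (R k i))\<bar> \<le> e" .
        have comb: "(\<Sum>k\<le>N. C * ivl_integral g (R k i) + \<sigma> * ivl_integral G (R k i)) \<le> C * ivl_integral g (K i) + \<sigma> * ivl_integral G (K i)"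
          if i: "i \<le> n" and \<sigma>: "\<sigma> = 1 \<or> \<sigma> = -1" for i \<sigma>
        proof (rule ivl_integral_combination_mono[OF K'(4)[OF i] simple_G[OF K'(3,4)[OF i]] K'(2)[OF i]])
          fix x assume "x \<in> ivl_set (K i)"
          then have "\<bar>G x\<bar> \<le> C * g x" using bound K'(3)[OF i] by blast
          then show "0 \<le> C * g x + \<sigma> * G x" using \<sigma> by (auto simp: abs_le_iff)
        next
          show "disjoint_family_on (\<lambda>k. ivl_set (R k i)) {..N}"
            using Idisj[of "{..N}"] by (auto simp: R_def ivl_set_inter disjoint_family_on_def)
        qed (auto simp: R_def ivl_inter_ordered ivl_set_inter)
        have "(\<Sum>i\<le>n. \<Sum>k\<le>N. C * ivl_integral g (R k i) + \<sigma> * ivl_integral G (R k i))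
          \<le> (\<Sum>i\<le>n. C * ivl_integral g (K i) + \<sigma> * ivl_integral G (K i))" if "\<sigma> = 1 \<or> \<sigma> = -1" for \<sigma>
          by (intro sum_mono comb that) simp
        then have "C * (\<Sum>k\<le>N. \<Sum>i\<le>n. ivl_integral g (R k i)) + \<sigma> * (\<Sum>k\<le>N. \<Sum>i\<le>n. ivl_integral G (R k i))
          \<le> C * (\<Sum>i\<le>n. ivl_integral g (K i)) + \<sigma> * (\<Sum>i\<le>n. ivl_integral G (K i))" if "\<sigma> = 1 \<or> \<sigma> = -1" for \<sigma>
          using that by (subst (1 2) sum.swap) (simp only: sum.distrib sum_distrib_left)
        from this[of 1] this[of "-1"]
        have "\<bar>(\<Sum>i\<le>n. ivl_integral G (K i)) - (\<Sum>k\<le>N. \<Sum>i\<le>n. ivl_integral G (R k i))\<bar>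
          \<le> C * ((\<Sum>i\<le>n. ivl_integral g (K i)) - (\<Sum>k\<le>N. \<Sum>i\<le>n. ivl_integral g (R k i)))"
          unfolding right_diff_distrib by (simp add: abs_le_iff algebra_simps)
        also have "\<dots> \<le> C * (2 * e)" using gdiff C by (intro mult_left_mono) auto
        finally have "\<bar>(\<Sum>k\<le>N. ivl_integral G (I k)) - (\<Sum>i\<le>n. ivl_integral G (K i))\<bar> \<le> e + C * (2 * e)"
          using first by linarith
        then show ?thesis by (simp add: algebra_simps)
      qed
      then show ?thesis using d' by blast
    qed
    then show ?thesis by blast
  qed
  then show ?thesis using d1pos by (intro exI[of _ "d1 / 2"]) auto
qed

lemma measurable_G: "G \<in> measurable_funs {A..B}"
proof -
  have "simple_cover G {A..B} I s" if "simple_cover g {A..B} I s" for I s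
    using that simple_G unfolding simple_cover_def by blast
  then show ?thesis using int_g unfolding lc_has_integral_def measurable_funs_def by blast
qed

text \<open>The value is the limit along families of fineness \<open>lc_mono j\<close>. These sums
  are Cauchy because all late ones are close to one partial sum over a fixed cover, and the same
  comparison ties every fine cover to the limit. Nonnegative combinations of \<open>g\<close> and
  \<open>G\<close> keep their sign along the families, which yields the estimate.\<close>

theorem integral_G:
  obtains w where "lc_has_integral G w {A..B}"
    "\<And>\<rho> \<epsilon>. (\<And>x. x \<in> {A..B} \<Longrightarrow> \<bar>G x - \<rho> * g x\<bar> \<le> \<epsilon> * g x) \<Longrightarrow> \<bar>w - \<rho> * v\<bar> \<le> \<epsilon> * v"
proof -
  have "\<exists>nK. gfam {..fst nK::nat} (snd nK) \<and> B - A - (\<Sum>i\<le>fst nK. ivl_length (snd nK i)) < lc_mono (of_nat j)" for j :: nat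
    using fine_family[OF lc_mono_pos[of "of_nat j"]] by auto
  then obtain nK where nK: "\<And>j::nat. gfam {..fst (nK j)::nat} (snd (nK j))"
    "\<And>j. B - A - (\<Sum>i\<le>fst (nK j). ivl_length (snd (nK j) i)) < lc_mono (of_nat j)"
    using choice[of "\<lambda>j nK. gfam {..fst nK::nat} (snd nK) \<and> B - A - (\<Sum>i\<le>fst nK. ivl_length (snd nK i)) < lc_mono (of_nat j)"]
    by blast
  define V where "V j = (\<Sum>i\<le>fst (nK j). ivl_integral g (snd (nK j) i))" for j
  define W where "W j = (\<Sum>i\<le>fst (nK j). ivl_integral G (snd (nK j) i))" for j
  have Vlim: "strong_lim V v" unfolding strong_lim_def
  proof (intro allI impI)
    fix e :: lc assume "0 < e"
    then obtain d where d: "close d e" using close_ex by blast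
    then obtain j0 :: nat where j0: "\<And>j. j \<ge> j0 \<Longrightarrow> lc_mono (of_nat j) < d" using lc_dense_small[of d] by (auto simp: close_def)
    have "\<bar>V j - v\<bar> < e" if "j \<ge> j0" for j
      unfolding V_def by (rule closeD[OF d nK(1)]) (use nK(2)[of j] j0[OF that] in simp)
    then show "\<forall>\<^sub>F j in sequentially. \<bar>V j - v\<bar> < e" unfolding eventually_sequentially by blast
  qed
  have near: "\<exists>d0>0. \<forall>I s. simple_cover G {A..B} I s \<longrightarrow> B - A - s < d0 \<longrightarrow>
    (\<exists>N0. \<forall>N\<ge>N0. \<exists>j0. \<forall>j\<ge>j0. \<bar>(\<Sum>k\<le>N. ivl_integral G (I k)) - W j\<bar> \<le> e)" if e: "0 < e" for e
  proof -
    define e1 where "e1 = e / (1 + 2 * C)"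
    have C2: "0 < 1 + 2 * C" using C by simp
    have e1: "0 < e1" "(1 + 2 * C) * e1 = e" using e C2 by (auto simp: e1_def)
    obtain d0 where d0: "0 < d0" and near: "\<And>I s. simple_cover G {A..B} I s \<Longrightarrow> B - A - s < d0 \<Longrightarrow>
      \<exists>N0. \<forall>N\<ge>N0. \<exists>d'>0. \<forall>(n::nat) K. gfam {..n} K \<longrightarrow> B - A - (\<Sum>i\<le>n. ivl_length (K i)) < d' \<longrightarrow>
        \<bar>(\<Sum>k\<le>N. ivl_integral G (I k)) - (\<Sum>i\<le>n. ivl_integral G (K i))\<bar> \<le> e"
      using cover_vs_family[OF e1(1)] unfolding e1(2) by blast
    have "\<exists>N0. \<forall>N\<ge>N0. \<exists>j0. \<forall>j\<ge>j0. \<bar>(\<Sum>k\<le>N. ivl_integral G (I k)) - W j\<bar> \<le> e"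
      if I: "simple_cover G {A..B} I s" "B - A - s < d0" for I s
    proof -
      obtain N0 where N0: "\<And>N. N \<ge> N0 \<Longrightarrow> \<exists>d'>0. \<forall>(n::nat) K. gfam {..n} K \<longrightarrow> B - A - (\<Sum>i\<le>n. ivl_length (K i)) < d' \<longrightarrow>
        \<bar>(\<Sum>k\<le>N. ivl_integral G (I k)) - (\<Sum>i\<le>n. ivl_integral G (K i))\<bar> \<le> e"
        using near[OF I] by blast
      have "\<exists>j0. \<forall>j\<ge>j0. \<bar>(\<Sum>k\<le>N. ivl_integral G (I k)) - W j\<bar> \<le> e" if N: "N \<ge> N0" for N
      proof -
        obtain d' where d': "0 < d'" "\<And>(n::nat) K. gfam {..n} K \<Longrightarrow> B - A - (\<Sum>i\<le>n. ivl_length (K i)) < d' \<Longrightarrow>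
          \<bar>(\<Sum>k\<le>N. ivl_integral G (I k)) - (\<Sum>i\<le>n. ivl_integral G (K i))\<bar> \<le> e" using N0[OF N] by blast
        obtain j0 :: nat where j0: "\<And>j. j \<ge> j0 \<Longrightarrow> lc_mono (of_nat j) < d'" using lc_dense_small[OF d'(1)] by auto
        have "\<bar>(\<Sum>k\<le>N. ivl_integral G (I k)) - W j\<bar> \<le> e" if "j \<ge> j0" for j
          unfolding W_def by (rule d'(2)[OF nK(1)]) (use nK(2)[of j] j0[OF that] in simp)
        then show ?thesis by blast
      qed
      then show ?thesis by blast
    qed
    then show ?thesis using d0 by blast
  qed
  have "\<exists>w. strong_lim W w"
  proof (rule strong_lim_complete)
    fix m
    have "0 < lc_mono m / 2" by simp
    from near[OF this] obtain d0 where d0: "0 < d0" "\<And>I s. simple_cover G {A..B} I s \<Longrightarrow> B - A - s < d0 \<Longrightarrow>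
      \<exists>N0. \<forall>N\<ge>N0. \<exists>j0. \<forall>j\<ge>j0. \<bar>(\<Sum>k\<le>N. ivl_integral G (I k)) - W j\<bar> \<le> lc_mono m / 2" by blast
    obtain I s where "simple_cover G {A..B} I s" "B - A - s < d0"
      using measurable_G d0(1) measure_AB unfolding measurable_funs_def by auto
    from d0(2)[OF this] obtain N j0 where j0: "\<And>j. j \<ge> j0 \<Longrightarrow> \<bar>(\<Sum>k\<le>N. ivl_integral G (I k)) - W j\<bar> \<le> lc_mono m / 2"
      by blast
    have "ord_ge m (W j - W j')" if "j \<ge> j0" "j' \<ge> j0" for j j'
    proof (rule ord_ge_of_abs_le)
      show "\<bar>W j - W j'\<bar> \<le> lc_mono m" using j0[OF that(1)] j0[OF that(2)] by linarith
    qed simp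
    then show "\<exists>N. \<forall>n\<ge>N. \<forall>n'\<ge>N. ord_ge m (W n - W n')" by blast
  qed
  then obtain w where w: "strong_lim W w" by blast
  show thesis
  proof (rule that)
    show "lc_has_integral G w {A..B}" unfolding lc_has_integral_def
    proof (intro conjI measurable_G allI impI)
      fix e :: lc assume "0 < e"
      then have e4: "0 < e / 4" by simp
      from near[OF this] obtain d0 where d0: "0 < d0" "\<And>I s. simple_cover G {A..B} I s \<Longrightarrow> B - A - s < d0 \<Longrightarrow>
        \<exists>N0. \<forall>N\<ge>N0. \<exists>j0. \<forall>j\<ge>j0. \<bar>(\<Sum>k\<le>N. ivl_integral G (I k)) - W j\<bar> \<le> e / 4" by blast
      have "\<exists>w'. strong_sums (\<lambda>n. ivl_integral G (I n)) w' \<and> \<bar>w' - w\<bar> < e"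
        if I: "simple_cover G {A..B} I s" "B - A - s < d0" for I s
      proof -
        obtain w' where w': "strong_sums (\<lambda>n. ivl_integral G (I n)) w'" using cover_sums[OF I(1)] by blast
        obtain N0 where N0: "\<And>N. N \<ge> N0 \<Longrightarrow> \<exists>j0. \<forall>j\<ge>j0. \<bar>(\<Sum>k\<le>N. ivl_integral G (I k)) - W j\<bar> \<le> e / 4"
          using d0(2)[OF I] by blast
        obtain N1 where N1: "\<And>N. N \<ge> N1 \<Longrightarrow> \<bar>(\<Sum>k\<le>N. ivl_integral G (I k)) - w'\<bar> < e / 4"
          using w' e4 unfolding strong_sums_def strong_lim_def eventually_sequentially by blast
        define N where "N = max N0 N1"
        obtain j0 where j0: "\<And>j. j \<ge> j0 \<Longrightarrow> \<bar>(\<Sum>k\<le>N. ivl_integral G (I k)) - W j\<bar> \<le> e / 4"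
          using N0[of N] by (auto simp: N_def)
        obtain j1 where j1: "\<And>j. j \<ge> j1 \<Longrightarrow> \<bar>W j - w\<bar> < e / 4"
          using w e4 unfolding strong_lim_def eventually_sequentially by blast
        define j where "j = max j0 j1"
        have "\<bar>(\<Sum>k\<le>N. ivl_integral G (I k)) - W j\<bar> \<le> e / 4" "\<bar>W j - w\<bar> < e / 4"
          "\<bar>(\<Sum>k\<le>N. ivl_integral G (I k)) - w'\<bar> < e / 4"
          using j0[of j] j1[of j] N1[of N] by (auto simp: j_def N_def)
        then have "\<bar>w' - w\<bar> < e" by linarith
        then show ?thesis using w' by blast
      qed
      then show "\<exists>d>0. \<forall>I s. simple_cover G {A..B} I s \<longrightarrow> lc_measure {A..B} - s < d \<longrightarrow>
        (\<exists>w'. strong_sums (\<lambda>n. ivl_integral G (I n)) w' \<and> \<bar>w' - w\<bar> < e)"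
        unfolding measure_AB using d0(1) by blast
    qed
  next
    fix \<rho> \<epsilon> assume est: "\<And>x. x \<in> {A..B} \<Longrightarrow> \<bar>G x - \<rho> * g x\<bar> \<le> \<epsilon> * g x"
    have K: "ivl_set (snd (nK j) i) \<subseteq> {A..B}" "simple_on g (ivl_set (snd (nK j) i))" if "i \<le> fst (nK j)" for i j
      using nK(1)[of j] that by (auto simp: gfam_def)
    have nn: "0 \<le> \<alpha> * ivl_integral g (snd (nK j) i) + \<beta> * ivl_integral G (snd (nK j) i)"
      if i: "i \<le> fst (nK j)" and q: "\<And>x. x \<in> {A..B} \<Longrightarrow> 0 \<le> \<alpha> * g x + \<beta> * G x" for \<alpha> \<beta> i j
      by (rule ivl_integral_combination_nonneg[OF K(2)[OF i] simple_G[OF K[OF i]]]) (use q K(1)[OF i] in blast)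
    have pos: "0 \<le> (\<epsilon> + \<rho>) * V j - 1 * W j" "0 \<le> (\<epsilon> - \<rho>) * V j - (-1) * W j" for j
    proof -
      have p: "0 \<le> (\<epsilon> + \<rho>) * g x + (-1) * G x" "0 \<le> (\<epsilon> - \<rho>) * g x + 1 * G x" if "x \<in> {A..B}" for x
        using est[OF that] by (auto simp: abs_le_iff algebra_simps)
      have "0 \<le> (\<Sum>i\<le>fst (nK j). (\<epsilon> + \<rho>) * ivl_integral g (snd (nK j) i) + (-1) * ivl_integral G (snd (nK j) i))"
        by (intro sum_nonneg nn p) auto
      moreover have "0 \<le> (\<Sum>i\<le>fst (nK j). (\<epsilon> - \<rho>) * ivl_integral g (snd (nK j) i) + 1 * ivl_integral G (snd (nK j) i))"
        by (intro sum_nonneg nn p) auto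
      ultimately show "0 \<le> (\<epsilon> + \<rho>) * V j - 1 * W j" "0 \<le> (\<epsilon> - \<rho>) * V j - (-1) * W j"
        by (simp_all add: V_def W_def sum.distrib sum_distrib_left sum_negf sum_subtractf)
    qed
    have "0 \<le> (\<epsilon> + \<rho>) * v - 1 * w" "0 \<le> (\<epsilon> - \<rho>) * v - (-1) * w"
      by (rule strong_lim_lower[OF strong_lim_diff[OF strong_lim_cmult[OF Vlim] strong_lim_cmult[OF w]]], rule pos)+
    then show "\<bar>w - \<rho> * v\<bar> \<le> \<epsilon> * v" by (simp add: abs_le_iff algebra_simps)
  qed
qed

end

section \<open>Dirac-like functions\<close>

lemma simple_cover_cong:
  assumes "\<And>x. x \<in> S \<Longrightarrow> f x = g x"
  shows "simple_cover f S I s \<longleftrightarrow> simple_cover g S I s"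
proof -
  have "simple_on f (ivl_set (I n)) \<longleftrightarrow> simple_on g (ivl_set (I n))" if "(\<Union>n. ivl_set (I n)) \<subseteq> S" for n
    using that by (intro simple_on_cong assms) blast
  then show ?thesis unfolding simple_cover_def by blast
qed

lemma lc_has_integral_cong:
  assumes eq: "\<And>x. x \<in> S \<Longrightarrow> f x = g x" and f: "lc_has_integral f v S"
  shows "lc_has_integral g v S"
proof -
  have ints: "(\<lambda>n. ivl_integral f (I n)) = (\<lambda>n. ivl_integral g (I n))" if "simple_cover g S I s" for I s
    using that by (intro ext ivl_integral_cong eq) (auto simp: simple_cover_def)
  have cov: "simple_cover f S I s \<longleftrightarrow> simple_cover g S I s" for I s by (rule simple_cover_cong[OF eq])
  show ?thesis unfolding lc_has_integral_def
  proof (intro conjI allI impI)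
    show "g \<in> measurable_funs S"
      using f by (simp add: lc_has_integral_def measurable_funs_def cov)
    fix e :: lc assume "0 < e"
    then obtain d where d: "0 < d" "\<And>I s. simple_cover f S I s \<Longrightarrow> lc_measure S - s < d \<Longrightarrow>
        \<exists>w. strong_sums (\<lambda>n. ivl_integral f (I n)) w \<and> \<bar>w - v\<bar> < e"
      using f unfolding lc_has_integral_def by blast
    have "\<exists>w. strong_sums (\<lambda>n. ivl_integral g (I n)) w \<and> \<bar>w - v\<bar> < e"
      if "simple_cover g S I s" "lc_measure S - s < d" for I s
      using d(2)[OF cov[THEN iffD2, OF that(1)] that(2)] unfolding ints[OF that(1)] .
    then show "\<exists>d>0. \<forall>I s. simple_cover g S I s \<longrightarrow> lc_measure S - s < d \<longrightarrow>
        (\<exists>w. strong_sums (\<lambda>n. ivl_integral g (I n)) w \<and> \<bar>w - v\<bar> < e)"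
      using d(1) by blast
  qed
qed

text \<open>A nonnegative function is its own absolute value, so the norm is the integral
  itself.\<close>

lemma dirac_like_has_integral:
  assumes "dirac_like S r g"
  shows "lc_has_integral g 1 S"
proof -
  have "g \<in> L1 S" and nonneg: "\<And>x. x \<in> S \<Longrightarrow> 0 \<le> g x" and n1: "norm1 S g = 1"
    using assms by (auto simp: dirac_like_def)
  then obtain v where v: "lc_has_integral (\<lambda>x. \<bar>g x\<bar>) v S" unfolding L1_def lc_integrable_def by blast
  then have "v = 1" using n1 lc_integral_eqI[OF v] by (simp add: norm1_def)
  show ?thesis by (rule lc_has_integral_cong[OF _ v[unfolded \<open>v = 1\<close>]]) (simp add: nonneg)
qed

section \<open>Polynomials on bounded sets\<close>

lemma canonical_extension_0 [simp]: "canonical_extension 0 x = 0"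
  by (simp add: canonical_extension_def)

lemma canonical_extension_pCons [simp]:
  "canonical_extension (pCons c p) x = of_real c + x * canonical_extension p x"
  by (simp add: canonical_extension_def map_poly_pCons)

lemma canonical_extension_bounded:
  assumes "\<And>x. x \<in> S \<Longrightarrow> \<bar>x\<bar> \<le> of_real R"
  shows "\<exists>C>0. \<forall>x\<in>S. \<bar>canonical_extension p x\<bar> \<le> of_real C"
proof (induction p)
  case 0
  show ?case by (intro exI[of _ 1]) auto
next
  case (pCons c p)
  then obtain C where C: "0 < C" "\<And>x. x \<in> S \<Longrightarrow> \<bar>canonical_extension p x\<bar> \<le> of_real C" by blast
  have "\<bar>canonical_extension (pCons c p) x\<bar> \<le> of_real (\<bar>c\<bar> + \<bar>R\<bar> * C + 1)" if x: "x \<in> S" for x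
  proof -
    have R: "0 \<le> R" using order.trans[OF abs_ge_zero assms[OF x]] by simp
    have "\<bar>x * canonical_extension p x\<bar> \<le> of_real R * of_real C"
      unfolding abs_mult using assms[OF x] C(2)[OF x] R by (intro mult_mono) auto
    then have "\<bar>of_real c + x * canonical_extension p x\<bar> \<le> of_real \<bar>c\<bar> + of_real R * of_real C"
      by (intro order.trans[OF abs_triangle_ineq] add_mono) auto
    also have "\<dots> = of_real (\<bar>c\<bar> + \<bar>R\<bar> * C)" using R by simp
    also have "\<dots> \<le> of_real (\<bar>c\<bar> + \<bar>R\<bar> * C + 1)" by (simp only: of_real_lc_le_iff)
    finally show ?thesis by simp
  qed
  moreover have "0 < \<bar>c\<bar> + \<bar>R\<bar> * C + 1" using C(1) by (simp add: add_nonneg_pos)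
  ultimately show ?case by blast
qed

text \<open>The constant is real, so at points infinitely close to \<open>r\<close> the deviation
  from the value at \<open>r\<close> is infinitesimal. The recursion splits
  \<open>x * p x - r * p r\<close> into \<open>p x * (x - r) + r * (p x - p r)\<close>.\<close>

lemma canonical_extension_Lipschitz_at:
  assumes S: "\<And>x. x \<in> S \<Longrightarrow> \<bar>x\<bar> \<le> of_real R"
  shows "\<exists>L. \<forall>x\<in>S. \<bar>canonical_extension p x - of_real (poly p r)\<bar> \<le> of_real L * \<bar>x - of_real r\<bar>"
proof (induction p)
  case 0
  show ?case by (intro exI[of _ 0]) auto
next
  case (pCons c p)
  then obtain L where L: "\<And>x. x \<in> S \<Longrightarrow> \<bar>canonical_extension p x - of_real (poly p r)\<bar> \<le> of_real L * \<bar>x - of_real r\<bar>"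
    by blast
  obtain C where C: "\<And>x. x \<in> S \<Longrightarrow> \<bar>canonical_extension p x\<bar> \<le> of_real C"
    using canonical_extension_bounded[OF S, of S p] by blast
  have "\<bar>canonical_extension (pCons c p) x - of_real (poly (pCons c p) r)\<bar> \<le> of_real (C + \<bar>r\<bar> * L) * \<bar>x - of_real r\<bar>"
    if x: "x \<in> S" for x
  proof -
    have "canonical_extension (pCons c p) x - of_real (poly (pCons c p) r) =
      canonical_extension p x * (x - of_real r) + of_real r * (canonical_extension p x - of_real (poly p r))"
      by (simp add: algebra_simps)
    also have "\<bar>\<dots>\<bar> \<le> \<bar>canonical_extension p x\<bar> * \<bar>x - of_real r\<bar> + of_real \<bar>r\<bar> * \<bar>canonical_extension p x - of_real (poly p r)\<bar>"
      by (rule order.trans[OF abs_triangle_ineq]) (simp add: abs_mult)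
    also have "\<dots> \<le> of_real C * \<bar>x - of_real r\<bar> + of_real \<bar>r\<bar> * (of_real L * \<bar>x - of_real r\<bar>)"
      using C[OF x] L[OF x] by (intro add_mono mult_right_mono mult_left_mono) auto
    also have "\<dots> = of_real (C + \<bar>r\<bar> * L) * \<bar>x - of_real r\<bar>" by (simp add: algebra_simps)
    finally show ?thesis .
  qed
  then show ?case by blast
qed

lemma integral_dirac_like_polynomial:
  fixes a b r :: real
  assumes "a < b" and D: "dirac_like {of_real a..of_real b} (of_real r) \<delta>"
  obtains w where "lc_has_integral (\<lambda>x. \<delta> x * canonical_extension p x) w {of_real a..of_real b}"
    "infsml (w - of_real (poly p r))"
proof -
  let ?S = "{of_real a..of_real b} :: lc set"
  have nonneg: "\<And>x. x \<in> ?S \<Longrightarrow> 0 \<le> \<delta> x" using D by (simp add: dirac_like_def)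
  obtain h where h: "h \<in> nonzero_infinitesimals" "0 < h"
    and supp: "{x \<in> ?S. \<delta> x \<noteq> 0} \<subseteq> {of_real r - h..of_real r + h}"
    using D unfolding dirac_like_def by blast
  have "ereal 0 < ereal (of_rat (lc_lead h))"
    using h by (auto simp: nonzero_infinitesimals_def lc_val_def split: if_splits)
  then have "0 < lc_lead h" by simp
  then have hinf: "infsml h" unfolding infsml_def using ord_ge_lead by blast
  have bnd: "\<bar>x\<bar> \<le> of_real (max \<bar>a\<bar> \<bar>b\<bar>)" if "x \<in> ?S" for x
  proof -
    have "of_real a \<le> x" "x \<le> of_real b" using that by auto
    moreover have "(of_real b :: lc) \<le> of_real (max \<bar>a\<bar> \<bar>b\<bar>)" "of_real (- max \<bar>a\<bar> \<bar>b\<bar>) \<le> (of_real a :: lc)"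
      unfolding of_real_lc_le_iff by linarith+
    ultimately show ?thesis unfolding abs_le_iff of_real_minus by linarith
  qed
  obtain C where C: "0 < C" "\<And>x. x \<in> ?S \<Longrightarrow> \<bar>canonical_extension p x\<bar> \<le> of_real C"
    using canonical_extension_bounded[of ?S, OF bnd] by blast
  obtain L where L: "\<And>x. x \<in> ?S \<Longrightarrow> \<bar>canonical_extension p x - of_real (poly p r)\<bar> \<le> of_real L * \<bar>x - of_real r\<bar>"
    using canonical_extension_Lipschitz_at[of ?S, OF bnd] by blast
  interpret dominated_integrand "of_real a" "of_real b" "of_real C" 1 \<delta> "\<lambda>x. \<delta> x * canonical_extension p x"
  proof
    show "lc_has_integral \<delta> 1 ?S" by (rule dirac_like_has_integral[OF D])
    show "\<bar>\<delta> x * canonical_extension p x\<bar> \<le> of_real C * \<delta> x" if "x \<in> ?S" for x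
      using mult_right_mono[OF C(2)[OF that] nonneg[OF that]] nonneg[OF that] by (simp add: abs_mult mult.commute)
    show "simple_on (\<lambda>x. \<delta> x * canonical_extension p x) (ivl_set K)" if "simple_on \<delta> (ivl_set K)" for K
      unfolding canonical_extension_def by (rule simple_on_mult_poly[OF that])
  qed (use assms C in auto)
  obtain w where w: "lc_has_integral (\<lambda>x. \<delta> x * canonical_extension p x) w ?S"
    and est: "\<And>\<rho> \<epsilon>. (\<And>x. x \<in> ?S \<Longrightarrow> \<bar>\<delta> x * canonical_extension p x - \<rho> * \<delta> x\<bar> \<le> \<epsilon> * \<delta> x) \<Longrightarrow> \<bar>w - \<rho> * 1\<bar> \<le> \<epsilon> * 1"
    using integral_G by blast
  \<comment> \<open>Here \<open>\<rho>\<close> is the value at \<open>r\<close> and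
    \<open>\<epsilon>\<close> is \<open>\<bar>L\<bar> * h\<close>: where \<open>\<delta>\<close>
    does not vanish, the distance to \<open>r\<close> is at most \<open>h\<close>, and elsewhere
    both sides are 0.\<close>
  have "\<bar>w - of_real (poly p r) * 1\<bar> \<le> of_real \<bar>L\<bar> * h * 1"
  proof (rule est)
    fix x assume x: "x \<in> ?S"
    show "\<bar>\<delta> x * canonical_extension p x - of_real (poly p r) * \<delta> x\<bar> \<le> of_real \<bar>L\<bar> * h * \<delta> x"
    proof (cases "\<delta> x = 0")
      case False
      then have "\<bar>x - of_real r\<bar> \<le> h" using supp x by (auto simp: abs_le_iff)
      then have "of_real \<bar>L\<bar> * \<bar>x - of_real r\<bar> \<le> of_real \<bar>L\<bar> * h" by (intro mult_left_mono) auto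
      moreover have "of_real L * \<bar>x - of_real r\<bar> \<le> of_real \<bar>L\<bar> * \<bar>x - of_real r\<bar>"
        by (intro mult_right_mono) (simp_all only: of_real_lc_le_iff abs_ge_self abs_ge_zero)
      ultimately have "\<bar>canonical_extension p x - of_real (poly p r)\<bar> \<le> of_real \<bar>L\<bar> * h"
        using L[OF x] by linarith
      then have "\<bar>canonical_extension p x - of_real (poly p r)\<bar> * \<delta> x \<le> of_real \<bar>L\<bar> * h * \<delta> x"
        using nonneg[OF x] by (intro mult_right_mono)
      moreover have "\<delta> x * canonical_extension p x - of_real (poly p r) * \<delta> x =
        (canonical_extension p x - of_real (poly p r)) * \<delta> x" by (simp add: algebra_simps)
      ultimately show ?thesis using nonneg[OF x] by (simp only: abs_mult abs_of_nonneg)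
    qed simp
  qed
  then have "\<bar>w - of_real (poly p r)\<bar> \<le> h * of_real \<bar>L\<bar>" by (simp add: mult.commute)
  then have "infsml (w - of_real (poly p r))"
    by (rule infsml_of_abs_le) (intro infsml_mult hinf ord_ge_of_real)
  then show thesis using that w by blast
qed

lemma standard_part_near_real:
  assumes "infsml (w - of_real x)"
  shows "lc_coeff w 0 = x" "standard_part w = ereal x"
proof -
  have o: "ord_ge 0 (w - of_real x)" "lc_coeff (w - of_real x) 0 = 0" using assms by (simp_all add: infsml_iff)
  then show c: "lc_coeff w 0 = x" by simp
  have "ord_ge 0 w" using ord_ge_add[OF o(1) ord_ge_of_real[of x]] by simp
  then have "0 \<le> lc_val w" by (auto simp: lc_val_def ord_ge_iff_lead)
  then show "standard_part w = ereal x" by (simp add: standard_part_def c)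
qed

text \<open>Weierstrass provides a polynomial within \<open>e / 2\<close>; from its degree on, the
  best approximation is at least as close in the supremum norm, in particular at
  \<open>r\<close>.\<close>

lemma best_approx_tendsto:
  fixes f :: "real \<Rightarrow> real"
  assumes "continuous_on {a..b} f" "\<And>n. best_approx a b f n (p n)" "r \<in> {a..b}"
  shows "(\<lambda>n. poly (p n) r) \<longlonglongrightarrow> f r"
proof (rule LIMSEQ_I)
  fix e :: real assume e: "0 < e"
  obtain g where g: "real_polynomial_function g" "\<And>x. x \<in> {a..b} \<Longrightarrow> \<bar>f x - g x\<bar> < e / 2"
    using Stone_Weierstrass_real_polynomial_function[of "{a..b}" f "e / 2"] assms(1) e by auto
  then obtain c m where gs: "g = (\<lambda>x. \<Sum>i\<le>m. c i * x ^ i)"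
    using real_polynomial_function_iff_sum by blast
  define q where "q = (\<Sum>i\<le>m. monom (c i) i)"
  have gq: "g x = poly q x" for x by (simp add: gs q_def poly_sum poly_monom)
  have ne: "{a..b} \<noteq> {}" using assms(3) by auto
  have "norm (poly (p n) r - f r) < e" if n: "n \<ge> degree q" for n
  proof -
    have "compact ((\<lambda>x. \<bar>f x - poly (p n) x\<bar>) ` {a..b})"
      by (intro compact_continuous_image continuous_intros assms(1)) auto
    then have "bdd_above ((\<lambda>x. \<bar>f x - poly (p n) x\<bar>) ` {a..b})"
      by (intro bounded_imp_bdd_above compact_imp_bounded)
    then have "\<bar>f r - poly (p n) r\<bar> \<le> sup_norm a b (\<lambda>x. f x - poly (p n) x)"
      unfolding sup_norm_def by (rule cSUP_upper[OF assms(3)])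
    also have "\<dots> \<le> sup_norm a b (\<lambda>x. f x - poly q x)"
      using assms(2)[of n] n unfolding best_approx_def by blast
    also have "\<dots> \<le> e / 2" unfolding sup_norm_def
      by (rule cSUP_least[OF ne]) (use g(2) gq in \<open>auto intro: less_imp_le\<close>)
    finally show ?thesis using e by (simp add: abs_minus_commute)
  qed
  then show "\<exists>no. \<forall>n\<ge>no. norm (poly (p n) r - f r) < e" by blast
qed

text \<open>Integrability belongs to the conclusion because \<open>lc_integral\<close> is a definite
  description and says nothing about the integral unless it exists.\<close>

theorem proposition5p6:
  fixes a b r :: real
    and \<delta> :: "lc \<Rightarrow> lc"
    and f :: "real \<Rightarrow> real"
    and p :: "nat \<Rightarrow> real poly"
  assumes "a < b"
    and "r \<in> {a..b}" and "r \<noteq> a" and "r \<noteq> b"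
    and "dirac_like {of_real a..of_real b} (of_real r) \<delta>"
    and "continuous_on {a..b} f"
    and "\<And>n. best_approx a b f n (p n)"
  shows "(\<forall>n. lc_integrable (\<lambda>x. \<delta> x * canonical_extension (p n) x) {of_real a..of_real b})
    \<and> (\<lambda>n. standard_part (lc_integral {of_real a..of_real b} (\<lambda>x. \<delta> x * canonical_extension (p n) x)))
        \<longlonglongrightarrow> ereal (f r)
    \<and> (\<lambda>n. lc_coeff (lc_integral {of_real a..of_real b} (\<lambda>x. \<delta> x * canonical_extension (p n) x)) 0)
        \<longlonglongrightarrow> f r"
proof -
  have int: "\<exists>w. lc_has_integral (\<lambda>x. \<delta> x * canonical_extension (p n) x) w {of_real a..of_real b} \<and>
    infsml (w - of_real (poly (p n) r))" for n
    using integral_dirac_like_polynomial[OF assms(1,5)] by blast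
  have val: "lc_coeff (lc_integral {of_real a..of_real b} (\<lambda>x. \<delta> x * canonical_extension (p n) x)) 0 = poly (p n) r"
    "standard_part (lc_integral {of_real a..of_real b} (\<lambda>x. \<delta> x * canonical_extension (p n) x)) = ereal (poly (p n) r)" for n
    using int[of n] standard_part_near_real lc_integral_eqI by auto
  have "(\<lambda>n. poly (p n) r) \<longlonglongrightarrow> f r" by (rule best_approx_tendsto) (use assms in auto)
  then show ?thesis unfolding val using int by (auto simp: lc_integrable_def tendsto_ereal)
qed

end
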